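(* Fix $\rho\in[0,1)$. Let $\{b_n^0\}_{n\in\mathbb Z}$ be an initial datum of the form $$b_n^0=a_n(A^0,\rho)\bigl(1+\varepsilon_n^0\bigr),\qquad n\in\mathbb Z,$$ for some $A^0>0$ and $\varepsilon_n^0\in\mathbb R$, and let $M=\sum_{n=-\infty}^\infty 2^{n+\rho}b_n^0$ be the initial mass. There exists $\delta_0>0$, depending on $M$, such that if $$|A^0-A_M|\le\delta_0,\qquad |\varepsilon_n^0|\le\delta_0\quad\text{for all } n\in\mathbb Z,$$ then there exists a solution $\{b_n(t)\}_{n\in\mathbb Z}$, $t\geq0$, to the system $$\frac{d b_n}{d t} = \frac{\gamma(2^{n+\rho})}{4}\Bigl( \zeta_{n-1,\rho}\,b_{n-1}(t)^2 - b_n(t) \Bigr) - \frac{\gamma(2^{n+1+\rho})}{2}\Bigl( \zeta_{n,\rho}\,b_{n}(t)^2 - b_{n+1}(t) \Bigr),\qquad n\in\mathbb Z,$$ with $b_n(0)=b_n^0$, which can be expressed as $$b_n(t)=a_n(A(t),\rho)\bigl(1+\varepsilon_n(t)\bigr)\qquad\text{for every } t>0 \text{ and } n\in\mathbb Z,$$ for suitable functions $A(t)>0$ and $\varepsilon_n(t)\in\mathbb R$. Moreover, for every $t>0$ one has the estimates $$\sup_{n\le0}|\varepsilon_n(t)|+\sup_{n\ge0}2^{(\beta-1)n}|\varepsilon_n(t)|\le\bigl(1+t^{-\frac{\beta-1}{\beta}}\bigr)e^{-\nu t},\qquad \Bigl|\frac{dA}{dt}(t)\Bigr|\le\bigl(1+t^{-\frac{\beta-1}{\beta}}\bigr)e^{-\nu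 t},$$ where $\nu>0$ depends only on $M$. Finally, $A(t)\to A_M$ as $t\to\infty$.
   Context: Kernel functions (fixed throughout; constants may depend on them without this being mentioned). Let $\alpha\in(0,1)$, $\beta\in(1,2)$, $\bar\alpha,\bar\beta>1$, $k_0,\gamma_0>0$. The function $k\in C([0,\infty))$ is strictly positive with $k(\xi)\sim\xi^{\alpha+1}$ (ratio tending to $1$) as $\xi\to\infty$ and $k(\xi)=k_0+O(\xi^{\bar\alpha})$ as $\xi\to0^+$. The function $\gamma\in C((0,\infty))$ is strictly positive with $\gamma(\xi)\sim\xi^\beta$ as $\xi\to\infty$ and $\gamma(\xi)=\gamma_0+O(\xi^{\bar\beta})$ as $\xi\to0^+$. Stationary coefficients. For $\rho\in[0,1)$ and $n\in\mathbb Z$ set $$\zeta_{n,\rho}:=\frac{\ln2}{2^{n+\rho}}\,\frac{k(2^{n+\rho})}{\gamma(2^{n+\rho+1})},\qquad \vartheta_{n,\rho}:=\frac{2\zeta_{n+1,\rho}}{\zeta_{n,\rho}}.$$ For $A>0$ let $$\alpha_n(A,\rho):=e^{-A2^n}\exp\Bigl(-2^n\sum_{j=n+1}^\infty2^{-j}\ln\vartheta_{j-1,\rho}\Bigr),\qquad a_n(A,\rho):=\frac{2\alpha_n(A,\rho)}{\zeta_{n,\rho}}.$$ The sequence $\{a_n(A,\rho)\}_{n\in\mathbb Z}$ is positive and satisfies $a_{n+1}=\zeta_{n,\rho}a_n^2$, and the map $A\mapsto\sum_{n}2^{n+\rho}a_n(A,\rho)$ is a bijection of $(0,\infty)$ onto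 $(0,\infty)$. For $M>0$, $A_M$ denotes the unique value $A>0$ such that $\sum_{n\in\mathbb Z}2^{n+\rho}a_n(A,\rho)=M$ (for the fixed $\rho$). The system in the claim is the evolution equation for the coefficients of solutions concentrated in Dirac masses, $g(x,t)=\sum_{n}b_n(t)\delta(x-n-\rho)$, of a coagulation-fragmentation equation in logarithmic variables. *)

theory Defs
  imports "HOL-Analysis.Analysis" "HOL-Library.Landau_Symbols"
begin

text \<open>
  The coagulation kernel \<open>k\<close> lives on $[0,\infty)$ and the fragmentation kernel \<open>\<gamma>\<close> on
  $(0,\infty)$; both are total functions here, whose values elsewhere are irrelevant.
\<close>

locale coag_frag_kernels =
  fixes \<alpha> \<beta> \<alpha>bar \<beta>bar k0 \<gamma>0 :: real and k \<gamma> :: "real \<Rightarrow> real"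
  assumes alpha: "0 < \<alpha>" "\<alpha> < 1"
    and beta: "1 < \<beta>" "\<beta> < 2"
    and alphabar: "1 < \<alpha>bar"
    and betabar: "1 < \<beta>bar"
    and k0_pos: "0 < k0"
    and gamma0_pos: "0 < \<gamma>0"
    and k_cont: "continuous_on {0..} k"
    and k_pos: "\<And>\<xi>. 0 \<le> \<xi> \<Longrightarrow> 0 < k \<xi>"
    and k_at_top: "k \<sim>[at_top] (\<lambda>\<xi>. \<xi> powr (\<alpha> + 1))"
    and k_at_0: "(\<lambda>\<xi>. k \<xi> - k0) \<in> O[at_right 0](\<lambda>\<xi>. \<xi> powr \<alpha>bar)"
    and gamma_cont: "continuous_on {0<..} \<gamma>"
    and gamma_pos: "\<And>\<xi>. 0 < \<xi> \<Longrightarrow> 0 < \<gamma> \<xi>"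
    and gamma_at_top: "\<gamma> \<sim>[at_top] (\<lambda>\<xi>. \<xi> powr \<beta>)"
    and gamma_at_0: "(\<lambda>\<xi>. \<gamma> \<xi> - \<gamma>0) \<in> O[at_right 0](\<lambda>\<xi>. \<xi> powr \<beta>bar)"

definition zeta :: "(real \<Rightarrow> real) \<Rightarrow> (real \<Rightarrow> real) \<Rightarrow> real \<Rightarrow> int \<Rightarrow> real" where
  "zeta k \<gamma> \<rho> n =
     ln 2 / 2 powr (of_int n + \<rho>) *
       (k (2 powr (of_int n + \<rho>)) / \<gamma> (2 powr (of_int n + \<rho> + 1)))"

definition vartheta :: "(real \<Rightarrow> real) \<Rightarrow> (real \<Rightarrow> real) \<Rightarrow> real \<Rightarrow> int \<Rightarrow> real" where
  "vartheta k \<gamma> \<rho> n = 2 * zeta k \<gamma> \<rho> (n + 1) / zeta k \<gamma> \<rho> n"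

text \<open>The series over $j \ge n+1$ is indexed by \<open>i :: nat\<close> through $j = n + 1 + i$.\<close>

definition alpha_coeff ::
    "(real \<Rightarrow> real) \<Rightarrow> (real \<Rightarrow> real) \<Rightarrow> real \<Rightarrow> real \<Rightarrow> int \<Rightarrow> real" where
  "alpha_coeff k \<gamma> A \<rho> n =
     exp (- A * 2 powi n) *
     exp (- (2 powi n) *
       (\<Sum>i. let j = n + 1 + int i in 2 powi (- j) * ln (vartheta k \<gamma> \<rho> (j - 1))))"

definition a_coeff ::
    "(real \<Rightarrow> real) \<Rightarrow> (real \<Rightarrow> real) \<Rightarrow> real \<Rightarrow> real \<Rightarrow> int \<Rightarrow> real" where
  "a_coeff k \<gamma> A \<rho> n = 2 * alpha_coeff k \<gamma> A \<rho> n / zeta k \<gamma> \<rho> n"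

definition has_mass :: "real \<Rightarrow> (int \<Rightarrow> real) \<Rightarrow> real \<Rightarrow> bool" where
  "has_mass \<rho> b M \<longleftrightarrow> ((\<lambda>n. 2 powr (of_int n + \<rho>) * b n) has_sum M) UNIV"

text \<open>
  For $M > 0$ and kernels as above the description is uniquely satisfied, since the mass
  of \<open>a_coeff k \<gamma> A \<rho>\<close> is a bijection of $(0,\infty)$ onto itself as a function of \<open>A\<close>.
\<close>

definition A_of_mass ::
    "(real \<Rightarrow> real) \<Rightarrow> (real \<Rightarrow> real) \<Rightarrow> real \<Rightarrow> real \<Rightarrow> real" where
  "A_of_mass k \<gamma> \<rho> M = (THE A. 0 < A \<and> has_mass \<rho> (a_coeff k \<gamma> A \<rho>) M)"

definition coeff_rhs ::
    "(real \<Rightarrow> real) \<Rightarrow> (real \<Rightarrow> real) \<Rightarrow> real \<Rightarrow> (int \<Rightarrow> real) \<Rightarrow> int \<Rightarrow> real" where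
  "coeff_rhs k \<gamma> \<rho> b n =
     \<gamma> (2 powr (of_int n + \<rho>)) / 4 * (zeta k \<gamma> \<rho> (n - 1) * (b (n - 1))\<^sup>2 - b n)
     - \<gamma> (2 powr (of_int n + 1 + \<rho>)) / 2 * (zeta k \<gamma> \<rho> n * (b n)\<^sup>2 - b (n + 1))"

text \<open>
  The derivative is one-sided at \<open>t = 0\<close>, so every coefficient is $C^1$ on $[0,\infty)$.
\<close>

definition solves_coeff_system ::
    "(real \<Rightarrow> real) \<Rightarrow> (real \<Rightarrow> real) \<Rightarrow> real \<Rightarrow> (int \<Rightarrow> real) \<Rightarrow> (real \<Rightarrow> int \<Rightarrow> real) \<Rightarrow> bool" where
  "solves_coeff_system k \<gamma> \<rho> b0 b \<longleftrightarrow>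
     (\<forall>n. b 0 n = b0 n) \<and>
     (\<forall>n. \<forall>t\<ge>0. ((\<lambda>s. b s n) has_real_derivative coeff_rhs k \<gamma> \<rho> (b t) n) (at t within {0..}))"

text \<open>
  $\sup_{n\le 0} |e_n| + \sup_{n\ge 0} 2^{(\beta-1)n} |e_n|$, taken in the extended reals so that
  a finite bound really bounds every term.
\<close>

definition weighted_sup_norm :: "real \<Rightarrow> (int \<Rightarrow> real) \<Rightarrow> ereal" where
  "weighted_sup_norm \<beta> e =
     (SUP n\<in>{..0}. ereal \<bar>e n\<bar>) +
     (SUP n\<in>{0..}. ereal (2 powr ((\<beta> - 1) * of_int n) * \<bar>e n\<bar>))"

end

theory Submission
  imports Defs "HOL-Complex_Analysis.Great_Picard"
begin

text \<open>
The coefficients form a reversible reaction network: with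
  $J_n = \frac{\gamma_n}{4}(\zeta_{n-1} b_{n-1}^2 - b_n)$, where $\gamma_n = \gamma(2^{n+\rho})$, the system reads
  $b_n' = J_n - 2 J_{n+1}$, and every $J_n$ vanishes on the whole family $a_n(A)$.  The proof follows
  the \<^emph>\<open>defect\<close> $p_n = 2^{-n}(1 - \zeta_{n-1} b_{n-1}^2 / b_n)$, which is zero exactly on this family and
  therefore does not see the parameter $A$.  With $D_n = \gamma_n/4$, $R_n = 4 D_{n+1} b_{n+1}/b_n$ and
  $q_n = 1 - 2^n p_n$ it satisfies
  \[ p_n' = q_n \bigl( D_{n-1} p_{n-1} + R_n p_{n+1} - (D_n + R_{n-1}) p_n \bigr), \]
  a system whose off-diagonal coefficients are positive (\<open>defect_derivative\<close>).  Hence every positive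
  strict supersolution of the bracket is a barrier for $|p_n|$, however the factor $q_n > 0$ behaves.

  Near a stationary state $R_n$ is close to $U_n = 4 D_{n+1} a_{n+1}/a_n$, and then the bracket acts on the
  increments of a function under the generator of a birth-death chain with death rates $D_n$ and
  birth rates $U_n$.  At $-\infty$ this chain drifts upwards ($U_n \to 2\gamma_0$, $D_n \to \gamma_0/4$); at $+\infty$ it
  comes down instantly, since $D_n \sim 2^{\beta n}/4$ while $U_n$ is superexponentially small.  So there are
  weights $w_n(s)$ that make the bracket at most $-2(\nu w_n + |\partial_s w_n|)$
  (\<open>supersolution_weights\<close>).  They behave like $2^{-n}$ for $s = 0$, the size of
  the defect of the initial datum, and like $s^{-\theta} 2^{-\beta n}$ for $s > 0$ and large $n$, where
  $\theta = (\beta-1)/\beta$; with $s = 1 - e^{-t}$ the barrier $\mu e^{-\nu t} w_n(s)$ contains both the smoothing and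
  the exponential decay.  All constants come from bounds on $D_n$ and $a_{n+1}/a_n$ that are uniform in
  $\rho$, which is why $\nu$ depends on $M$ only.

  Solutions are produced on finite truncations, where the flux through the ends is switched off: this
  keeps the equation for $p_n$ and only drops positive terms from the bracket, so the barrier applies to each
  truncation (\<open>truncated_a_priori\<close>), and compactness gives a global solution with the same bound
  (\<open>global_solution\<close>).

  For that solution put $z_n = 2^{-n} \ln (b_n / a_n)$, where $a_n = a_n(A_M)$.  Its increments are comparable
  to $p_n$, so $z_n$ converges as $n \to \infty$, and $A(t) = A_M - \lim_n z_n(t)$ is the only parameter for
  which $b_n / a_n(A(t)) \to 1$ at $+\infty$; the tail of the series of increments bounds $\varepsilon_n$
  (\<open>excess_bound\<close>).  Since $z_n' = -D_n p_n + R_n p_{n+1}$, differentiability of $A$ amounts to the locally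
  uniform convergence of $D_n p_n$, which holds because each $D_n p_n$ relaxes at the fast rate $D_n$ towards
  its predecessor (\<open>scaled_defect_increments\<close>).  Finally mass is conserved and $\varepsilon_n(t) \to 0$ uniformly, so
  the mass of $a(A(t))$ tends to $M$ and $A(t) \to A_M$.
\<close>

section \<open>Comparison and compactness for reaction networks\<close>

text \<open>
  At the first time at which one of finitely many functions reaches its barrier, it does so with a
  derivative pointing strictly inwards, so it must already have been outside just before.
\<close>

lemma first_touching:
  fixes x y x' y' :: "'i \<Rightarrow> real \<Rightarrow> real"
  assumes fin: "finite I"
    and contx: "\<And>i. i \<in> I \<Longrightarrow> continuous_on {0..} (x i)"
    and conty: "\<And>i. i \<in> I \<Longrightarrow> continuous_on {0..} (y i)"
    and init: "\<And>i. i \<in> I \<Longrightarrow> \<bar>x i 0\<bar> < y i 0"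
    and derx: "\<And>i t. i \<in> I \<Longrightarrow> 0 < t \<Longrightarrow> (x i has_real_derivative x' i t) (at t)"
    and dery: "\<And>i t. i \<in> I \<Longrightarrow> 0 < t \<Longrightarrow> (y i has_real_derivative y' i t) (at t)"
    and touch: "\<And>i t. i \<in> I \<Longrightarrow> 0 < t \<Longrightarrow> (\<forall>j\<in>I. \<bar>x j t\<bar> \<le> y j t) \<Longrightarrow> \<bar>x i t\<bar> = y i t
                  \<Longrightarrow> sgn (x i t) * x' i t < y' i t"
    and pos: "\<And>i t. i \<in> I \<Longrightarrow> 0 \<le> t \<Longrightarrow> 0 < y i t"
    and "i \<in> I" "0 \<le> t"
  shows "\<bar>x i t\<bar> < y i t"
proof (rule ccontr)
  assume neg: "\<not> \<bar>x i t\<bar> < y i t"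
  define S where "S = (\<Union>j\<in>I. {s\<in>{0..}. y j s - \<bar>x j s\<bar> \<le> 0})"
  have cl: "closed S"
    unfolding S_def
  proof (intro closed_UN[OF fin] ballI)
    fix j assume j: "j \<in> I"
    have "continuous_on {0..} (\<lambda>s. y j s - \<bar>x j s\<bar>)"
      by (intro continuous_intros conty contx j)
    then show "closed {s\<in>{0..}. y j s - \<bar>x j s\<bar> \<le> 0}"
      by (intro continuous_on_closed_Collect_le) (auto intro!: continuous_intros)
  qed
  have "t \<in> S" using neg \<open>i \<in> I\<close> \<open>0 \<le> t\<close> by (auto simp: S_def not_less)
  then have ne: "S \<noteq> {}" by blast
  have bdd: "bdd_below S" by (auto simp: S_def bdd_below_def)
  define T where "T = Inf S"
  have TS: "T \<in> S" unfolding T_def using closed_contains_Inf[OF ne bdd cl] .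
  then obtain j where j: "j \<in> I" and jT: "y j T \<le> \<bar>x j T\<bar>" and T0: "0 \<le> T" by (auto simp: S_def)
  have Tpos: "0 < T" using init[OF j] jT T0 by (cases "T = 0") auto
  have before: "\<bar>x m s\<bar> < y m s" if "m \<in> I" "0 \<le> s" "s < T" for m s
  proof (rule ccontr)
    assume "\<not> ?thesis"
    then have "s \<in> S" using that by (auto simp: S_def not_less)
    then show False using cInf_lower[OF _ bdd, of s] that by (auto simp: T_def)
  qed
  have atT: "\<bar>x m T\<bar> \<le> y m T" if m: "m \<in> I" for m
  proof -
    have c: "continuous (at T) (\<lambda>s. y m s - \<bar>x m s\<bar>)"
      by (intro continuous_intros DERIV_isCont[OF derx] DERIV_isCont[OF dery] m Tpos)
    have "((\<lambda>s. y m s - \<bar>x m s\<bar>) \<longlongrightarrow> y m T - \<bar>x m T\<bar>) (at_left T)"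
      using c by (simp add: continuous_at filterlim_at_split)
    moreover have "eventually (\<lambda>s. 0 \<le> y m s - \<bar>x m s\<bar>) (at_left T)"
      using eventually_at_left[OF Tpos, of "\<lambda>s. 0 \<le> y m s - \<bar>x m s\<bar>"] before[OF m] Tpos
      by (auto intro!: exI[of _ 0] simp: less_imp_le)
    ultimately have "0 \<le> y m T - \<bar>x m T\<bar>"
      by (rule tendsto_lowerbound) simp
    then show ?thesis by simp
  qed
  have eq: "\<bar>x j T\<bar> = y j T" using atT[OF j] jT by simp
  have lt: "sgn (x j T) * x' j T < y' j T" using touch[OF j Tpos _ eq] atT by blast
  define g where "g = (\<lambda>s. y j s - sgn (x j T) * x j s)"
  have "(g has_real_derivative (y' j T - sgn (x j T) * x' j T)) (at T)"
    unfolding g_def by (auto intro!: derivative_eq_intros derx dery j Tpos)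
  from DERIV_pos_inc_left[OF this] lt
  obtain d where d: "d > 0" and dd: "\<And>h. 0 < h \<Longrightarrow> h < d \<Longrightarrow> g (T - h) < g T"
    by auto
  define h where "h = min (d/2) (T/2)"
  have h: "0 < h" "h < d" "h < T" using d Tpos by (auto simp: h_def)
  have "g T = 0" using eq by (simp add: g_def sgn_mult_self_eq abs_sgn mult.commute)
  then have "g (T - h) < 0" using dd h by force
  moreover have "sgn (x j T) * x j (T - h) \<le> \<bar>x j (T - h)\<bar>"
    by (cases "x j T" "0::real" rule: linorder_cases) auto
  moreover have "\<bar>x j (T - h)\<bar> < y j (T - h)" using before[OF j] h by simp
  ultimately show False by (simp add: g_def)
qed

text \<open>
  The right-hand side of the system with $\gamma_n / 4$ replaced by an arbitrary rate \<open>c n\<close>, so that setting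
  some rates to zero gives the truncated systems.
\<close>

definition net_flux :: "(int \<Rightarrow> real) \<Rightarrow> (int \<Rightarrow> real) \<Rightarrow> (int \<Rightarrow> real) \<Rightarrow> int \<Rightarrow> real" where
  "net_flux c \<zeta> b n = c n * (\<zeta> (n - 1) * (b (n - 1))\<^sup>2 - b n) - 2 * c (n + 1) * (\<zeta> n * (b n)\<^sup>2 - b (n + 1))"

lemma at_within_atLeast_eq_Icc:
  fixes t a :: real assumes "a \<le> t" "t < T" shows "at t within {a..} = at t within {a..T}"
  using assms by (intro at_within_nhd[of t "{..<T}"]) auto

lemma has_integral_exp_mult:
  fixes L t :: real assumes "0 \<le> t"
  shows "((\<lambda>s. exp (L * s) * (L * v)) has_integral (exp (L * t) - 1) * v) {0..t}"
proof -
  have "((\<lambda>s. exp (L * s) * (L * v)) has_integral exp (L * t) * v - exp (L * 0) * v) {0..t}"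
    using assms
    by (intro fundamental_theorem_of_calculus)
       (auto intro!: derivative_eq_intros simp: has_real_derivative_iff_has_vector_derivative[symmetric])
  then show ?thesis by (simp add: algebra_simps)
qed

text \<open>
  The linear problem solved in each step of the iteration below.
\<close>

lemma duhamel_derivative:
  fixes L c :: real
  assumes f: "continuous_on {0..} f" and "0 \<le> t"
  shows "((\<lambda>t. exp (- L * t) * (c + integral {0..t} (\<lambda>s. exp (L * s) * f s))) has_real_derivative
     f t - L * (exp (- L * t) * (c + integral {0..t} (\<lambda>s. exp (L * s) * f s)))) (at t within {0..})"
proof -
  have c: "continuous_on {0..t+1} (\<lambda>s. exp (L * s) * f s)"
    by (intro continuous_intros continuous_on_subset[OF f]) auto
  have "((\<lambda>x. integral {0..x} (\<lambda>s. exp (L * s) * f s)) has_real_derivative exp (L * t) * f t) (at t within {0..t+1})"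
    using integral_has_real_derivative[OF c, of t] \<open>0 \<le> t\<close> by simp
  then have *: "((\<lambda>x. integral {0..x} (\<lambda>s. exp (L * s) * f s)) has_real_derivative exp (L * t) * f t) (at t within {0..})"
    using at_within_atLeast_eq_Icc[of 0 t "t+1"] \<open>0 \<le> t\<close> by simp
  show ?thesis
    by (rule derivative_eq_intros * refl | simp)+ (simp add: exp_minus field_simps)
qed

text \<open>
  Adding \<open>\<Lambda> n * b n\<close> to both sides makes the right-hand side nondecreasing in every coordinate on the order
  interval between the sub- and the supersolution.  The Duhamel iterates therefore increase, stay in
  the interval, and converge to a solution.
\<close>

lemma monotone_iteration:
  fixes c \<zeta> l u b0 :: "int \<Rightarrow> real"
  assumes c: "\<And>n. 0 \<le> c n" and \<zeta>: "\<And>n. 0 \<le> \<zeta> n" and l: "\<And>n. 0 \<le> l n"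
    and lb: "\<And>n. l n \<le> b0 n" and bu: "\<And>n. b0 n \<le> u n"
    and Fl: "\<And>n. 0 \<le> net_flux c \<zeta> l n" and Fu: "\<And>n. net_flux c \<zeta> u n \<le> 0"
  shows "\<exists>b. (\<forall>n. b 0 n = b0 n) \<and>
    (\<forall>n. \<forall>t\<ge>0. ((\<lambda>s. b s n) has_real_derivative net_flux c \<zeta> (b t) n) (at t within {0..})) \<and>
    (\<forall>n. \<forall>t\<ge>0. l n \<le> b t n \<and> b t n \<le> u n)"
proof -
  \<comment> \<open>The derivative of the loss terms is at most $c_n + 4 c_{n+1} \zeta_n u_n$ below the supersolution.\<close>
  define \<Lambda> where "\<Lambda> = (\<lambda>n. c n + 4 * c (n + 1) * \<zeta> n * u n)"
  define H where "H = (\<lambda>b n. net_flux c \<zeta> b n + \<Lambda> n * b n)"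
  have u: "0 \<le> u n" for n using l lb bu order_trans by metis
  have H_mono: "H x n \<le> H y n" if xy: "\<And>m. l m \<le> x m" "\<And>m. x m \<le> y m" "\<And>m. y m \<le> u m" for x y n
  proof -
    have x0: "0 \<le> x m" for m using l xy order_trans by metis
    have y0: "0 \<le> y m" for m using x0 xy order_trans by metis
    have s: "(x m)\<^sup>2 \<le> (y m)\<^sup>2" for m using x0 xy by (simp add: power_mono)
    have 1: "c n * (\<zeta> (n - 1) * (x (n - 1))\<^sup>2) \<le> c n * (\<zeta> (n - 1) * (y (n - 1))\<^sup>2)"
      using c \<zeta> s by (intro mult_left_mono) auto
    have 2: "2 * c (n + 1) * x (n + 1) \<le> 2 * c (n + 1) * y (n + 1)"
      using c xy by (intro mult_left_mono) auto
    have "(y n)\<^sup>2 - (x n)\<^sup>2 = (y n + x n) * (y n - x n)" by (simp add: power2_eq_square algebra_simps)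
    also have "\<dots> \<le> (2 * u n) * (y n - x n)"
      using xy(2)[of n] xy(3)[of n] by (intro mult_right_mono) linarith+
    finally have "(2 * c (n + 1) * \<zeta> n) * ((y n)\<^sup>2 - (x n)\<^sup>2) \<le> (2 * c (n + 1) * \<zeta> n) * ((2 * u n) * (y n - x n))"
      using c \<zeta> by (intro mult_left_mono) auto
    then show ?thesis using 1 2
      unfolding H_def net_flux_def \<Lambda>_def by (simp add: algebra_simps)
  qed
  define X where "X = rec_nat (\<lambda>(t::real) n. l n)
     (\<lambda>_ f t n. exp (- \<Lambda> n * t) * (b0 n + integral {0..t} (\<lambda>s. exp (\<Lambda> n * s) * H (f s) n)))"
  have X0: "X 0 t n = l n" for t n by (simp add: X_def)
  have XS: "X (Suc k) t n = exp (- \<Lambda> n * t) * (b0 n + integral {0..t} (\<lambda>s. exp (\<Lambda> n * s) * H (X k s) n))" for k t n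
    by (simp add: X_def)
  have Xcont: "continuous_on {0..} (\<lambda>t. X k t n)" for k n
  proof (induction k arbitrary: n)
    case 0 show ?case by (simp add: X0)
  next
    case (Suc k)
    have "continuous_on {0..} (\<lambda>t. H (X k t) n)"
      unfolding H_def net_flux_def by (intro continuous_intros Suc)
    from duhamel_derivative[OF this] show ?case
      unfolding XS[abs_def] by (intro DERIV_continuous_on) auto
  qed
  have Hcont: "continuous_on {0..} (\<lambda>t. H (X k t) n)" for k n
    unfolding H_def net_flux_def by (intro continuous_intros Xcont)
  have Hint: "(\<lambda>s. exp (\<Lambda> n * s) * H (X k s) n) integrable_on {0..t}" for k n t
    by (intro integrable_continuous_real continuous_intros continuous_on_subset[OF Hcont]) auto
  have expv: "exp (- \<Lambda> n * t) * (v + integral {0..t} (\<lambda>s. exp (\<Lambda> n * s) * (\<Lambda> n * v))) = v" if "0 \<le> t" for n t v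
    using integral_unique[OF has_integral_exp_mult[OF that, of "\<Lambda> n" v]]
    by (simp add: exp_minus field_simps)
  have expint: "(\<lambda>s. exp (\<Lambda> n * s) * (\<Lambda> n * v)) integrable_on {0..t}" for n t v
    by (intro integrable_continuous_real continuous_intros)
  have bounds: "(\<forall>t\<ge>0. \<forall>n. l n \<le> X k t n \<and> X k t n \<le> X (Suc k) t n \<and> X (Suc k) t n \<le> u n)" for k
  proof (induction k)
    case 0
    have "l n \<le> X (Suc 0) t n \<and> X (Suc 0) t n \<le> u n" if t: "0 \<le> t" for t n
    proof
      have "\<Lambda> n * l n \<le> H (X 0 s) n" for s
        using Fl[of n] by (simp add: H_def X0[abs_def])
      then have "exp (- \<Lambda> n * t) * (l n + integral {0..t} (\<lambda>s. exp (\<Lambda> n * s) * (\<Lambda> n * l n))) \<le> X (Suc 0) t n"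
        unfolding XS by (intro mult_left_mono add_mono lb integral_le expint Hint) (auto intro!: mult_left_mono)
      then show "l n \<le> X (Suc 0) t n" using expv[OF t] by simp
      have "H (X 0 s) n \<le> \<Lambda> n * u n" for s
        using Fu[of n] H_mono[of "X 0 s" u n] order_trans[OF lb bu] by (simp add: H_def X0[abs_def])
      then have "X (Suc 0) t n \<le> exp (- \<Lambda> n * t) * (u n + integral {0..t} (\<lambda>s. exp (\<Lambda> n * s) * (\<Lambda> n * u n)))"
        unfolding XS by (intro mult_left_mono add_mono bu integral_le expint Hint) (auto intro!: mult_left_mono)
      then show "X (Suc 0) t n \<le> u n" using expv[OF t] by simp
    qed
    then show ?case by (simp add: X0)
  next
    case (Suc k)
    show ?case
    proof (intro allI impI)
      fix t :: real and n assume t: "0 \<le> t"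
      have a1: "H (X k s) n \<le> H (X (Suc k) s) n" if "0 \<le> s" for s
        using Suc that by (intro H_mono) auto
      have a2: "H (X (Suc k) s) n \<le> \<Lambda> n * u n" if "0 \<le> s" for s
      proof -
        have "H (X (Suc k) s) n \<le> H u n" using Suc that by (intro H_mono) (auto intro: order_trans)
        also have "\<dots> \<le> \<Lambda> n * u n" using Fu[of n] by (simp add: H_def)
        finally show ?thesis .
      qed
      have "X (Suc k) t n \<le> X (Suc (Suc k)) t n"
        unfolding XS[of k t n] XS[of "Suc k" t n]
        by (intro mult_left_mono add_mono order_refl integral_le Hint) (auto intro!: mult_left_mono a1)
      moreover have "X (Suc (Suc k)) t n \<le> exp (- \<Lambda> n * t) * (u n + integral {0..t} (\<lambda>s. exp (\<Lambda> n * s) * (\<Lambda> n * u n)))"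
        unfolding XS[of "Suc k" t n]
        by (intro mult_left_mono add_mono bu integral_le expint Hint) (auto intro!: mult_left_mono a2)
      ultimately show "l n \<le> X (Suc k) t n \<and> X (Suc k) t n \<le> X (Suc (Suc k)) t n \<and> X (Suc (Suc k)) t n \<le> u n"
        using expv[OF t, where n = n and v = "u n"] Suc t by (metis order_trans)
    qed
  qed
  define b where "b = (\<lambda>t n. lim (\<lambda>k. X k t n))"
  have lim: "(\<lambda>k. X k t n) \<longlonglongrightarrow> b t n" if "0 \<le> t" for t n
  proof -
    have "incseq (\<lambda>k. X k t n)" using bounds that by (intro incseq_SucI) auto
    moreover have "Bseq (\<lambda>k. X k t n)"
    proof (rule BseqI'[of _ "u n"])
      fix k show "norm (X k t n) \<le> u n" using bounds[of k] that l[of n] by (smt (verit) real_norm_def)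
    qed
    ultimately have "convergent (\<lambda>k. X k t n)" by (intro Bseq_monoseq_convergent) (auto simp: incseq_imp_monoseq)
    then show ?thesis by (simp add: b_def convergent_LIMSEQ_iff)
  qed
  have bl: "l n \<le> b t n" and bub: "b t n \<le> u n" if "0 \<le> t" for t n
    using bounds that by (auto intro!: LIMSEQ_le_const[OF lim] LIMSEQ_le_const2[OF lim] exI[of _ 0]) (metis order_trans)
  have Hlim: "(\<lambda>k. H (X k t) n) \<longlonglongrightarrow> H (b t) n" if "0 \<le> t" for t n
    unfolding H_def net_flux_def by (intro tendsto_intros lim that)
  have Hb: "\<bar>H (X k t) n\<bar> \<le> max \<bar>H l n\<bar> \<bar>H u n\<bar>" if "0 \<le> t" for k t n
  proof -
    have "H l n \<le> H (X k t) n" "H (X k t) n \<le> H u n"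
      using bounds[of k] that by (auto intro!: H_mono intro: order_trans)
    then show ?thesis by linarith
  qed
  have dom: "(\<lambda>s. exp (\<Lambda> n * s) * H (b s) n) integrable_on {0..t}"
     "(\<lambda>k. integral {0..t} (\<lambda>s. exp (\<Lambda> n * s) * H (X k s) n)) \<longlonglongrightarrow> integral {0..t} (\<lambda>s. exp (\<Lambda> n * s) * H (b s) n)" for n t
  proof -
    have h: "(\<lambda>s. exp (\<Lambda> n * s) * max \<bar>H l n\<bar> \<bar>H u n\<bar>) integrable_on {0..t}"
      by (intro integrable_continuous_real continuous_intros)
    have le: "norm (exp (\<Lambda> n * s) * H (X k s) n) \<le> exp (\<Lambda> n * s) * max \<bar>H l n\<bar> \<bar>H u n\<bar>" if "s \<in> {0..t}" for k s
      using Hb[of s k n] that by (simp add: abs_mult)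
    have conv: "(\<lambda>k. exp (\<Lambda> n * s) * H (X k s) n) \<longlonglongrightarrow> exp (\<Lambda> n * s) * H (b s) n" if "s \<in> {0..t}" for s
      using that by (intro tendsto_intros Hlim) auto
    show "(\<lambda>s. exp (\<Lambda> n * s) * H (b s) n) integrable_on {0..t}"
     "(\<lambda>k. integral {0..t} (\<lambda>s. exp (\<Lambda> n * s) * H (X k s) n)) \<longlonglongrightarrow> integral {0..t} (\<lambda>s. exp (\<Lambda> n * s) * H (b s) n)"
      using dominated_convergence[OF Hint h le conv] by blast+
  qed
  have beq: "b t n = exp (- \<Lambda> n * t) * (b0 n + integral {0..t} (\<lambda>s. exp (\<Lambda> n * s) * H (b s) n))" if "0 \<le> t" for t n
  proof (rule LIMSEQ_unique)
    show "(\<lambda>k. X (Suc k) t n) \<longlonglongrightarrow> b t n" using lim[OF that] by (rule LIMSEQ_Suc)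
    show "(\<lambda>k. X (Suc k) t n) \<longlonglongrightarrow> exp (- \<Lambda> n * t) * (b0 n + integral {0..t} (\<lambda>s. exp (\<Lambda> n * s) * H (b s) n))"
      unfolding XS by (intro tendsto_intros dom)
  qed
  have bcont: "continuous_on {0..} (\<lambda>t. b t n)" for n
  proof -
    have "continuous_on {0..T} (\<lambda>t. b t n)" for T
    proof -
      have "continuous_on {0..T} (\<lambda>t. exp (- \<Lambda> n * t) * (b0 n + integral {0..t} (\<lambda>s. exp (\<Lambda> n * s) * H (b s) n)))"
        by (intro continuous_intros indefinite_integral_continuous_1 dom)
      then show ?thesis by (rule continuous_on_eq) (use beq in auto)
    qed
    then have "continuous (at t within {0..}) (\<lambda>t. b t n)" if "0 \<le> t" for t
      using at_within_atLeast_eq_Icc[of 0 t "t+1"] that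
      by (metis atLeastAtMost_iff continuous_on_eq_continuous_within less_add_one less_imp_le)
    then show ?thesis by (auto simp: continuous_on_eq_continuous_within)
  qed
  have Hbc: "continuous_on {0..} (\<lambda>t. H (b t) n)" for n
    unfolding H_def net_flux_def by (intro continuous_intros bcont)
  have der: "((\<lambda>s. b s n) has_real_derivative net_flux c \<zeta> (b t) n) (at t within {0..})" if "0 \<le> t" for t n
  proof -
    have "((\<lambda>t. exp (- \<Lambda> n * t) * (b0 n + integral {0..t} (\<lambda>s. exp (\<Lambda> n * s) * H (b s) n))) has_real_derivative
       net_flux c \<zeta> (b t) n) (at t within {0..})"
    proof -
      have v: "H (b t) n - \<Lambda> n * b t n = net_flux c \<zeta> (b t) n" by (simp add: H_def)
      show ?thesis
        using duhamel_derivative[OF Hbc[of n] that, where c = "b0 n" and L = "\<Lambda> n"]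
        unfolding beq[OF that, of n, symmetric] v .
    qed
    then show ?thesis
      by (rule has_field_derivative_transform_within[where d = 1]) (use beq that in auto)
  qed
  have "b 0 n = b0 n" for n using beq[of 0 n] by simp
  then show ?thesis using der bl bub by blast
qed


text \<open>
  Bounds on the states bound the derivative of each coordinate, so the solutions are equi-Lipschitz
  coordinatewise: a subsequence that converges at all rational times converges at all times, and the
  integrated equation passes to the limit.
\<close>

lemma network_solution_limit:
  fixes bN :: "nat \<Rightarrow> real \<Rightarrow> int \<Rightarrow> real" and D \<zeta> B b0 :: "int \<Rightarrow> real"
  assumes bound: "\<And>N n t. 0 \<le> t \<Longrightarrow> \<bar>bN N t n\<bar> \<le> B n"
    and init: "\<And>N n. bN N 0 n = b0 n"
    and der: "\<And>n. \<exists>N0. \<forall>N\<ge>N0. \<forall>t\<ge>0.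
        ((\<lambda>s. bN N s n) has_real_derivative net_flux D \<zeta> (bN N t) n) (at t within {0..})"
  shows "\<exists>k b. strict_mono (k :: nat \<Rightarrow> nat) \<and> (\<forall>n. \<forall>t\<ge>0. (\<lambda>N. bN (k N) t n) \<longlonglongrightarrow> b t n) \<and>
     (\<forall>n. b 0 n = b0 n) \<and>
     (\<forall>n. \<forall>t\<ge>0. ((\<lambda>s. b s n) has_real_derivative net_flux D \<zeta> (b t) n) (at t within {0..}))"
proof -
  define L where "L = (\<lambda>n. \<bar>D n\<bar> * (\<bar>\<zeta> (n-1)\<bar> * (B (n-1))\<^sup>2 + B n) + 2 * \<bar>D (n+1)\<bar> * (\<bar>\<zeta> n\<bar> * (B n)\<^sup>2 + B (n+1)))"
  have B0: "0 \<le> B n" for n using bound[of 0 0 n] by linarith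
  have Lb: "\<bar>net_flux D \<zeta> (bN N t) n\<bar> \<le> L n" if "0 \<le> t" for N t n
  proof -
    have sq: "(bN N t m)\<^sup>2 \<le> (B m)\<^sup>2" for m
      using bound[OF that, of N m] B0[of m] by (simp add: abs_le_square_iff[symmetric])
    have one: "\<bar>\<zeta> m * (bN N t m)\<^sup>2 - bN N t m'\<bar> \<le> \<bar>\<zeta> m\<bar> * (B m)\<^sup>2 + B m'" for m m'
    proof -
      have "\<bar>\<zeta> m * (bN N t m)\<^sup>2 - bN N t m'\<bar> \<le> \<bar>\<zeta> m * (bN N t m)\<^sup>2\<bar> + \<bar>bN N t m'\<bar>" by linarith
      also have "\<dots> \<le> \<bar>\<zeta> m\<bar> * (B m)\<^sup>2 + B m'"
        using sq[of m] bound[OF that, of N m'] by (auto simp: abs_mult intro!: add_mono mult_left_mono)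
      finally show ?thesis .
    qed
    have "\<bar>net_flux D \<zeta> (bN N t) n\<bar> \<le>
       \<bar>D n * (\<zeta> (n - 1) * (bN N t (n - 1))\<^sup>2 - bN N t n)\<bar> + \<bar>2 * D (n+1) * (\<zeta> n * (bN N t n)\<^sup>2 - bN N t (n + 1))\<bar>"
      unfolding net_flux_def by linarith
    also have "\<dots> \<le> L n"
      unfolding L_def abs_mult using one by (intro add_mono mult_mono) auto
    finally show ?thesis .
  qed
  obtain N0 where N0: "\<And>n N t. N \<ge> N0 n \<Longrightarrow> 0 \<le> t \<Longrightarrow>
        ((\<lambda>s. bN N s n) has_real_derivative net_flux D \<zeta> (bN N t) n) (at t within {0..})"
    using der by metis
  have lip: "\<bar>bN N s n - bN N t n\<bar> \<le> L n * \<bar>s - t\<bar>" if "N \<ge> N0 n" "0 \<le> s" "0 \<le> t" for N s t n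
    using field_differentiable_bound[of "{0..}" "\<lambda>s. bN N s n" "\<lambda>t. net_flux D \<zeta> (bN N t) n" "L n" s t]
      N0 Lb that by auto
  have L0: "0 \<le> L n" for n using Lb[of 0 0 n] by linarith
  define S :: "(int \<times> real) set" where "S = UNIV \<times> (\<rat> \<inter> {0..})"
  have "countable S" unfolding S_def by (intro countable_SIGMA countable_Int1 countable_rat) auto
  moreover have "norm (bN N (snd x) (fst x) / (B (fst x) + 1)) \<le> 1" if "x \<in> S" for N x
    using bound[of "snd x" N "fst x"] B0[of "fst x"] that by (auto simp: S_def)
  ultimately obtain k where k: "strict_mono (k::nat\<Rightarrow>nat)"
    and kl: "\<And>x. x \<in> S \<Longrightarrow> \<exists>l. (\<lambda>N. bN (k N) (snd x) (fst x) / (B (fst x) + 1)) \<longlonglongrightarrow> l"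
    using function_convergent_subsequence[of S "\<lambda>N x. bN N (snd x) (fst x) / (B (fst x) + 1)" 1] by blast
  have conv_rat: "convergent (\<lambda>N. bN (k N) q n)" if q: "q \<in> \<rat>" "0 \<le> q" for q n
  proof -
    obtain l where "(\<lambda>N. bN (k N) q n / (B n + 1)) \<longlonglongrightarrow> l" using kl[of "(n,q)"] q by (auto simp: S_def)
    then have "(\<lambda>N. bN (k N) q n / (B n + 1) * (B n + 1)) \<longlonglongrightarrow> l * (B n + 1)" by (intro tendsto_intros)
    moreover have "B n + 1 \<noteq> 0" using B0[of n] by linarith
    ultimately show ?thesis by (auto simp: convergent_def)
  qed
  have conv: "convergent (\<lambda>N. bN (k N) t n)" if t: "0 \<le> t" for t n
  proof (rule Cauchy_convergent, rule metric_CauchyI)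
    fix e :: real assume e: "0 < e"
    define d where "d = e / (3 * (L n + 1))"
    have d: "0 < d" using e L0[of n] by (simp add: d_def)
    obtain q where q: "q \<in> \<rat>" "t < q" "q < t + d" using Rats_dense_in_real[of t "t+d"] d by auto
    have "Cauchy (\<lambda>N. bN (k N) q n)" using conv_rat[of q n] q t by (intro convergent_Cauchy) auto
    then obtain M where M: "\<And>i j. i \<ge> M \<Longrightarrow> j \<ge> M \<Longrightarrow> dist (bN (k i) q n) (bN (k j) q n) < e/3"
      using metric_CauchyD[of _ "e/3"] e by (metis divide_pos_pos zero_less_numeral)
    have near: "\<bar>bN (k i) t n - bN (k i) q n\<bar> < e / 3" if "i \<ge> N0 n" for i
    proof -
      have "k i \<ge> N0 n" using that seq_suble[OF k, of i] by linarith
      then have "\<bar>bN (k i) t n - bN (k i) q n\<bar> \<le> L n * \<bar>t - q\<bar>"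
        using lip[where N = "k i" and n = n and s = t and t = q] q t by auto
      also have "\<dots> \<le> L n * d" using q L0[of n] by (intro mult_left_mono) auto
      also have "\<dots> < (L n + 1) * d" using d by simp
      also have "\<dots> = e / 3" using L0[of n] by (simp add: d_def field_simps)
      finally show ?thesis .
    qed
    show "\<exists>M. \<forall>m\<ge>M. \<forall>j\<ge>M. dist (bN (k m) t n) (bN (k j) t n) < e"
    proof (intro exI allI impI)
      fix i j assume ij: "i \<ge> max M (N0 n)" "j \<ge> max M (N0 n)"
      have "\<bar>bN (k i) q n - bN (k j) q n\<bar> < e / 3" using M[of i j] ij by (simp add: dist_real_def)
      moreover have "\<bar>bN (k i) t n - bN (k i) q n\<bar> < e / 3" "\<bar>bN (k j) t n - bN (k j) q n\<bar> < e / 3"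
        using near[of i] near[of j] ij by simp_all
      ultimately show "dist (bN (k i) t n) (bN (k j) t n) < e"
        unfolding dist_real_def by argo
    qed
  qed
  define b where "b = (\<lambda>t n. lim (\<lambda>N. bN (k N) t n))"
  have lim: "(\<lambda>N. bN (k N) t n) \<longlonglongrightarrow> b t n" if "0 \<le> t" for t n
    using conv[OF that, of n] by (simp add: b_def convergent_LIMSEQ_iff)
  have lipb: "\<bar>b s n - b t n\<bar> \<le> L n * \<bar>s - t\<bar>" if "0 \<le> s" "0 \<le> t" for s t n
  proof (rule tendsto_upperbound)
    show "(\<lambda>N. \<bar>bN (k N) s n - bN (k N) t n\<bar>) \<longlonglongrightarrow> \<bar>b s n - b t n\<bar>"
      by (intro tendsto_intros lim that)
    show "\<forall>\<^sub>F N in sequentially. \<bar>bN (k N) s n - bN (k N) t n\<bar> \<le> L n * \<bar>s - t\<bar>"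
      using eventually_ge_at_top[of "N0 n"]
      by eventually_elim (use lip that seq_suble[OF k] in \<open>meson order_trans\<close>)
  qed simp
  have bcont: "continuous_on {0..} (\<lambda>t. b t n)" for n
    by (rule lipschitz_on_continuous_on[of "L n"])
       (use lipb L0 in \<open>auto simp: lipschitz_on_def dist_real_def\<close>)
  have b0: "b 0 n = b0 n" for n
    using lim[of 0 n] by (simp add: init LIMSEQ_const_iff)
  have fluxcont: "continuous_on {0..} (\<lambda>t. net_flux D \<zeta> (b t) n)" for n
    unfolding net_flux_def by (intro continuous_intros bcont)
  have inteq: "b t n = b0 n + integral {0..t} (\<lambda>s. net_flux D \<zeta> (b s) n)" if t: "0 \<le> t" for t n
  proof -
    define j where "j = (\<lambda>N. k (N + N0 n))"
    have jN: "j N \<ge> N0 n" for N using seq_suble[OF k, of "N + N0 n"] by (simp add: j_def)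
    have limj: "(\<lambda>N. bN (j N) s m) \<longlonglongrightarrow> b s m" if "0 \<le> s" for s m
      unfolding j_def using LIMSEQ_ignore_initial_segment[OF lim[OF that]] .
    have hi: "((\<lambda>s. net_flux D \<zeta> (bN (j N) s) n) has_integral (bN (j N) t n - b0 n)) {0..t}" for N
    proof -
      have "((\<lambda>s. bN (j N) s n) has_vector_derivative net_flux D \<zeta> (bN (j N) s) n) (at s within {0..t})"
        if "s \<in> {0..t}" for s
        using has_field_derivative_subset[OF N0[OF jN, of s N], of "{0..t}"] that
        by (auto simp: has_real_derivative_iff_has_vector_derivative[symmetric])
      from fundamental_theorem_of_calculus[OF t this] show ?thesis by (simp add: init)
    qed
    have "((\<lambda>s. net_flux D \<zeta> (b s) n) has_integral (b t n - b0 n)) {0..t}"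
    proof (rule has_integral_dominated_convergence[OF hi])
      show "(\<lambda>s. L n) integrable_on {0..t}" by (rule integrable_const_ivl)
      show "\<And>N. \<forall>s\<in>{0..t}. norm (net_flux D \<zeta> (bN (j N) s) n) \<le> L n" using Lb by auto
      show "\<forall>s\<in>{0..t}. (\<lambda>N. net_flux D \<zeta> (bN (j N) s) n) \<longlonglongrightarrow> net_flux D \<zeta> (b s) n"
        unfolding net_flux_def by (auto intro!: tendsto_intros limj)
      show "(\<lambda>N. bN (j N) t n - b0 n) \<longlonglongrightarrow> b t n - b0 n" by (intro tendsto_intros limj t)
    qed
    then show ?thesis by (simp add: integral_unique)
  qed
  have derb: "((\<lambda>s. b s n) has_real_derivative net_flux D \<zeta> (b t) n) (at t within {0..})" if t: "0 \<le> t" for t n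
  proof -
    have "((\<lambda>x. b0 n + integral {0..x} (\<lambda>s. net_flux D \<zeta> (b s) n)) has_real_derivative net_flux D \<zeta> (b t) n) (at t within {0..t+1})"
      using integral_has_real_derivative[OF continuous_on_subset[OF fluxcont, of "{0..t+1}" n], of t] t
      by (auto intro!: derivative_eq_intros)
    then have "((\<lambda>x. b0 n + integral {0..x} (\<lambda>s. net_flux D \<zeta> (b s) n)) has_real_derivative net_flux D \<zeta> (b t) n) (at t within {0..})"
      using at_within_atLeast_eq_Icc[of 0 t "t+1"] t by simp
    then show ?thesis
      by (rule has_field_derivative_transform_within[where d = 1]) (use inteq t in auto)
  qed
  show ?thesis using k lim b0 derb by blast
qed

section \<open>Positive supersolutions of the linearised defect system\<close>

text \<open>
  The function $\sigma_n(s)$ that prescribes $D_n w_n$ for large $n$.  It equals $2^{(\beta-1)n}$ at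
  $s = 0$ and tends to $(\kappa s)^{-\theta}$ as $n \to \infty$.
\<close>

definition profile :: "real \<Rightarrow> real \<Rightarrow> int \<Rightarrow> real \<Rightarrow> real" where
  "profile \<beta> \<kappa> n s = (2 powr (- \<beta> * of_int n) + \<kappa> * s) powr (- ((\<beta> - 1) / \<beta>))"

lemma two_powr_step:
  "(2::real) powr (- \<beta> * of_int (n - 1)) = 2 powr \<beta> * 2 powr (- \<beta> * of_int n)"
  "(2::real) powr (- \<beta> * of_int (n + 1)) = 2 powr (-\<beta>) * 2 powr (- \<beta> * of_int n)"
proof -
  have e: "- \<beta> * of_int (n - 1) = \<beta> + - \<beta> * of_int n" "- \<beta> * of_int (n + 1) = - \<beta> + - \<beta> * of_int n"
    by (simp_all add: algebra_simps)
  show "(2::real) powr (- \<beta> * of_int (n - 1)) = 2 powr \<beta> * 2 powr (- \<beta> * of_int n)"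
    "(2::real) powr (- \<beta> * of_int (n + 1)) = 2 powr (-\<beta>) * 2 powr (- \<beta> * of_int n)"
    unfolding e powr_add by (rule refl)+
qed

lemma two_powr_bounds:
  fixes \<beta> :: real assumes "1 < \<beta>" "\<beta> < 2"
  shows "2 \<le> 2 powr \<beta>" "2 powr \<beta> \<le> 4" "2 powr (\<beta> - 1) \<le> 2"
proof -
  show "2 \<le> 2 powr \<beta>" "2 powr \<beta> \<le> 4" "2 powr (\<beta> - 1) \<le> 2"
    using powr_mono[of 1 \<beta> "2::real"] powr_mono[of \<beta> 2 "2::real"] powr_mono[of "\<beta> - 1" 1 "2::real"] assms
    by simp_all
qed

text \<open>
  The increments of $\sigma_n$ in $n$ must absorb $\partial_s w_n$, which is of order
  $\kappa x^{-\theta-1} / D_n$.  The mean value theorem gives increments of order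
  $2^{-\beta n} x^{-\theta-1}$, and $1/D_n$ is of order $2^{-\beta n}$, so it suffices that \<open>\<kappa>\<close> be small.
\<close>

lemma profile_gap:
  fixes \<beta> \<kappa> s :: real and n :: int
  assumes \<beta>: "1 < \<beta>" "\<beta> < 2" and \<kappa>: "0 \<le> \<kappa>" and s: "0 \<le> s"
  defines "\<theta> \<equiv> (\<beta> - 1) / \<beta>"
  defines "x \<equiv> 2 powr (- \<beta> * of_int n) + \<kappa> * s"
  shows "\<theta> / 8 * 2 powr (- \<beta> * of_int n) * x powr (- \<theta> - 1) \<le> profile \<beta> \<kappa> n s - profile \<beta> \<kappa> (n - 1) s"
proof -
  define \<tau> where "\<tau> = (2::real) powr (- \<beta> * of_int n)"
  define y where "y = 2 powr \<beta> * \<tau> + \<kappa> * s"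
  have \<theta>: "0 < \<theta>" "\<theta> < 1" using \<beta> by (auto simp: \<theta>_def)
  have \<tau>: "0 < \<tau>" by (simp add: \<tau>_def)
  have \<kappa>s: "0 \<le> \<kappa> * s" using \<kappa> s by simp
  have x: "0 < x" "x = \<tau> + \<kappa> * s" using add_pos_nonneg[OF \<tau> \<kappa>s] by (simp_all add: x_def \<tau>_def)
  have dif: "\<tau> \<le> y - x" using two_powr_bounds[OF \<beta>] \<tau> by (simp add: y_def x)
  then have xy: "x < y" using \<tau> by linarith
  have y4: "y \<le> 2 powr \<beta> * x"
  proof -
    have "1 * (\<kappa> * s) \<le> 2 powr \<beta> * (\<kappa> * s)" using two_powr_bounds[OF \<beta>] \<kappa>s by (intro mult_right_mono) auto
    then show ?thesis by (simp add: y_def x distrib_left)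
  qed
  have "\<exists>z>x. z < y \<and> y powr (-\<theta>) - x powr (-\<theta>) = (y - x) * (- \<theta> * z powr (- \<theta> - 1))"
  proof (rule MVT2[OF xy])
    fix z assume "x \<le> z" "z \<le> y"
    then show "((\<lambda>z. z powr (-\<theta>)) has_real_derivative - \<theta> * z powr (- \<theta> - 1)) (at z)"
      using x by (auto intro!: derivative_eq_intros)
  qed
  then obtain z where z: "x < z" "z < y" and eq: "y powr (-\<theta>) - x powr (-\<theta>) = (y - x) * (- \<theta> * z powr (- \<theta> - 1))"
    by blast
  have "(2 powr \<beta> * x) powr (-\<theta> - 1) \<le> z powr (- \<theta> - 1)"
    using z x y4 \<theta> by (intro powr_mono2') auto
  moreover have "(2 powr \<beta> * x) powr (-\<theta> - 1) = 2 powr (\<beta> * (-\<theta> - 1)) * x powr (-\<theta> - 1)"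
    using x by (simp add: powr_mult powr_powr)
  moreover have "\<beta> * (-\<theta> - 1) = 1 - 2 * \<beta>" using \<beta> by (simp add: \<theta>_def field_simps)
  moreover have "1/8 \<le> (2::real) powr (1 - 2 * \<beta>)"
  proof -
    have "(2::real) powr (-3) \<le> 2 powr (1 - 2 * \<beta>)" using \<beta> by (intro powr_mono) auto
    then show ?thesis by (simp add: powr_minus powr_numeral)
  qed
  ultimately have "1/8 * x powr (-\<theta> - 1) \<le> z powr (-\<theta> - 1)"
    by (metis mult_right_mono order_trans powr_ge_zero)
  then have "\<theta> * \<tau> * (1/8 * x powr (-\<theta> - 1)) \<le> \<theta> * (y - x) * z powr (-\<theta> - 1)"
    using dif \<theta> \<tau> xy by (intro mult_mono) auto
  also have "\<dots> = x powr (-\<theta>) - y powr (-\<theta>)" using eq by (simp add: algebra_simps)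
  also have "y = 2 powr (- \<beta> * of_int (n - 1)) + \<kappa> * s" by (simp only: y_def \<tau>_def two_powr_step)
  finally show ?thesis by (simp add: profile_def \<theta>_def[symmetric] x_def \<tau>_def mult_ac)
qed

lemma profile_pos: "0 \<le> \<kappa> \<Longrightarrow> 0 \<le> s \<Longrightarrow> 0 < profile \<beta> \<kappa> n s"
  using add_pos_nonneg[of "2 powr (- \<beta> * of_int n)" "\<kappa> * s"] by (simp add: profile_def)

lemma profile_Suc_le:
  assumes \<beta>: "1 < \<beta>" "\<beta> < 2" and \<kappa>: "0 \<le> \<kappa>" and s: "0 \<le> s"
  shows "profile \<beta> \<kappa> (n + 1) s \<le> 2 * profile \<beta> \<kappa> n s"
proof -
  define \<tau> where "\<tau> = (2::real) powr (- \<beta> * of_int n)"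
  define \<theta> where "\<theta> = (\<beta> - 1) / \<beta>"
  have \<theta>: "0 < \<theta>" using \<beta> by (auto simp: \<theta>_def)
  have \<tau>: "0 < \<tau>" by (simp add: \<tau>_def)
  have \<kappa>s: "0 \<le> \<kappa> * s" using \<kappa> s by simp
  have b1: "2 powr (-\<beta>) \<le> (1::real)" using powr_mono[of "-\<beta>" 0 "2::real"] \<beta> by simp
  have "2 powr (-\<beta>) * (\<tau> + \<kappa> * s) \<le> 2 powr (-\<beta>) * \<tau> + \<kappa> * s"
    using mult_right_mono[OF b1 \<kappa>s] by (simp add: distrib_left)
  then have "(2 powr (-\<beta>) * \<tau> + \<kappa> * s) powr (-\<theta>) \<le> (2 powr (-\<beta>) * (\<tau> + \<kappa> * s)) powr (-\<theta>)"
    using \<theta> \<tau> \<kappa>s by (intro powr_mono2') auto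
  also have "\<dots> = 2 powr (\<beta> * \<theta>) * (\<tau> + \<kappa> * s) powr (-\<theta>)"
    using \<tau> \<kappa>s by (simp add: powr_mult powr_powr)
  also have "\<beta> * \<theta> = \<beta> - 1" using \<beta> by (simp add: \<theta>_def)
  also have "2 powr (\<beta> - 1) * (\<tau> + \<kappa> * s) powr (-\<theta>) \<le> 2 * (\<tau> + \<kappa> * s) powr (-\<theta>)"
    using two_powr_bounds[OF \<beta>] by (intro mult_right_mono) auto
  finally show ?thesis by (simp only: profile_def \<theta>_def[symmetric] two_powr_step \<tau>_def)
qed

lemma profile_le:
  assumes \<beta>: "1 < \<beta>" "\<beta> < 2" and \<kappa>: "0 < \<kappa>" and s: "0 \<le> s"
  shows "profile \<beta> \<kappa> n s \<le> 2 powr ((\<beta> - 1) * of_int n)"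
    and "0 < s \<Longrightarrow> profile \<beta> \<kappa> n s \<le> \<kappa> powr (- ((\<beta> - 1) / \<beta>)) * s powr (- ((\<beta> - 1) / \<beta>))"
    and "profile \<beta> \<kappa> n 0 = 2 powr ((\<beta> - 1) * of_int n)"
proof -
  define \<theta> where "\<theta> = (\<beta> - 1) / \<beta>"
  have \<theta>: "0 < \<theta>" using \<beta> by (auto simp: \<theta>_def)
  have e: "(2 powr (- \<beta> * of_int n)) powr (-\<theta>) = 2 powr ((\<beta> - 1) * of_int n)"
  proof -
    have "- \<beta> * of_int n * - \<theta> = (\<beta> - 1) * of_int n" using \<beta> by (simp add: \<theta>_def)
    then show ?thesis by (simp only: powr_powr)
  qed
  then show "profile \<beta> \<kappa> n 0 = 2 powr ((\<beta> - 1) * of_int n)" by (simp add: profile_def \<theta>_def)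
  have "profile \<beta> \<kappa> n s \<le> (2 powr (- \<beta> * of_int n)) powr (-\<theta>)"
    unfolding profile_def \<theta>_def[symmetric] using \<theta> \<kappa> s by (intro powr_mono2') auto
  then show "profile \<beta> \<kappa> n s \<le> 2 powr ((\<beta> - 1) * of_int n)" by (simp only: e)
  assume s: "0 < s"
  have "profile \<beta> \<kappa> n s \<le> (\<kappa> * s) powr (-\<theta>)"
    unfolding profile_def \<theta>_def[symmetric] using \<theta> \<kappa> s by (intro powr_mono2') auto
  then show "profile \<beta> \<kappa> n s \<le> \<kappa> powr (- ((\<beta> - 1) / \<beta>)) * s powr (- ((\<beta> - 1) / \<beta>))"
    using \<kappa> s by (simp add: powr_mult \<theta>_def)
qed

lemma profile_derivative:
  fixes \<beta> \<kappa> s :: real and n :: int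
  assumes \<kappa>: "0 \<le> \<kappa>" and s: "0 \<le> s"
  defines "\<theta> \<equiv> (\<beta> - 1) / \<beta>"
  shows "(profile \<beta> \<kappa> n has_real_derivative
     - (\<theta> * \<kappa> * (2 powr (- \<beta> * of_int n) + \<kappa> * s) powr (- \<theta> - 1))) (at s)"
proof -
  have "0 < 2 powr (- \<beta> * of_int n) + \<kappa> * s"
    using \<kappa> s by (intro add_pos_nonneg) auto
  then show ?thesis
    unfolding profile_def[abs_def] \<theta>_def[symmetric]
    by (auto intro!: derivative_eq_intros)
qed

text \<open>
  \<open>r n\<close> stands for the ratio $a_{n+1}/a_n$ of a stationary state, and \<open>g\<close> for $\gamma_0/4$.
\<close>

definition coeff_bounds :: "real \<Rightarrow> real \<Rightarrow> real \<Rightarrow> real \<Rightarrow> real \<Rightarrow> int \<Rightarrow> (int \<Rightarrow> real) \<Rightarrow> (int \<Rightarrow> real) \<Rightarrow> bool" where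
  "coeff_bounds \<beta> g c1 C1 R n0 D r \<longleftrightarrow>
     (\<forall>n. 0 < D n \<and> 0 < r n \<and> r n \<le> R) \<and>
     (\<forall>n\<le>n0. \<bar>D n - g\<bar> \<le> g / 50 \<and> \<bar>r n - 2\<bar> \<le> 1 / 25) \<and>
     (\<forall>n\<ge>n0. c1 * 2 powr (\<beta> * of_int n) \<le> D n \<and> D n \<le> C1 * 2 powr (\<beta> * of_int n))"

text \<open>
  Ratios $b_{n+1}/b_n$ of states close to the stationary one.  From \<open>N1\<close> on only smallness is required: there
  closeness to the stationary ratio fails, because a shift of $A$ changes it by a factor
  that is not close to one.
\<close>

definition admissible_ratios :: "real \<Rightarrow> real \<Rightarrow> int \<Rightarrow> (int \<Rightarrow> real) \<Rightarrow> (int \<Rightarrow> real) \<Rightarrow> bool" where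
  "admissible_ratios \<beta> \<eta> N1 r q \<longleftrightarrow>
     (\<forall>n<N1. \<bar>q n - r n\<bar> \<le> \<eta> * r n) \<and>
     (\<forall>n\<ge>N1. 0 \<le> q n \<and> q n \<le> (\<beta> - 1) / \<beta> / 2048 * 2 powr (- \<beta> * of_int n))"

text \<open>
  The bracket in the equation for the defect, with $b_{n+1}/b_n$ replaced by \<open>q n\<close>.
\<close>

definition chain_op :: "(int \<Rightarrow> real) \<Rightarrow> (int \<Rightarrow> real) \<Rightarrow> (int \<Rightarrow> real) \<Rightarrow> int \<Rightarrow> real" where
  "chain_op D q w n = D (n - 1) * w (n - 1) + 4 * D (n + 1) * q n * w (n + 1) - (D n + 4 * D n * q (n - 1)) * w n"

text \<open>
  Below \<open>N1\<close> the recursion makes $D_n h_n - U_n h_{n+1}$ equal to the increasing sequence $2^{n - N_1}$, whose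
  increments are what the supersolution inequality gains.  Solved downwards the recursion keeps \<open>h\<close> positive,
  but it grows like $8^{-n}$ if continued to $-\infty$; below \<open>n0\<close> it is replaced by $2^{-n}$, which is a strict
  supersolution there.
\<close>

lemma static_weights:
  fixes \<beta> g c1 C1 R :: real and n0 N1 :: int
  assumes \<beta>: "1 < \<beta>" "\<beta> < 2" and pos: "0 < c1" "0 < C1" "0 < R" and N: "n0 < N1"
  shows "\<exists>W>0. \<forall>D r. coeff_bounds \<beta> g c1 C1 R n0 D r \<longrightarrow>
    (\<exists>h. (\<forall>n. 0 < h n) \<and> (\<forall>n\<ge>n0. h n \<le> W) \<and> h N1 = 1 / D N1 \<and>
       (\<forall>n. n0 \<le> n \<longrightarrow> n < N1 \<longrightarrow> D n * h n = 4 * D (n+1) * r n * h (n+1) + 2 powr (of_int (n - N1))) \<and>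
       (\<forall>n<n0. h n = 2 powr (of_int (n0 - n)) * h n0))"
proof -
  define X where "X = 1 + 16 * R * C1 / c1 + 2 powr (- \<beta> * of_int n0) / c1"
  have X1: "1 \<le> X" using pos by (simp add: X_def)
  define W where "W = (2 * X) ^ (nat (N1 - n0) + 1)"
  have "\<exists>h. (\<forall>n. 0 < h n) \<and> (\<forall>n\<ge>n0. h n \<le> W) \<and> h N1 = 1 / D N1 \<and>
       (\<forall>n. n0 \<le> n \<longrightarrow> n < N1 \<longrightarrow> D n * h n = 4 * D (n+1) * r n * h (n+1) + 2 powr (of_int (n - N1))) \<and>
       (\<forall>n<n0. h n = 2 powr (of_int (n0 - n)) * h n0)"
    if cb: "coeff_bounds \<beta> g c1 C1 R n0 D r" for D r
  proof -
    have Dp: "0 < D n" and rp: "0 < r n" and rR: "r n \<le> R" for n using cb by (auto simp: coeff_bounds_def)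
    have Dl: "c1 * 2 powr (\<beta> * of_int n) \<le> D n" and Du: "D n \<le> C1 * 2 powr (\<beta> * of_int n)" if "n0 \<le> n" for n
      using cb that by (auto simp: coeff_bounds_def)
    have inv: "1 / D n \<le> X" if "n0 \<le> n" for n
    proof -
      have "c1 * 2 powr (\<beta> * of_int n0) \<le> c1 * 2 powr (\<beta> * of_int n)"
        using that \<beta> pos by (intro mult_left_mono powr_mono mult_left_mono) auto
      also have "\<dots> \<le> D n" by (rule Dl[OF that])
      finally have "1 / D n \<le> 1 / (c1 * 2 powr (\<beta> * of_int n0))"
        using pos by (intro divide_left_mono) (auto simp: Dp)
      also have "\<dots> \<le> X" using pos by (simp add: X_def powr_minus field_simps)
      finally show ?thesis .
    qed
    have rat: "4 * D (n+1) * r n / D n \<le> X - 1 / c1 * 2 powr (- \<beta> * of_int n0)" if "n0 \<le> n" for n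
    proof -
      have "D (n+1) \<le> C1 * 2 powr (\<beta> * of_int (n+1))" using Du[of "n+1"] that by simp
      also have "\<dots> = C1 * (2 powr \<beta> * 2 powr (\<beta> * of_int n))" by (simp add: powr_add distrib_left)
      also have "\<dots> \<le> C1 * (4 * 2 powr (\<beta> * of_int n))"
        using two_powr_bounds[OF \<beta>] pos by (intro mult_left_mono mult_right_mono) auto
      also have "\<dots> = 4 * C1 / c1 * (c1 * 2 powr (\<beta> * of_int n))" using pos by simp
      also have "\<dots> \<le> 4 * C1 / c1 * D n" using Dl[OF that] pos by (intro mult_left_mono) auto
      finally have 1: "D (n+1) \<le> 4 * C1 / c1 * D n" .
      have "4 * D (n+1) * r n \<le> 4 * (4 * C1 / c1 * D n) * R"
        using 1 rR[of n] rp[of n] Dp[of n] Dp[of "n+1"] pos by (intro mult_mono) auto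
      then have "4 * D (n+1) * r n / D n \<le> 4 * (4 * C1 / c1 * D n) * R / D n"
        using Dp[of n] by (intro divide_right_mono) (auto intro: less_imp_le)
      also have "\<dots> = 16 * R * C1 / c1" using Dp[of n] by (simp add: field_simps)
      finally show ?thesis by (simp add: X_def)
    qed
    define v where "v = rec_nat (1 / D N1) (\<lambda>m x. (4 * D (N1 - int m) * r (N1 - int m - 1) * x + 2 powr (- of_int (int m + 1))) / D (N1 - int m - 1))"
    have v0: "v 0 = 1 / D N1" by (simp add: v_def)
    have vS: "v (Suc m) = (4 * D (N1 - int m) * r (N1 - int m - 1) * v m + 2 powr (- of_int (int m + 1))) / D (N1 - int m - 1)" for m
      by (simp add: v_def)
    have vp: "0 < v m" for m
    proof (induction m)
      case (Suc m)
      have "0 < 4 * D (N1 - int m) * r (N1 - int m - 1) * v m" using Suc Dp rp by simp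
      then show ?case unfolding vS using Dp by (intro divide_pos_pos add_pos_pos) auto
    qed (simp add: v0 Dp)
    have vb: "v m \<le> (2 * X) ^ (m + 1)" if "int m \<le> N1 - n0" for m
      using that
    proof (induction m)
      case 0
      then show ?case using inv[of N1] N X1 by (simp add: v0)
    next
      case (Suc m)
      define n where "n = N1 - int m - 1"
      have n: "n0 \<le> n" using Suc by (simp add: n_def)
      have pw: "1 \<le> (2 * X) ^ (m + 1)" using X1 by (intro one_le_power) auto
      have "v (Suc m) = (4 * D (n+1) * r n / D n) * v m + 2 powr (- of_int (int m + 1)) * (1 / D n)"
        unfolding vS n_def by (simp add: add_divide_distrib algebra_simps)
      also have "\<dots> \<le> X * (2 * X) ^ (m + 1) + 1 * X"
      proof (intro add_mono mult_mono)
        show "4 * D (n+1) * r n / D n \<le> X" 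
        proof -
          have "0 \<le> 1 / c1 * 2 powr (- \<beta> * of_int n0)" using pos by simp
          then show ?thesis using rat[OF n] by linarith
        qed
        show "v m \<le> (2 * X) ^ (m + 1)" using Suc by simp
        show "2 powr (- of_int (int m + 1)) \<le> (1::real)" using powr_mono[of "- of_int (int m + 1)" 0 "2::real"] by simp
      qed (use inv[OF n] vp X1 Dp in \<open>auto intro: less_imp_le\<close>)
      also have "\<dots> \<le> X * (2 * X) ^ (m + 1) + X * (2 * X) ^ (m + 1)"
      proof -
        have "X * 1 \<le> X * (2 * X) ^ (m + 1)" using pw X1 by (intro mult_left_mono) linarith+
        then show ?thesis by linarith
      qed
      also have "\<dots> = (2 * X) ^ (Suc m + 1)" by (simp add: power_mult_distrib algebra_simps)
      finally show ?case .
    qed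
    define h where "h = (\<lambda>n. if n \<ge> n0 then v (nat (N1 - n)) else 2 powr (of_int (n0 - n)) * v (nat (N1 - n0)))"
    show ?thesis
    proof (intro exI[of _ h] conjI allI impI)
      fix n show "0 < h n" by (simp add: h_def vp)
    next
      fix n assume n: "n0 \<le> n"
      have le: "int (nat (N1 - n)) \<le> N1 - n0" using n N by simp
      have "v (nat (N1 - n)) \<le> (2 * X) ^ (nat (N1 - n) + 1)" by (rule vb[OF le])
      also have "\<dots> \<le> W" unfolding W_def using X1 n by (intro power_increasing) auto
      finally show "h n \<le> W" using n by (simp add: h_def)
    next
      show "h N1 = 1 / D N1" using N by (simp add: h_def v0)
    next
      fix n assume n: "n0 \<le> n" "n < N1"
      define m where "m = nat (N1 - n - 1)"
      have m: "nat (N1 - n) = Suc m" "nat (N1 - (n+1)) = m" "int m = N1 - n - 1" using n by (auto simp: m_def)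
      have "D n * v (Suc m) = 4 * D (n+1) * r n * v m + 2 powr (of_int (n - N1))"
        using Dp[of n] by (simp add: vS m(3))
      then show "D n * h n = 4 * D (n+1) * r n * h (n+1) + 2 powr (of_int (n - N1))"
        using n by (simp only: h_def m) simp
    next
      fix n assume "n < n0"
      then show "h n = 2 powr (of_int (n0 - n)) * h n0" using N by (simp add: h_def)
    qed
  qed
  moreover have "0 < W" using X1 by (simp add: W_def)
  ultimately show ?thesis by blast
qed

text \<open>
  At the junction \<open>n0\<close> the two pieces fit because $D_{n_0} h_{n_0} \ge U_{n_0} h_{n_0+1}$ by the recursion, while
  $2 D_{n_0 - 1} - U_{n_0 - 1}$ is close to $2g - 8g < 0$.  To the left of it the bracket is close to
  $(2g + 4g - g - 8g) h_n = -3g\, h_n$.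
\<close>

lemma static_weight_op:
  fixes \<beta> g c1 C1 R \<eta> W :: real and n0 N1 :: int and D r q h :: "int \<Rightarrow> real"
  assumes \<beta>: "1 < \<beta>" "\<beta> < 2" and pos: "0 < g" "0 < c1" "0 < C1" "0 < R" and N: "n0 < N1"
    and cb: "coeff_bounds \<beta> g c1 C1 R n0 D r" and ad: "admissible_ratios \<beta> \<eta> N1 r q"
    and hp: "\<And>n. 0 < h n" and hW: "\<And>n. n0 \<le> n \<Longrightarrow> h n \<le> W" and W: "0 < W"
    and hmid: "\<And>n. n0 \<le> n \<Longrightarrow> n < N1 \<Longrightarrow> D n * h n = 4 * D (n+1) * r n * h (n+1) + 2 powr (of_int (n - N1))"
    and hleft: "\<And>n. n < n0 \<Longrightarrow> h n = 2 powr (of_int (n0 - n)) * h n0"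
    and \<eta>: "0 < \<eta>" "\<eta> \<le> 1/100" "\<eta> * ((1 + 4 * R) * C1 * 2 powr (\<beta> * of_int N1) * W) \<le> 2 powr (of_int (n0 - N1)) / 4"
    and E: "0 \<le> E" "2 * E * W < 2 powr (of_int (n0 - N1)) / 2" "2 * E \<le> g"
    and n: "n < N1"
  shows "chain_op D q h n < - (2 * E * h n)"
proof -
  have Dp: "0 < D m" and rp: "0 < r m" and rR: "r m \<le> R" for m using cb by (auto simp: coeff_bounds_def)
  have Dlow: "\<bar>D m - g\<bar> \<le> g / 50" and rlow: "\<bar>r m - 2\<bar> \<le> 1 / 25" if "m \<le> n0" for m
    using cb that by (auto simp: coeff_bounds_def)
  have qr: "\<bar>q m - r m\<bar> \<le> \<eta> * r m" if "m < N1" for m using ad that by (auto simp: admissible_ratios_def)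
  have half: "h (m - 1) = 2 * h m" if "m \<le> n0" for m
  proof (cases "m = n0")
    case True then show ?thesis using hleft[of "n0 - 1"] by simp
  next
    case False
    have "2 powr real_of_int (n0 - (m - 1)) = 2 * (2::real) powr real_of_int (n0 - m)"
      using powr_add[of "2::real" 1 "real_of_int (n0 - m)"] by (simp add: algebra_simps)
    then show ?thesis using hleft[of m] hleft[of "m - 1"] False that by simp
  qed
  consider "n0 < n" | "n = n0" | "n < n0" by linarith
  then show ?thesis
  proof cases
    case 1
    have e1: "D (n-1) * h (n-1) = 4 * D n * r (n-1) * h n + 2 powr (of_int (n - 1 - N1))"
      using hmid[of "n-1"] 1 n by simp
    have e2: "D n * h n = 4 * D (n+1) * r n * h (n+1) + 2 powr (of_int (n - N1))" using hmid[of n] 1 n by simp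
    have p2: "2 powr (of_int (n - N1)) = 2 * (2::real) powr (of_int (n - 1 - N1))"
      using powr_add[of "2::real" 1 "real_of_int (n - 1 - N1)"] by (simp add: algebra_simps)
    have up: "4 * D (n+1) * q n * h (n+1) \<le> (1 + \<eta>) * (4 * D (n+1) * r n * h (n+1))"
    proof -
      have "q n \<le> (1 + \<eta>) * r n" using qr[of n] n by (simp add: algebra_simps abs_le_iff)
      then have "(4 * D (n+1) * h (n+1)) * q n \<le> (4 * D (n+1) * h (n+1)) * ((1 + \<eta>) * r n)"
        using Dp[of "n+1"] hp[of "n+1"] by (intro mult_left_mono) auto
      then show ?thesis by (simp add: mult_ac)
    qed
    have lo: "4 * D n * r (n-1) * h n - 4 * D n * q (n-1) * h n \<le> \<eta> * (4 * R * (D n * h n))"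
    proof -
      have "r (n-1) - q (n-1) \<le> \<eta> * R"
        using qr[of "n-1"] n mult_left_mono[OF rR[of "n-1"] less_imp_le[OF \<eta>(1)]] by linarith
      then have "(4 * D n * h n) * (r (n-1) - q (n-1)) \<le> (4 * D n * h n) * (\<eta> * R)"
        using Dp[of n] hp[of n] by (intro mult_left_mono) auto
      then show ?thesis by (simp add: algebra_simps)
    qed
    have Dh: "\<eta> * ((1 + 4 * R) * (D n * h n)) \<le> 2 powr (of_int (n0 - N1)) / 4"
    proof -
      have "D n \<le> C1 * 2 powr (\<beta> * of_int n)" using cb 1 by (auto simp: coeff_bounds_def)
      also have "\<dots> \<le> C1 * 2 powr (\<beta> * of_int N1)"
        using n \<beta> pos by (intro mult_left_mono powr_mono mult_left_mono) auto
      finally have "D n * h n \<le> (C1 * 2 powr (\<beta> * of_int N1)) * W"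
        using hW[of n] 1 hp[of n] pos by (intro mult_mono) auto
      then have "\<eta> * ((1 + 4 * R) * (D n * h n)) \<le> \<eta> * ((1 + 4 * R) * (C1 * 2 powr (\<beta> * of_int N1) * W))"
        using \<eta> pos by (intro mult_left_mono) auto
      also have "\<dots> \<le> 2 powr (of_int (n0 - N1)) / 4" using \<eta>(3) by (simp only: mult.assoc)
      finally show ?thesis .
    qed
    have p0: "2 powr (of_int (n0 - N1)) \<le> (2::real) powr (of_int (n - 1 - N1))"
      using 1 by (intro powr_mono) auto
    have Eh: "2 * E * h n \<le> 2 * E * W" using hW[of n] 1 E by (intro mult_left_mono) auto
    define P where "P = 4 * D (n+1) * r n * h (n+1)"
    define x where "x = D n * h n"
    define y where "y = (2::real) powr (of_int (n - 1 - N1))"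
    have "x = P + 2 * y" using e2 p2 by (simp add: P_def x_def y_def)
    have y0: "0 < y" by (simp add: y_def)
    have "chain_op D q h n \<le> \<eta> * (4 * R * x) + y + (1 + \<eta>) * P - x"
      using up lo e1 unfolding chain_op_def P_def x_def y_def by (simp add: algebra_simps)
    also have "\<dots> = \<eta> * ((1 + 4 * R) * x) - y - 2 * \<eta> * y"
      using \<open>x = P + 2 * y\<close> by (simp add: algebra_simps)
    also have "\<dots> \<le> y / 4 - y"
    proof -
      have "0 \<le> 2 * \<eta> * y" using \<eta> y0 by simp
      then show ?thesis using Dh p0 unfolding x_def[symmetric] y_def[symmetric] by linarith
    qed
    also have "\<dots> < - (2 * E * h n)"
      using Eh E p0 y0 unfolding y_def[symmetric] by linarith
    finally show ?thesis .
  next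
    case 2
    have u: "4 * D (n+1) * q n * h (n+1) \<le> (1 + \<eta>) * (D n * h n)"
    proof -
      have "q n \<le> (1 + \<eta>) * r n" using qr[of n] n by (simp add: algebra_simps abs_le_iff)
      then have "(4 * D (n+1) * h (n+1)) * q n \<le> (4 * D (n+1) * h (n+1)) * ((1 + \<eta>) * r n)"
        using Dp[of "n+1"] hp[of "n+1"] by (intro mult_left_mono) auto
      also have "\<dots> = (1 + \<eta>) * (4 * D (n+1) * r n * h (n+1))" by simp
      also have "\<dots> \<le> (1 + \<eta>) * (D n * h n)"
        using hmid[of n] 2 n \<eta> by (intro mult_left_mono) auto
      finally show ?thesis by (simp add: mult_ac)
    qed
    have q1: "19/10 \<le> q (n-1)"
    proof -
      have "\<eta> * r (n-1) \<le> 1/100 * r (n-1)" using \<eta> rp[of "n-1"] by (intro mult_right_mono) auto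
      moreover have "\<bar>q (n-1) - r (n-1)\<bar> \<le> \<eta> * r (n-1)" "\<bar>r (n-1) - 2\<bar> \<le> 1 / 25"
        using qr[of "n-1"] rlow[of "n-1"] n 2 by simp_all
      ultimately show ?thesis by linarith
    qed
    have "4 * D n * (19/10) * h n \<le> 4 * D n * q (n-1) * h n"
      using q1 Dp[of n] hp[of n] by (intro mult_right_mono mult_left_mono) auto
    moreover have "h (n-1) = 2 * h n" using half[of n] 2 by simp
    ultimately have "chain_op D q h n \<le> (2 * D (n-1) + \<eta> * D n - 4 * D n * (19/10)) * h n"
      using u unfolding chain_op_def by (simp add: algebra_simps)
    also have "\<dots> \<le> (- 2 * g) * h n"
    proof (rule mult_right_mono)
      have "\<eta> * D n \<le> 1/100 * D n" using \<eta> Dp[of n] by (intro mult_right_mono) auto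
      then show "2 * D (n-1) + \<eta> * D n - 4 * D n * (19/10) \<le> - 2 * g"
      proof -
        have "\<bar>D n - g\<bar> \<le> g / 50" "\<bar>D (n-1) - g\<bar> \<le> g / 50" using Dlow[of n] Dlow[of "n-1"] 2 by simp_all
        then show ?thesis using \<open>\<eta> * D n \<le> 1/100 * D n\<close> pos(1) by linarith
      qed
    qed (use hp[of n] in simp)
    also have "\<dots> < - (2 * E * h n)"
    proof -
      have "2 * E * h n \<le> g * h n" using E(3) hp[of n] by (intro mult_right_mono) auto
      moreover have "0 < g * h n" using pos hp[of n] by simp
      ultimately show ?thesis by linarith
    qed
    finally show ?thesis .
  next
    case 3
    have q1: "19/10 \<le> q (n-1)"
    proof -
      have "\<eta> * r (n-1) \<le> 1/100 * r (n-1)" using \<eta> rp[of "n-1"] by (intro mult_right_mono) auto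
      moreover have "\<bar>q (n-1) - r (n-1)\<bar> \<le> \<eta> * r (n-1)" "\<bar>r (n-1) - 2\<bar> \<le> 1 / 25"
        using qr[of "n-1"] rlow[of "n-1"] n 3 by simp_all
      ultimately show ?thesis by linarith
    qed
    have q2: "q n \<le> 21/10"
    proof -
      have "\<eta> * r n \<le> 1/100 * r n" using \<eta> rp[of n] by (intro mult_right_mono) auto
      moreover have "\<bar>q n - r n\<bar> \<le> \<eta> * r n" "\<bar>r n - 2\<bar> \<le> 1 / 25"
        using qr[of n] rlow[of n] n 3 by simp_all
      ultimately show ?thesis by linarith
    qed
    have "4 * D n * (19/10) * h n \<le> 4 * D n * q (n-1) * h n"
      using q1 Dp[of n] hp[of n] by (intro mult_right_mono mult_left_mono) auto
    moreover have "h (n-1) = 2 * h n" using half[of n] 3 by simp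
    moreover have "4 * D (n+1) * q n * h (n+1) \<le> 2 * D (n+1) * (21/10) * h n"
    proof -
      have "4 * D (n+1) * q n * h (n+1) \<le> 4 * D (n+1) * (21/10) * h (n+1)"
        using q2 Dp[of "n+1"] hp[of "n+1"] by (intro mult_right_mono mult_left_mono) auto
      then show ?thesis using half[of "n+1"] 3 by simp
    qed
    ultimately have "chain_op D q h n \<le> (2 * D (n-1) + 2 * D (n+1) * (21/10) - D n - 4 * D n * (19/10)) * h n"
      unfolding chain_op_def by (simp add: algebra_simps)
    also have "\<dots> \<le> (- 2 * g) * h n"
    proof (rule mult_right_mono)
      have "\<bar>D n - g\<bar> \<le> g / 50" "\<bar>D (n-1) - g\<bar> \<le> g / 50" "\<bar>D (n+1) - g\<bar> \<le> g / 50"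
        using Dlow[of n] Dlow[of "n-1"] Dlow[of "n+1"] 3 by simp_all
      then show "2 * D (n-1) + 2 * D (n+1) * (21/10) - D n - 4 * D n * (19/10) \<le> - 2 * g"
        using pos(1) by linarith
    qed (use hp[of n] in simp)
    also have "\<dots> < - (2 * E * h n)"
    proof -
      have "2 * E * h n \<le> g * h n" using E(3) hp[of n] by (intro mult_right_mono) auto
      moreover have "0 < g * h n" using pos hp[of n] by simp
      ultimately show ?thesis by linarith
    qed
    finally show ?thesis .
  qed
qed

text \<open>
  \<open>w'\<close> is the derivative of \<open>w\<close> in its time-like argument.
\<close>

definition decay_weights :: "real \<Rightarrow> real \<Rightarrow> real \<Rightarrow> int \<Rightarrow> (int \<Rightarrow> real) \<Rightarrow> (int \<Rightarrow> real) \<Rightarrow>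
    (int \<Rightarrow> real \<Rightarrow> real) \<Rightarrow> (int \<Rightarrow> real \<Rightarrow> real) \<Rightarrow> real \<Rightarrow> real \<Rightarrow> bool" where
  "decay_weights \<beta> \<nu> \<eta> N1 D r w w' c C \<longleftrightarrow>
     0 < c \<and> 0 < C \<and>
     (\<forall>n. \<forall>s\<ge>0. 0 < w n s \<and> w' n s \<le> 0 \<and> (w n has_real_derivative w' n s) (at s)) \<and>
     (\<forall>n s q. 0 \<le> s \<longrightarrow> s \<le> 1 \<longrightarrow> admissible_ratios \<beta> \<eta> N1 r q \<longrightarrow>
        chain_op D q (\<lambda>m. w m s) n < - (2 * (\<nu> * w n s - w' n s))) \<and>
     (\<forall>n. c * 2 powr (- of_int n) \<le> w n 0) \<and>
     (\<forall>n. \<forall>s\<ge>0. w n s \<le> C * 2 powr (- of_int n)) \<and>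
     (\<forall>n\<ge>0. \<forall>s>0. w n s \<le> C * s powr (- ((\<beta> - 1) / \<beta>)) * 2 powr (- \<beta> * of_int n)) \<and>
     (\<forall>n\<ge>N1. \<forall>s>0. D n * w n s \<le> C * s powr (- ((\<beta> - 1) / \<beta>)))"

text \<open>
  The static weights are multiplied by $\sigma_{N_1}(s)$ and continued by $\sigma_n(s)/D_n$ from \<open>N1\<close> on.  The
  rate \<open>\<nu>\<close> is chosen before the coefficients, so it depends on their bounds only.
\<close>

lemma supersolution_weights:
  fixes \<beta> g c1 C1 R :: real and n0 N1 :: int
  assumes \<beta>: "1 < \<beta>" "\<beta> < 2" and pos: "0 < g" "0 < c1" "0 < C1" "0 < R" and N: "n0 < N1" "n0 \<le> 0" "0 \<le> N1"
  shows "\<exists>\<nu>>0. \<exists>\<eta>>0. \<forall>D r. coeff_bounds \<beta> g c1 C1 R n0 D r \<longrightarrow>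
   (\<exists>w w' c C. decay_weights \<beta> \<nu> \<eta> N1 D r w w' c C)"
proof -
  obtain W where W: "0 < W" and Wex: "\<And>D r. coeff_bounds \<beta> g c1 C1 R n0 D r \<Longrightarrow>
    (\<exists>h. (\<forall>n. 0 < h n) \<and> (\<forall>n\<ge>n0. h n \<le> W) \<and> h N1 = 1 / D N1 \<and>
       (\<forall>n. n0 \<le> n \<longrightarrow> n < N1 \<longrightarrow> D n * h n = 4 * D (n+1) * r n * h (n+1) + 2 powr (of_int (n - N1))) \<and>
       (\<forall>n<n0. h n = 2 powr (of_int (n0 - n)) * h n0))"
    using static_weights[OF \<beta> pos(2-4) N(1), of g] by blast
  define \<theta> where "\<theta> = (\<beta> - 1) / \<beta>"
  have \<theta>: "0 < \<theta>" "\<theta> < 1" using \<beta> by (auto simp: \<theta>_def)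
  define G where "G = (2::real) powr (\<beta> * of_int N1)"
  have G: "1 \<le> G" using ge_one_powr_ge_zero[of 2 "\<beta> * of_int N1"] \<beta> N by (simp add: G_def)
  define d where "d = (2::real) powr (of_int (n0 - N1))"
  have d: "0 < d" "d \<le> 1" using N powr_mono[of "of_int (n0 - N1)" 0 "2::real"] by (auto simp: d_def)
  \<comment> \<open>An upper bound for $\nu + |\partial_s w_n|/w_n$ at indices below \<open>N1\<close> that leaves room in all three regions of the static weights.\<close>
  define E where "E = min (d / (16 * W)) (g / 8)"
  have E: "0 < E" "16 * E * W \<le> d" "8 * E \<le> g"
    using d W pos by (auto simp: E_def min_def field_simps)
  define \<kappa> where "\<kappa> = min 1 (min (c1 / 200) (E / G))"
  have \<kappa>': "0 < \<kappa>" "\<kappa> \<le> 1" "\<kappa> \<le> c1 / 200" "\<kappa> \<le> E / G"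
    using pos E G min.cobounded1[of "c1 / 200" "E / G"] min.cobounded2[of "c1 / 200" "E / G"]
      min.cobounded1[of 1 "min (c1 / 200) (E / G)"] min.cobounded2[of 1 "min (c1 / 200) (E / G)"]
    unfolding \<kappa>_def by (simp, linarith+)
  then have \<kappa>: "0 < \<kappa>" "\<kappa> \<le> 1" "\<kappa> \<le> c1 / 200" "\<kappa> * G \<le> E"
    using G by (auto simp: field_simps)
  define \<nu> where "\<nu> = min (\<theta> * c1 / 200) E"
  have \<nu>: "0 < \<nu>" "\<nu> \<le> \<theta> * c1 / 200" "\<nu> \<le> E"
    using \<theta> pos E min.cobounded1[of "\<theta> * c1 / 200" E] min.cobounded2[of "\<theta> * c1 / 200" E]
    unfolding \<nu>_def by simp_all
  define Z where "Z = (1 + 4 * R) * C1 * G * W"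
  have Z: "0 < Z" using pos G W by (simp add: Z_def)
  define \<eta> where "\<eta> = min (1/100) (min (1 / (32 * R)) (d / (4 * Z)))"
  have \<eta>': "0 < \<eta>" "\<eta> \<le> 1/100" "\<eta> \<le> 1 / (32 * R)" "\<eta> \<le> d / (4 * Z)"
    using pos d Z min.cobounded1[of "1 / (32 * R)" "d / (4 * Z)"] min.cobounded2[of "1 / (32 * R)" "d / (4 * Z)"]
      min.cobounded1[of "1/100" "min (1 / (32 * R)) (d / (4 * Z))"] min.cobounded2[of "1/100" "min (1 / (32 * R)) (d / (4 * Z))"]
    unfolding \<eta>_def by (simp, linarith+)
  then have \<eta>: "0 < \<eta>" "\<eta> \<le> 1/100" "\<eta> * R \<le> 1/32" "\<eta> * Z \<le> d / 4"
    using pos Z by (auto simp: field_simps)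
  have main: "\<exists>w w' c C. decay_weights \<beta> \<nu> \<eta> N1 D r w w' c C"
    if cb: "coeff_bounds \<beta> g c1 C1 R n0 D r" for D r
  proof -
    obtain h where hp: "\<And>n. 0 < h n" and hW: "\<And>n. n0 \<le> n \<Longrightarrow> h n \<le> W" and hN: "h N1 = 1 / D N1"
      and hmid: "\<And>n. n0 \<le> n \<Longrightarrow> n < N1 \<Longrightarrow> D n * h n = 4 * D (n+1) * r n * h (n+1) + 2 powr (of_int (n - N1))"
      and hleft: "\<And>n. n < n0 \<Longrightarrow> h n = 2 powr (of_int (n0 - n)) * h n0"
      using Wex[OF cb] by blast
    have Dp: "0 < D m" and rp: "0 < r m" and rR: "r m \<le> R" for m using cb by (auto simp: coeff_bounds_def)
    have Dl: "c1 * 2 powr (\<beta> * of_int n) \<le> D n" and Du: "D n \<le> C1 * 2 powr (\<beta> * of_int n)" if "n0 \<le> n" for n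
      using cb that by (auto simp: coeff_bounds_def)
    define \<tau> where "\<tau> = (\<lambda>n. (2::real) powr (- \<beta> * of_int n))"
    define x where "x = (\<lambda>n s. \<tau> n + \<kappa> * s)"
    define \<sigma> where "\<sigma> = profile \<beta> \<kappa>"
    have \<tau>p: "0 < \<tau> n" for n by (simp add: \<tau>_def)
    have \<tau>1: "\<tau> n \<le> 1" if "0 \<le> n" for n using powr_mono[of "- \<beta> * of_int n" 0 "2::real"] \<beta> that by (simp add: \<tau>_def)
    have Dinv: "1 / D n \<le> \<tau> n / c1" if "n0 \<le> n" for n
    proof -
      have "1 / D n \<le> 1 / (c1 * 2 powr (\<beta> * of_int n))"
        using Dl[OF that] pos by (intro divide_left_mono) (auto simp: Dp)
      also have "\<dots> = \<tau> n / c1" by (simp add: \<tau>_def powr_minus field_simps)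
      finally show ?thesis .
    qed
    have xp: "0 < x n s" if "0 \<le> s" for n s using \<tau>p[of n] \<kappa> that by (simp add: x_def add_pos_nonneg)
    have \<sigma>x: "\<sigma> n s = x n s * x n s powr (-\<theta> - 1)" if "0 \<le> s" for n s
    proof -
      have "\<sigma> n s = x n s powr (1 + (-\<theta> - 1))" by (simp add: \<sigma>_def profile_def x_def \<tau>_def \<theta>_def)
      also have "\<dots> = x n s powr 1 * x n s powr (-\<theta> - 1)" by (rule powr_add)
      finally show ?thesis using xp[OF that, of n] by simp
    qed
    have \<sigma>p: "0 < \<sigma> n s" if "0 \<le> s" for n s using profile_pos \<kappa> that by (simp add: \<sigma>_def)
    have gap: "\<theta> / 8 * \<tau> n * x n s powr (- \<theta> - 1) \<le> \<sigma> n s - \<sigma> (n - 1) s" if "0 \<le> s" for n s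
      using profile_gap[OF \<beta>, of \<kappa> s n] \<kappa> that by (simp add: \<sigma>_def \<theta>_def \<tau>_def x_def)
    have \<sigma>2: "\<sigma> (n + 1) s \<le> 2 * \<sigma> n s" if "0 \<le> s" for n s
      using profile_Suc_le[OF \<beta>, of \<kappa> s n] \<kappa> that by (simp add: \<sigma>_def)
    have \<sigma>der: "(\<sigma> n has_real_derivative - (\<theta> * \<kappa> * x n s powr (- \<theta> - 1))) (at s)" if "0 \<le> s" for n s
      using profile_derivative[of \<kappa> s \<beta> n] \<kappa> that by (simp add: \<sigma>_def \<theta>_def \<tau>_def x_def)
    define w where "w = (\<lambda>n s. if N1 \<le> n then \<sigma> n s / D n else \<sigma> N1 s * h n)"
    define w' where "w' = (\<lambda>n s. if N1 \<le> n then - (\<theta> * \<kappa> * x n s powr (- \<theta> - 1)) / D n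
        else - (\<theta> * \<kappa> * x N1 s powr (- \<theta> - 1)) * h n)"
    have wleft: "w n s = \<sigma> N1 s * h n" if "n \<le> N1" for n s using that hN by (auto simp: w_def)
    have Dw: "D n * w n s = \<sigma> n s" if "N1 \<le> n" for n s using that Dp[of n] by (auto simp: w_def)
    have basic: "0 < w n s \<and> w' n s \<le> 0 \<and> (w n has_real_derivative w' n s) (at s)" if s: "0 \<le> s" for n s
    proof (cases "N1 \<le> n")
      case True
      have "((\<lambda>s. \<sigma> n s / D n) has_real_derivative w' n s) (at s)"
        using DERIV_cdivide[OF \<sigma>der[OF s], of n "D n"] True by (simp add: w'_def)
      then show ?thesis using True \<sigma>p[OF s] Dp[of n] \<theta> \<kappa> by (auto simp: w_def[abs_def] w'_def)
    next
      case False
      have "((\<lambda>s. \<sigma> N1 s * h n) has_real_derivative w' n s) (at s)"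
        using DERIV_cmult_right[OF \<sigma>der[OF s], of N1 "h n"] False by (simp add: w'_def)
      then show ?thesis using False \<sigma>p[OF s] hp[of n] \<theta> \<kappa> by (auto simp: w_def[abs_def] w'_def)
    qed
    have op: "chain_op D q (\<lambda>m. w m s) n < - (2 * (\<nu> * w n s - w' n s))"
      if s: "0 \<le> s" "s \<le> 1" and ad: "admissible_ratios \<beta> \<eta> N1 r q" for n s q
    proof (cases "n < N1")
      case True
      have "chain_op D q h n < - (2 * (2 * E) * h n)"
      proof (rule static_weight_op[OF \<beta> pos N(1) cb ad hp hW W hmid hleft])
        show "\<eta> * ((1 + 4 * R) * C1 * 2 powr (\<beta> * of_int N1) * W) \<le> 2 powr (of_int (n0 - N1)) / 4"
          using \<eta>(4) by (simp add: Z_def G_def d_def)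
        show "2 * (2 * E) * W < 2 powr (of_int (n0 - N1)) / 2"
          unfolding d_def[symmetric] using E(2) mult_pos_pos[OF E(1) W] by simp
      qed (use \<eta> E True in auto)
      then have "\<sigma> N1 s * chain_op D q h n < \<sigma> N1 s * (- (2 * (2 * E) * h n))"
        using \<sigma>p[OF s(1)] by (intro mult_strict_left_mono) auto
      moreover have "chain_op D q (\<lambda>m. w m s) n = \<sigma> N1 s * chain_op D q h n"
        using True by (simp add: chain_op_def wleft algebra_simps)
      moreover have "\<nu> * w n s \<le> E * (\<sigma> N1 s * h n)"
        using True \<nu> \<sigma>p[OF s(1), of N1] hp[of n] by (simp add: wleft mult_right_mono)
      moreover have "- w' n s \<le> E * (\<sigma> N1 s * h n)"
      proof -
        have "1 / G = \<tau> N1" by (simp add: G_def \<tau>_def powr_minus field_simps)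
        then have "1 / G \<le> x N1 s" using \<kappa> s by (simp add: x_def)
        then have "1 \<le> G * x N1 s" using G by (simp add: field_simps)
        then have "1 * x N1 s powr (-\<theta> - 1) \<le> (G * x N1 s) * x N1 s powr (-\<theta> - 1)" by (intro mult_right_mono) auto
        then have "x N1 s powr (-\<theta> - 1) \<le> G * \<sigma> N1 s" using \<sigma>x[OF s(1), of N1] by simp
        then have "\<theta> * \<kappa> * x N1 s powr (-\<theta> - 1) \<le> 1 * \<kappa> * (G * \<sigma> N1 s)"
          using \<theta> \<kappa> by (intro mult_mono) auto
        also have "\<dots> = (\<kappa> * G) * \<sigma> N1 s" by simp
        also have "\<dots> \<le> E * \<sigma> N1 s" using \<kappa> \<sigma>p[OF s(1), of N1] by (intro mult_right_mono) auto
        finally have "\<theta> * \<kappa> * x N1 s powr (-\<theta> - 1) * h n \<le> E * \<sigma> N1 s * h n"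
          using hp[of n] by (intro mult_right_mono) auto
        then show ?thesis using True by (simp add: w'_def mult_ac)
      qed
      ultimately show ?thesis by (simp add: algebra_simps)
    next
      case False
      then have n: "N1 \<le> n" by simp
      define S where "S = \<tau> n * x n s powr (-\<theta> - 1)"
      have Sp: "0 < S" using \<tau>p[of n] xp[OF s(1), of n] by (simp add: S_def)
      have x2: "x n s \<le> 2"
        using \<tau>1[of n] n N mult_mono[OF \<kappa>(2) s(2)] \<kappa> s by (simp add: x_def)
      have \<sigma>S: "\<tau> n * \<sigma> n s \<le> 2 * S"
        using mult_right_mono[OF x2, of "\<tau> n * x n s powr (-\<theta> - 1)"] \<tau>p[of n]
        by (simp add: \<sigma>x[OF s(1)] S_def mult_ac)
      have Di: "1 / D n \<le> \<tau> n / c1" using Dinv[of n] n N by simp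
      have w1: "w n s \<le> 2 * S / c1"
      proof -
        have "w n s = \<sigma> n s * (1 / D n)" using n by (simp add: w_def)
        also have "\<dots> \<le> \<sigma> n s * (\<tau> n / c1)" using Di \<sigma>p[OF s(1), of n] by (intro mult_left_mono) auto
        also have "\<dots> \<le> 2 * S / c1" using \<sigma>S pos by (simp add: divide_right_mono mult_ac)
        finally show ?thesis .
      qed
      have w2: "- w' n s \<le> \<theta> * \<kappa> * S / c1"
      proof -
        have "- w' n s = \<theta> * \<kappa> * x n s powr (-\<theta> - 1) * (1 / D n)" using n by (simp add: w'_def)
        also have "\<dots> \<le> \<theta> * \<kappa> * x n s powr (-\<theta> - 1) * (\<tau> n / c1)" using Di \<theta> \<kappa> by (intro mult_left_mono) auto
        also have "\<dots> = \<theta> * \<kappa> * S / c1" by (simp add: S_def mult_ac)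
        finally show ?thesis .
      qed
      have b: "2 * (\<nu> * w n s - w' n s) \<le> 3 * \<theta> * S / 100"
      proof -
        have "\<nu> * w n s \<le> (\<theta> * c1 / 200) * (2 * S / c1)"
          using w1 \<nu> basic[OF s(1), of n] \<theta> pos by (intro mult_mono) auto
        also have "\<dots> = \<theta> * S / 100" using pos by simp
        finally have 1: "\<nu> * w n s \<le> \<theta> * S / 100" .
        have "\<theta> * \<kappa> * S / c1 \<le> \<theta> * (c1 / 200) * S / c1"
          using \<kappa> \<theta> Sp pos by (intro divide_right_mono mult_right_mono mult_left_mono) auto
        also have "\<dots> = \<theta> * S / 200" using pos by simp
        finally have 2: "\<theta> * \<kappa> * S / c1 \<le> \<theta> * S / 200" .
        have "2 * (\<nu> * w n s - w' n s) = 2 * (\<nu> * w n s) + 2 * (- w' n s)" by simp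
        also have "\<dots> \<le> 2 * (\<theta> * S / 100) + 2 * (\<theta> * S / 200)"
          using 1 order_trans[OF w2 2] by (intro add_mono mult_left_mono) auto
        also have "\<dots> = 3 * \<theta> * S / 100" by simp
        finally show ?thesis .
      qed
      have qn: "0 \<le> q n" "q n \<le> \<theta> / 2048 * \<tau> n" using ad n by (auto simp: admissible_ratios_def \<theta>_def \<tau>_def)
      have up: "4 * D (n+1) * q n * w (n+1) s \<le> \<theta> * S / 128"
      proof -
        have "4 * D (n+1) * q n * w (n+1) s = 4 * q n * \<sigma> (n+1) s" using Dw[of "n+1" s] n by (simp add: mult_ac)
        also have "\<dots> \<le> 4 * (\<theta> / 2048 * \<tau> n) * (2 * \<sigma> n s)"
          using qn \<sigma>2[OF s(1), of n] \<sigma>p[OF s(1), of "n+1"] \<theta> \<tau>p[of n] by (intro mult_mono) auto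
        also have "\<dots> = \<theta> / 256 * (\<tau> n * \<sigma> n s)" by simp
        also have "\<dots> \<le> \<theta> / 256 * (2 * S)" using \<sigma>S \<theta> by (intro mult_left_mono) auto
        finally show ?thesis by (simp add: mult.commute)
      qed
      show ?thesis
      proof (cases "n = N1")
        case False
        then have "0 \<le> q (n-1)" "N1 \<le> n - 1" using ad n by (auto simp: admissible_ratios_def)
        then have nn: "0 \<le> 4 * D n * q (n-1) * w n s" and Dn1: "D (n-1) * w (n-1) s = \<sigma> (n-1) s"
          using Dw Dp[of n] basic[OF s(1), of n] by auto
        have "chain_op D q (\<lambda>m. w m s) n = \<sigma> (n-1) s + 4 * D (n+1) * q n * w (n+1) s - \<sigma> n s - 4 * D n * q (n-1) * w n s"
          using Dw[OF n, of s] by (simp add: chain_op_def Dn1 distrib_right)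
        then have "chain_op D q (\<lambda>m. w m s) n \<le> \<sigma> (n-1) s + \<theta> * S / 128 - \<sigma> n s"
          using up nn by linarith
        moreover have "\<theta> * S / 8 \<le> \<sigma> n s - \<sigma> (n-1) s" using gap[OF s(1), of n] by (simp add: S_def)
        moreover have "3 * \<theta> * S / 100 < \<theta> * S / 8 - \<theta> * S / 128" using mult_pos_pos[OF \<theta>(1) Sp] by (simp add: mult.commute)
        ultimately show ?thesis using b by linarith
      next
        case True
        have e: "D (N1-1) * h (N1-1) = 4 * r (N1-1) + 1/2"
          using hmid[of "N1-1"] N hN Dp[of N1] by (simp add: powr_minus)
        have qq: "r (N1-1) - q (N1-1) \<le> 1/32"
        proof -
          have "\<eta> * r (N1-1) \<le> \<eta> * R" using \<eta> rR by (intro mult_left_mono) auto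
          moreover have "\<bar>q (N1-1) - r (N1-1)\<bar> \<le> \<eta> * r (N1-1)" using ad by (auto simp: admissible_ratios_def)
          ultimately show ?thesis using \<eta>(3) by linarith
        qed
        have "chain_op D q (\<lambda>m. w m s) N1 = \<sigma> N1 s * (D (N1-1) * h (N1-1)) + 4 * D (N1+1) * q N1 * w (N1+1) s
               - (D N1 * w N1 s) - 4 * q (N1-1) * (D N1 * w N1 s)"
          by (simp add: chain_op_def wleft algebra_simps)
        also have "\<dots> = \<sigma> N1 s * (4 * (r (N1-1) - q (N1-1)) - 1/2) + 4 * D (N1+1) * q N1 * w (N1+1) s"
          unfolding e Dw[OF order_refl] by (simp add: algebra_simps)
        also have "\<dots> \<le> \<sigma> N1 s * (- (3/8)) + \<theta> * S / 128"
          using up qq \<sigma>p[OF s(1), of N1] True by (intro add_mono mult_left_mono) auto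
        finally have c: "chain_op D q (\<lambda>m. w m s) N1 \<le> - (3/8 * \<sigma> N1 s) + \<theta> * S / 128" by simp
        have "\<theta> * S / 8 < \<sigma> N1 s"
          using gap[OF s(1), of n] \<sigma>p[OF s(1), of "n-1"] True by (simp add: S_def)
        moreover have "0 < \<theta> * S" using \<theta> Sp by simp
        ultimately show ?thesis using b c True by simp
      qed
    qed
    have \<sigma>le: "\<sigma> n s \<le> 2 powr ((\<beta> - 1) * of_int n)" if "0 \<le> s" for n s
      using profile_le(1)[OF \<beta>, of \<kappa> s n] \<kappa> that by (simp add: \<sigma>_def)
    have \<sigma>le2: "\<sigma> n s \<le> \<kappa> powr (-\<theta>) * s powr (-\<theta>)" if "0 < s" for n s
      using profile_le(2)[OF \<beta>, of \<kappa> s n] \<kappa> that by (simp add: \<sigma>_def \<theta>_def)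
    have \<sigma>0: "\<sigma> n 0 = 2 powr ((\<beta> - 1) * of_int n)" for n
      using profile_le(3)[OF \<beta>, of \<kappa> 0 n] \<kappa> by (simp add: \<sigma>_def)
    have split: "2 powr ((\<beta> - 1) * of_int n) * \<tau> n = 2 powr (- of_int n)" for n
      by (simp add: \<tau>_def powr_add[symmetric] algebra_simps)
    have hn0: "h n \<le> W * 2 powr (of_int (N1 - n))" if "n \<le> N1" for n
    proof (cases "n < n0")
      case True
      have "h n = 2 powr (of_int (n0 - n)) * h n0" by (rule hleft[OF True])
      also have "\<dots> \<le> 2 powr (of_int (N1 - n)) * W"
        using hW[of n0] hp[of n0] N by (intro mult_mono powr_mono) auto
      finally show ?thesis by (simp add: mult.commute)
    next
      case False
      have "1 \<le> (2::real) powr (of_int (N1 - n))" using that by (intro ge_one_powr_ge_zero) auto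
      then have "W * 1 \<le> W * 2 powr (of_int (N1 - n))" using W by (intro mult_left_mono) auto
      then show ?thesis using hW[of n] False by linarith
    qed
    have hlo: "d * min (1 / (C1 * G)) (1 / D N1) * 2 powr (of_int (n0 - n)) \<le> h n" if "n \<le> N1" for n
    proof -
      have *: "d * min (1 / (C1 * G)) (1 / D N1) \<le> h m" if m: "n0 \<le> m" "m \<le> N1" for m
      proof (cases "m = N1")
        case True
        have "d * min (1 / (C1 * G)) (1 / D N1) \<le> 1 * (1 / D N1)"
          using d pos G Dp[of N1] by (intro mult_mono) auto
        then show ?thesis using True hN by simp
      next
        case False
        have "d \<le> 2 powr (of_int (m - N1))" unfolding d_def using m by (intro powr_mono) auto
        also have "\<dots> \<le> D m * h m"
          using hmid[of m] m False Dp[of "m+1"] rp[of m] hp[of "m+1"] by simp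
        also have "\<dots> \<le> (C1 * G) * h m"
        proof -
          have "D m \<le> C1 * 2 powr (\<beta> * of_int m)" using Du m by simp
          also have "\<dots> \<le> C1 * G" unfolding G_def
            using m \<beta> pos by (intro mult_left_mono powr_mono mult_left_mono) auto
          finally show ?thesis using hp[of m] by (intro mult_right_mono) auto
        qed
        finally have "d * (1 / (C1 * G)) \<le> h m" using pos G by (simp add: field_simps)
        moreover have "d * min (1 / (C1 * G)) (1 / D N1) \<le> d * (1 / (C1 * G))" using d by (intro mult_left_mono) auto
        ultimately show ?thesis by linarith
      qed
      show ?thesis
      proof (cases "n < n0")
        case True
        then show ?thesis using *[of n0] N hleft[OF True] by (simp add: mult.commute mult_left_mono)
      next
        case False
        have "2 powr (of_int (n0 - n)) \<le> (1::real)" using powr_mono[of "of_int (n0 - n)" 0 "2::real"] False by simp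
        then have "d * min (1 / (C1 * G)) (1 / D N1) * 2 powr (of_int (n0 - n)) \<le> d * min (1 / (C1 * G)) (1 / D N1) * 1"
          using d pos G Dp[of N1] by (intro mult_left_mono) auto
        then show ?thesis using *[of n] False that by simp
      qed
    qed
    define c where "c = min (1 / C1) (\<sigma> N1 0 * (d * min (1 / (C1 * G)) (1 / D N1)) * 2 powr (of_int n0))"
    have cpos: "0 < c" using pos d G Dp[of N1] \<sigma>p[of 0 N1] by (simp add: c_def)
    have lower: "c * 2 powr (- of_int n) \<le> w n 0" for n
    proof (cases "N1 \<le> n")
      case True
      have "D n \<le> C1 * 2 powr (\<beta> * of_int n)" using Du True N by simp
      then have "1 / (C1 * 2 powr (\<beta> * of_int n)) \<le> 1 / D n" using pos by (intro divide_left_mono) (auto simp: Dp)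
      then have "2 powr ((\<beta> - 1) * of_int n) * (1 / (C1 * 2 powr (\<beta> * of_int n))) \<le> 2 powr ((\<beta> - 1) * of_int n) * (1 / D n)"
        by (intro mult_left_mono) auto
      also have "\<dots> = w n 0" using True \<sigma>0 by (simp add: w_def)
      also have "2 powr ((\<beta> - 1) * of_int n) * (1 / (C1 * 2 powr (\<beta> * of_int n))) = 1 / C1 * 2 powr (- of_int n)"
        unfolding split[symmetric] \<tau>_def by (simp add: powr_minus field_simps)
      finally have "1 / C1 * 2 powr (- of_int n) \<le> w n 0" .
      moreover have "c * 2 powr (- of_int n) \<le> 1 / C1 * 2 powr (- of_int n)" by (intro mult_right_mono) (auto simp: c_def)
      ultimately show ?thesis by linarith
    next
      case False
      have "c * 2 powr (- of_int n) \<le> \<sigma> N1 0 * (d * min (1 / (C1 * G)) (1 / D N1)) * 2 powr (of_int n0) * 2 powr (- of_int n)"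
        by (intro mult_right_mono) (auto simp: c_def)
      also have "\<dots> = \<sigma> N1 0 * (d * min (1 / (C1 * G)) (1 / D N1) * 2 powr (of_int (n0 - n)))"
        using powr_add[of "2::real" "of_int n0" "- of_int n"] by (simp add: mult_ac)
      also have "\<dots> \<le> \<sigma> N1 0 * h n" using hlo[of n] False \<sigma>p[of 0 N1] by (intro mult_left_mono) auto
      finally show ?thesis using False by (simp add: w_def)
    qed
    define Ca where "Ca = 1 / c1 + 2 powr ((\<beta> - 1) * of_int N1) * W * 2 powr (of_int N1)"
    have upper1: "w n s \<le> Ca * 2 powr (- of_int n)" if s: "0 \<le> s" for n s
    proof (cases "N1 \<le> n")
      case True
      have "w n s = \<sigma> n s * (1 / D n)" using True by (simp add: w_def)
      also have "\<dots> \<le> 2 powr ((\<beta> - 1) * of_int n) * (\<tau> n / c1)"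
        using \<sigma>le[OF s, of n] Dinv[of n] True N Dp[of n] \<sigma>p[OF s, of n] by (intro mult_mono) auto
      also have "\<dots> = 1 / c1 * 2 powr (- of_int n)" unfolding split[symmetric] by simp
      also have "\<dots> \<le> Ca * 2 powr (- of_int n)" using W by (intro mult_right_mono) (auto simp: Ca_def)
      finally show ?thesis .
    next
      case False
      have "w n s = \<sigma> N1 s * h n" using False by (simp add: w_def)
      also have "\<dots> \<le> 2 powr ((\<beta> - 1) * of_int N1) * (W * 2 powr (of_int (N1 - n)))"
        using \<sigma>le[OF s, of N1] hn0[of n] False hp[of n] by (intro mult_mono) auto
      also have "\<dots> = 2 powr ((\<beta> - 1) * of_int N1) * W * 2 powr (of_int N1) * 2 powr (- of_int n)"
        using powr_add[of "2::real" "of_int N1" "- of_int n"] by (simp add: mult_ac)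
      also have "\<dots> \<le> Ca * 2 powr (- of_int n)" using pos by (intro mult_right_mono) (auto simp: Ca_def)
      finally show ?thesis .
    qed
    define Cb where "Cb = \<kappa> powr (-\<theta>) * (1 / c1 + W * G)"
    have upper2: "w n s \<le> Cb * s powr (-\<theta>) * 2 powr (- \<beta> * of_int n)" if n: "0 \<le> n" and s: "0 < s" for n s
    proof (cases "N1 \<le> n")
      case True
      have "w n s = \<sigma> n s * (1 / D n)" using True by (simp add: w_def)
      also have "\<dots> \<le> (\<kappa> powr (-\<theta>) * s powr (-\<theta>)) * (\<tau> n / c1)"
        using \<sigma>le2[OF s, of n] Dinv[of n] True N Dp[of n] by (intro mult_mono) auto
      also have "\<dots> = \<kappa> powr (-\<theta>) * (1 / c1) * (s powr (-\<theta>) * \<tau> n)" by simp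
      also have "\<dots> \<le> Cb * (s powr (-\<theta>) * \<tau> n)"
        unfolding Cb_def using \<tau>p[of n] W G by (intro mult_right_mono mult_left_mono) auto
      finally show ?thesis by (simp add: \<tau>_def mult_ac)
    next
      case False
      have g: "1 \<le> G * \<tau> n"
      proof -
        have "1 = G * \<tau> N1" by (simp add: G_def \<tau>_def powr_minus)
        also have "\<tau> N1 \<le> \<tau> n" unfolding \<tau>_def using False \<beta> by (intro powr_mono) auto
        then have "G * \<tau> N1 \<le> G * \<tau> n" using G by (intro mult_left_mono) auto
        finally show ?thesis .
      qed
      have "w n s = \<sigma> N1 s * h n" using False by (simp add: w_def)
      also have "\<dots> \<le> (\<kappa> powr (-\<theta>) * s powr (-\<theta>)) * W"
        using \<sigma>le2[OF s, of N1] hW[of n] n N hp[of n] by (intro mult_mono) auto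
      also have "\<dots> \<le> (\<kappa> powr (-\<theta>) * s powr (-\<theta>)) * W * (G * \<tau> n)"
        using mult_left_mono[OF g, of "(\<kappa> powr (-\<theta>) * s powr (-\<theta>)) * W"] W by simp
      also have "\<dots> = \<kappa> powr (-\<theta>) * (W * G) * (s powr (-\<theta>) * \<tau> n)" by simp
      also have "\<dots> \<le> Cb * (s powr (-\<theta>) * \<tau> n)"
        unfolding Cb_def using \<tau>p[of n] pos by (intro mult_right_mono mult_left_mono) auto
      finally show ?thesis by (simp add: \<tau>_def mult_ac)
    qed
    define C where "C = max Ca (max Cb (\<kappa> powr (-\<theta>)))"
    have Cpos: "0 < C" using \<kappa> by (simp add: C_def less_max_iff_disj)
    show ?thesis
      unfolding decay_weights_def \<theta>_def[symmetric]
    proof (rule exI[of _ w], rule exI[of _ w'], rule exI[of _ c], rule exI[of _ C], intro conjI allI impI cpos Cpos)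
      fix n s assume "0 \<le> (s::real)"
      then show "0 < w n s" "w' n s \<le> 0" "(w n has_real_derivative w' n s) (at s)" using basic by auto
      show "w n s \<le> C * 2 powr (- of_int n)"
        by (rule order_trans[OF upper1[OF \<open>0 \<le> s\<close>]]) (auto intro!: mult_right_mono simp: C_def)
    next
      fix n show "c * 2 powr (- of_int n) \<le> w n 0" by (rule lower)
    next
      fix n s assume "0 \<le> (n::int)" "0 < (s::real)"
      then show "w n s \<le> C * s powr (-\<theta>) * 2 powr (- \<beta> * of_int n)"
        by (rule order_trans[OF upper2]) (auto intro!: mult_right_mono simp: C_def)
    next
      fix n s assume n: "N1 \<le> n" "0 < (s::real)"
      have "D n * w n s \<le> \<kappa> powr (-\<theta>) * s powr (-\<theta>)" using Dw[OF n(1)] \<sigma>le2[OF n(2)] by simp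
      also have "\<dots> \<le> C * s powr (-\<theta>)" by (intro mult_right_mono) (auto simp: C_def)
      finally show "D n * w n s \<le> C * s powr (-\<theta>)" .
    qed (rule op)
  qed
  then show ?thesis using \<nu>(1) \<eta>(1) by blast
qed

section \<open>The defect of a state and its a priori bound\<close>

text \<open>
  With $d_n = z_n - z_{n-1}$ this is $2^{-n}(1 - e^{-2^n d_n})$.
\<close>

definition defect :: "(int \<Rightarrow> real) \<Rightarrow> (int \<Rightarrow> real) \<Rightarrow> int \<Rightarrow> real" where
  "defect \<zeta> b n = 2 powr (- of_int n) * (1 - \<zeta> (n - 1) * (b (n - 1))\<^sup>2 / b n)"

lemma defect_eq: "b n \<noteq> 0 \<Longrightarrow> \<zeta> (n - 1) * (b (n - 1))\<^sup>2 - b n = - (2 powr (of_int n) * defect \<zeta> b n * b n)"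
proof -
  assume "b n \<noteq> 0"
  have "2 powr (of_int n) * (2::real) powr (- of_int n) = 1" by (simp add: powr_add[symmetric])
  then have "2 powr (of_int n) * defect \<zeta> b n = 1 - \<zeta> (n - 1) * (b (n - 1))\<^sup>2 / b n"
    by (simp add: defect_def mult.assoc[symmetric])
  then show ?thesis using \<open>b n \<noteq> 0\<close> by (simp add: field_simps)
qed

lemma defect_quotient: "\<zeta> (n - 1) * (b (n - 1))\<^sup>2 / b n = 1 - 2 powr (of_int n) * defect \<zeta> b n"
proof -
  have "2 powr (of_int n) * (2::real) powr (- of_int n) = 1" by (simp add: powr_add[symmetric])
  then show ?thesis by (simp add: defect_def mult.assoc[symmetric])
qed

text \<open>
  This is $2^{-n} b_n'/b_n$, that is, the time derivative of $z_n$.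
\<close>

definition log_rate :: "(int \<Rightarrow> real) \<Rightarrow> (int \<Rightarrow> real) \<Rightarrow> (int \<Rightarrow> real) \<Rightarrow> int \<Rightarrow> real" where
  "log_rate c \<zeta> b n = - c n * defect \<zeta> b n + 4 * c (n + 1) * (b (n + 1) / b n) * defect \<zeta> b (n + 1)"

lemma net_flux_log_rate:
  assumes "b n \<noteq> 0" "b (n + 1) \<noteq> 0"
  shows "net_flux c \<zeta> b n = 2 powr (of_int n) * log_rate c \<zeta> b n * b n"
proof -
  have e: "(2::real) powr (of_int (n + 1)) = 2 * 2 powr (of_int n)" by (simp add: powr_add)
  have 1: "\<zeta> (n - 1) * (b (n - 1))\<^sup>2 - b n = - (2 powr (of_int n) * defect \<zeta> b n * b n)"
    using assms(1) by (rule defect_eq)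
  have 2: "\<zeta> n * (b n)\<^sup>2 - b (n + 1) = - (2 * 2 powr (of_int n) * defect \<zeta> b (n + 1) * b (n + 1))"
    using defect_eq[of b "n + 1" \<zeta>] assms(2) unfolding e by simp
  show ?thesis
    unfolding net_flux_def log_rate_def 1 2 using assms(1) by (simp add: field_simps)
qed

lemma square_quotient_derivative:
  fixes X Y :: "real \<Rightarrow> real"
  assumes X: "(X has_real_derivative T / 2 * g1 * X t) (at t within S)"
    and Y: "(Y has_real_derivative T * g2 * Y t) (at t within S)" and nz: "Y t \<noteq> 0" "T \<noteq> 0"
  shows "((\<lambda>s. 1 / T * (1 - z * (X s)\<^sup>2 / Y s)) has_real_derivative z * (X t)\<^sup>2 / Y t * (g2 - g1)) (at t within S)"
proof -
  have "((\<lambda>s. 1 / T * (1 - z * (X s)\<^sup>2 / Y s)) has_real_derivative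
     1 / T * (0 - (z * (2 * (T / 2 * g1 * X t) * X t) * Y t - z * (X t)\<^sup>2 * (T * g2 * Y t)) / (Y t * Y t))) (at t within S)"
    by (rule derivative_eq_intros X Y refl nz | simp)+ (simp add: mult_ac)
  moreover have "1 / T * (0 - (z * (2 * (T / 2 * g1 * X t) * X t) * Y t - z * (X t)\<^sup>2 * (T * g2 * Y t)) / (Y t * Y t))
    = z * (X t)\<^sup>2 / Y t * (g2 - g1)"
    using nz by (simp add: field_simps power2_eq_square)
  ultimately show ?thesis by simp
qed

lemma defect_derivative:
  assumes pos: "\<And>m. 0 < b t m"
    and der: "\<And>m. ((\<lambda>s. b s m) has_real_derivative net_flux c \<zeta> (b t) m) (at t within S)"
  shows "((\<lambda>s. defect \<zeta> (b s) n) has_real_derivative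
     (1 - 2 powr (of_int n) * defect \<zeta> (b t) n) * chain_op c (\<lambda>m. b t (m + 1) / b t m) (defect \<zeta> (b t)) n) (at t within S)"
proof -
  define T where "T = (2::real) powr (of_int n)"
  have T: "T \<noteq> 0" "2 powr (- of_int n) = 1 / T" "2 powr (of_int (n - 1)) = T / 2"
    by (simp_all add: T_def powr_minus powr_diff field_simps)
  define q where "q = \<zeta> (n - 1) * (b t (n - 1))\<^sup>2 / b t n"
  have nz: "b t m \<noteq> 0" for m using pos[of m] by simp
  define G where "G = log_rate c \<zeta> (b t)"
  have d1: "((\<lambda>s. b s (n - 1)) has_real_derivative T / 2 * G (n - 1) * b t (n - 1)) (at t within S)"
    using der[of "n - 1"] net_flux_log_rate[of "b t" "n - 1" c \<zeta>] nz by (simp only: G_def T diff_add_cancel) simp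
  have d2: "((\<lambda>s. b s n) has_real_derivative T * G n * b t n) (at t within S)"
    using der[of n] net_flux_log_rate[of "b t" n c \<zeta>] nz by (simp add: G_def T_def)
  have "((\<lambda>s. 2 powr (- of_int n) * (1 - \<zeta> (n - 1) * (b s (n - 1))\<^sup>2 / b s n)) has_real_derivative q * (G n - G (n - 1))) (at t within S)"
    unfolding T(2) q_def by (rule square_quotient_derivative[OF d1 d2 nz T(1)])
  moreover have "q = 1 - 2 powr (of_int n) * defect \<zeta> (b t) n" unfolding q_def by (rule defect_quotient)
  moreover have "G n - G (n - 1) = chain_op c (\<lambda>m. b t (m + 1) / b t m) (defect \<zeta> (b t)) n"
    by (simp add: G_def log_rate_def chain_op_def algebra_simps)
  ultimately show ?thesis unfolding defect_def[abs_def] by simp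
qed

lemma abs_ln_le:
  fixes q e :: real assumes "\<bar>1 - q\<bar> \<le> e" "e \<le> 1/2"
  shows "\<bar>ln q\<bar> \<le> 2 * e"
proof -
  define x where "x = q - 1"
  have x: "\<bar>x\<bar> \<le> e" "\<bar>x\<bar> \<le> 1/2" "q = 1 + x" using assms by (simp_all add: x_def abs_minus_commute)
  have "\<bar>ln (1 + x) - x\<bar> \<le> 2 * x\<^sup>2" using x by (intro abs_ln_one_plus_x_minus_x_bound) auto
  moreover have "x\<^sup>2 \<le> \<bar>x\<bar> * (1/2)"
    using mult_left_mono[OF x(2), of "\<bar>x\<bar>"] by (simp add: power2_eq_square)
  ultimately show ?thesis using x by (simp add: abs_le_iff) linarith
qed

lemma abs_double_step:
  fixes x l q E Y :: real
  assumes "x = 2 * l - q" "\<bar>q\<bar> \<le> E"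
  shows "\<bar>l\<bar> \<le> Y \<Longrightarrow> \<bar>x\<bar> \<le> 2 * Y + E" and "\<bar>x\<bar> \<le> Y \<Longrightarrow> 2 * \<bar>l\<bar> \<le> Y + E"
  using assms by linarith+

text \<open>
  The logarithms $L_n = \ln (b_n/a_n)$ satisfy $L_n = 2 L_{n-1} - \ln q_n$.  Upwards errors double at each step,
  which the factor $2^n$ records; downwards they are halved, so the bound stays constant.
\<close>

lemma log_distance_bound:
  fixes a b \<zeta> :: "int \<Rightarrow> real" and N :: int
  assumes a: "\<And>n. 0 < a n" and rec: "\<And>n. a (n + 1) = \<zeta> n * (a n)\<^sup>2" and \<zeta>: "\<And>n. 0 < \<zeta> n"
    and b: "\<And>n. 0 < b n" and e: "e \<le> 1/2" and N: "0 < N"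
    and q: "\<And>n. - N < n \<Longrightarrow> n \<le> N \<Longrightarrow> \<bar>1 - \<zeta> (n - 1) * (b (n - 1))\<^sup>2 / b n\<bar> \<le> e"
    and Z: "\<bar>ln (b 0 / a 0)\<bar> \<le> Z"
  shows "\<And>n. - N \<le> n \<Longrightarrow> n \<le> N \<Longrightarrow> \<bar>ln (b n / a n)\<bar> \<le> (Z + 2 * e) * max 1 (2 powr (of_int n))"
    and "\<And>n. - N \<le> n \<Longrightarrow> n < N \<Longrightarrow> \<bar>ln ((b (n + 1) / b n) / (a (n + 1) / a n))\<bar> \<le> (Z + 4 * e) * max 1 (2 powr (of_int n))"
proof -
  define L where "L = (\<lambda>n. ln (b n / a n))"
  define Q where "Q = (\<lambda>n. ln (\<zeta> (n - 1) * (b (n - 1))\<^sup>2 / b n))"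
  have LQ: "L n = 2 * L (n - 1) - Q n" for n
  proof -
    have "a n = \<zeta> (n - 1) * (a (n - 1))\<^sup>2" using rec[of "n - 1"] by simp
    then show ?thesis using a[of n] a[of "n-1"] b[of n] b[of "n-1"] \<zeta>[of "n-1"]
      by (simp add: L_def Q_def ln_mult ln_div ln_realpow)
  qed
  have Qb: "\<bar>Q n\<bar> \<le> 2 * e" if "- N < n" "n \<le> N" for n
    unfolding Q_def using q[OF that] e by (rule abs_ln_le)
  have Z0: "0 \<le> Z" using Z by linarith
  have e0: "0 \<le> e" using q[of N] N by (meson abs_ge_zero neg_less_0_iff_less order_less_trans order_refl order_trans)
  have up: "int m \<le> N \<longrightarrow> \<bar>L (int m)\<bar> \<le> 2 ^ m * (Z + 2 * e) - 2 * e" for m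
  proof (induction m)
    case 0 then show ?case using Z by (simp add: L_def)
  next
    case (Suc m)
    show ?case
    proof
      assume le: "int (Suc m) \<le> N"
      have "L (int (Suc m)) = 2 * L (int m) - Q (int (Suc m))" using LQ[of "int (Suc m)"] by simp
      moreover have "\<bar>Q (int (Suc m))\<bar> \<le> 2 * e" using Qb le by simp
      moreover have "\<bar>L (int m)\<bar> \<le> 2 ^ m * (Z + 2 * e) - 2 * e" using Suc le by simp
      ultimately have "\<bar>L (int (Suc m))\<bar> \<le> 2 * (2 ^ m * (Z + 2 * e) - 2 * e) + 2 * e"
        by (rule abs_double_step(1))
      then show "\<bar>L (int (Suc m))\<bar> \<le> 2 ^ Suc m * (Z + 2 * e) - 2 * e" by (simp add: algebra_simps)
    qed
  qed
  have down: "int m \<le> N \<longrightarrow> \<bar>L (- int m)\<bar> \<le> Z + 2 * e" for m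
  proof (induction m)
    case 0 then show ?case using Z e0 by (simp add: L_def)
  next
    case (Suc m)
    show ?case
    proof
      assume le: "int (Suc m) \<le> N"
      have "- int (Suc m) = - int m - 1" by simp
      then have "L (- int m) = 2 * L (- int (Suc m)) - Q (- int m)" using LQ[of "- int m"] by (simp only:)
      moreover have "\<bar>Q (- int m)\<bar> \<le> 2 * e" using Qb[of "- int m"] le by simp
      moreover have "\<bar>L (- int m)\<bar> \<le> Z + 2 * e" using Suc le by simp
      ultimately have "2 * \<bar>L (- int (Suc m))\<bar> \<le> Z + 2 * e + 2 * e" by (rule abs_double_step(2))
      then show "\<bar>L (- int (Suc m))\<bar> \<le> Z + 2 * e" using Z0 by simp
    qed
  qed
  have Lb: "\<bar>L n\<bar> \<le> (Z + 2 * e) * max 1 (2 powr (of_int n))" if n: "- N \<le> n" "n \<le> N" for n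
  proof (cases "0 \<le> n")
    case True
    have p: "(2::real) ^ nat n = 2 powr (of_int n)" using True by (simp add: powr_realpow[symmetric])
    have "\<bar>L n\<bar> \<le> 2 ^ nat n * (Z + 2 * e) - 2 * e" using up[of "nat n"] True n by simp
    also have "\<dots> \<le> (Z + 2 * e) * 2 powr (of_int n)" using e0 by (simp add: p mult.commute)
    also have "\<dots> \<le> (Z + 2 * e) * max 1 (2 powr (of_int n))" using Z0 e0 by (intro mult_left_mono) auto
    finally show ?thesis .
  next
    case False
    have "\<bar>L n\<bar> \<le> (Z + 2 * e) * 1" using down[of "nat (-n)"] False n by simp
    also have "\<dots> \<le> (Z + 2 * e) * max 1 (2 powr (of_int n))" using Z0 e0 by (intro mult_left_mono) auto
    finally show ?thesis .
  qed
  show "\<bar>ln (b n / a n)\<bar> \<le> (Z + 2 * e) * max 1 (2 powr (of_int n))" if "- N \<le> n" "n \<le> N" for n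
    using Lb[OF that] by (simp add: L_def)
  { fix n assume n: "- N \<le> n" "n < N"
    have "ln ((b (n + 1) / b n) / (a (n + 1) / a n)) = L (n + 1) - L n"
      using a[of n] a[of "n+1"] b[of n] b[of "n+1"] by (simp add: L_def ln_mult ln_div)
    also have "\<dots> = L n - Q (n + 1)" using LQ[of "n + 1"] by simp
    finally have "\<bar>ln ((b (n + 1) / b n) / (a (n + 1) / a n))\<bar> \<le> \<bar>L n\<bar> + 2 * e"
      using Qb[of "n+1"] n by auto
    also have "\<dots> \<le> (Z + 2 * e) * max 1 (2 powr (of_int n)) + 2 * e * max 1 (2 powr (of_int n))"
      using Lb[of n] n mult_left_mono[of 1 "max 1 (2 powr (of_int n))" "2 * e"] e0 by simp
    finally show "\<bar>ln ((b (n + 1) / b n) / (a (n + 1) / a n))\<bar> \<le> (Z + 4 * e) * max 1 (2 powr (of_int n))"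
      by (simp add: algebra_simps) }
qed

lemma exp_bounds_small:
  fixes x e :: real assumes "\<bar>x\<bar> \<le> e" "e \<le> 1" shows "\<bar>exp x - 1\<bar> \<le> 2 * e"
proof -
  have "exp x \<le> 1 + \<bar>x\<bar> + \<bar>x\<bar>\<^sup>2" if "0 \<le> x" using exp_bound[of x] that assms by simp
  moreover have "\<bar>x\<bar>\<^sup>2 \<le> \<bar>x\<bar> * 1" unfolding power2_eq_square using assms by (intro mult_left_mono) auto
  moreover have "1 + x \<le> exp x" by (rule exp_ge_add_one_self)
  moreover have "exp x \<le> 1" if "x \<le> 0" using that by simp
  ultimately show ?thesis using assms by (cases "0 \<le> x") linarith+
qed

lemma at_within_atLeast_pos: "0 < (t::real) \<Longrightarrow> at t within {0..} = at t"
  by (rule at_within_interior) simp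

text \<open>
  The stationary state \<open>a\<close> together with weights as in \<open>supersolution_weights\<close>, written out so that each property can
  be cited.  The tail condition keeps the ratios admissible for all states with
  $|\ln (b_n/a_n)|$ of order at most $\kappa 2^n$.
\<close>

locale damped_network =
  fixes D \<zeta> a :: "int \<Rightarrow> real" and w w' :: "int \<Rightarrow> real \<Rightarrow> real"
    and \<beta> \<nu> \<eta> \<kappa> c C :: real and N1 :: int
  assumes beta: "1 < \<beta>" "\<beta> < 2" and nu: "0 < \<nu>" and eta: "0 < \<eta>" and kap: "0 < \<kappa>"
    and c_pos: "0 < c" and C_pos: "0 < C" and N1: "0 \<le> N1"
    and D_pos: "\<And>n. 0 < D n" and zeta_pos: "\<And>n. 0 < \<zeta> n" and a_pos: "\<And>n. 0 < a n"
    and a_rec: "\<And>n. a (n + 1) = \<zeta> n * (a n)\<^sup>2"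
    and tail: "\<And>n. N1 \<le> n \<Longrightarrow> a (n + 1) / a n * exp (\<kappa> * 2 powr (of_int n)) \<le> (\<beta> - 1) / \<beta> / 2048 * 2 powr (- \<beta> * of_int n)"
    and w_pos: "\<And>n s. 0 \<le> s \<Longrightarrow> 0 < w n s" and w'_neg: "\<And>n s. 0 \<le> s \<Longrightarrow> w' n s \<le> 0"
    and w_deriv: "\<And>n s. 0 \<le> s \<Longrightarrow> (w n has_real_derivative w' n s) (at s)"
    and w_super: "\<And>n s q. 0 \<le> s \<Longrightarrow> s \<le> 1 \<Longrightarrow> admissible_ratios \<beta> \<eta> N1 (\<lambda>n. a (n + 1) / a n) q \<Longrightarrow>
        chain_op D q (\<lambda>m. w m s) n < - (2 * (\<nu> * w n s - w' n s))"
    and w_lower: "\<And>n. c * 2 powr (- of_int n) \<le> w n 0"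
    and w_upper: "\<And>n s. 0 \<le> s \<Longrightarrow> w n s \<le> C * 2 powr (- of_int n)"
    and w_smooth: "\<And>n s. 0 \<le> n \<Longrightarrow> 0 < s \<Longrightarrow> w n s \<le> C * s powr (- ((\<beta> - 1) / \<beta>)) * 2 powr (- \<beta> * of_int n)"
    and Dw_smooth: "\<And>n s. N1 \<le> n \<Longrightarrow> 0 < s \<Longrightarrow> D n * w n s \<le> C * s powr (- ((\<beta> - 1) / \<beta>))"
begin

abbreviation r :: "int \<Rightarrow> real" where "r n \<equiv> a (n + 1) / a n"

text \<open>
  Chosen so that $\mu Z_1 (2 - e^{-\nu t})$ grows faster than $|(\ln b_0)'|$ can, which makes it a
  barrier for $|\ln (b_0/a_0)|$: the defect alone does not control the level of the state.
\<close>

definition Z1 :: real where "Z1 = (D 0 * C + 4 * D 1 * (3 * r 0) * C + 1) / \<nu>"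
definition K :: real where "K = 2 * Z1 + 4 * C"

definition small_amplitude :: "real \<Rightarrow> bool" where
  "small_amplitude \<mu> \<longleftrightarrow> 0 < \<mu> \<and> \<mu> * C \<le> 1/10 \<and> \<mu> * K \<le> \<kappa> \<and> \<mu> * K * 2 powr (of_int N1) \<le> 1 \<and> 2 * (\<mu> * K * 2 powr (of_int N1)) \<le> \<eta>"

text \<open>
  The time change $s = 1 - e^{-t}$ is smooth, comparable to $\min(1,t)$, and satisfies $0 < s' \le 1$.
\<close>

definition barrier :: "real \<Rightarrow> int \<Rightarrow> real \<Rightarrow> real" where
  "barrier \<mu> n t = \<mu> * exp (- \<nu> * t) * w n (1 - exp (- t))"

lemma Z1_pos: "0 < Z1"
  using D_pos[of 0] D_pos[of 1] C_pos a_pos[of 0] a_pos[of 1] nu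
  by (simp add: Z1_def add_pos_pos)

lemma K_pos: "0 < K" using Z1_pos C_pos by (simp add: K_def)

lemma barrier_pos: "0 < \<mu> \<Longrightarrow> 0 \<le> t \<Longrightarrow> 0 < barrier \<mu> n t"
  by (simp add: barrier_def w_pos)

lemma barrier_upper:
  assumes "0 < \<mu>" "0 \<le> t" shows "barrier \<mu> n t \<le> \<mu> * exp (- \<nu> * t) * (C * 2 powr (- of_int n))"
  unfolding barrier_def using assms by (intro mult_left_mono w_upper) auto

lemma barrier_upper':
  assumes "0 < \<mu>" "0 \<le> t" shows "2 powr (of_int n) * barrier \<mu> n t \<le> \<mu> * C"
proof -
  have "exp (- \<nu> * t) \<le> 1" using nu assms by simp
  then have "\<mu> * exp (- \<nu> * t) * (C * 2 powr (- of_int n)) \<le> \<mu> * 1 * (C * 2 powr (- of_int n))"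
    using assms C_pos by (intro mult_right_mono mult_left_mono) auto
  then have "barrier \<mu> n t \<le> \<mu> * C * 2 powr (- of_int n)" using barrier_upper[OF assms, of n] by simp
  then have "2 powr (of_int n) * barrier \<mu> n t \<le> 2 powr (of_int n) * (\<mu> * C * 2 powr (- of_int n))"
    by (intro mult_left_mono) auto
  also have "\<dots> = \<mu> * C * (2 powr (of_int n) * 2 powr (- of_int n))" by simp
  also have "\<dots> = \<mu> * C" by (simp only: powr_add[symmetric]) simp
  finally show ?thesis .
qed

lemma barrier_derivative:
  assumes "0 \<le> t"
  shows "(barrier \<mu> n has_real_derivative \<mu> * exp (- \<nu> * t) * (exp (- t) * w' n (1 - exp (- t)) - \<nu> * w n (1 - exp (- t)))) (at t)"
proof -
  have "((\<lambda>t. w n (1 - exp (- t))) has_real_derivative w' n (1 - exp (- t)) * exp (- t)) (at t)"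
  proof (rule DERIV_chain2[where f = "w n"])
    show "(w n has_real_derivative w' n (1 - exp (- t))) (at (1 - exp (- t)))" using assms by (intro w_deriv) auto
    show "((\<lambda>t. 1 - exp (- t)) has_real_derivative exp (- t)) (at t)" by (auto intro!: derivative_eq_intros)
  qed
  then show ?thesis
    unfolding barrier_def[abs_def] by (auto intro!: derivative_eq_intros simp: algebra_simps)
qed

text \<open>
  Below \<open>N1\<close> the logarithmic distance is small outright; from \<open>N1\<close> on it is dominated by the margin in
  the tail condition.
\<close>

lemma ratio_close:
  assumes sm: "small_amplitude \<mu>" and x: "0 < x"
    and ln: "\<bar>ln (x / r n)\<bar> \<le> \<mu> * K * max 1 (2 powr (of_int n))"
  shows "n < N1 \<Longrightarrow> \<bar>x - r n\<bar> \<le> \<eta> * r n"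
    and "N1 \<le> n \<Longrightarrow> x \<le> (\<beta> - 1) / \<beta> / 2048 * 2 powr (- \<beta> * of_int n)"
    and "n = 0 \<Longrightarrow> x \<le> 3 * r n"
proof -
  have rp: "0 < r n" using a_pos by simp
  have xr: "x = r n * exp (ln (x / r n))" using x rp a_pos[of n] a_pos[of "n+1"] by simp
  have mK: "0 < \<mu> * K" using sm K_pos by (simp add: small_amplitude_def)
  have P: "1 \<le> (2::real) powr (of_int N1)" using N1 by (intro ge_one_powr_ge_zero) auto
  have close: "\<bar>exp (ln (x / r n)) - 1\<bar> \<le> 2 * (\<mu> * K * 2 powr (of_int N1))" if "n \<le> N1"
  proof (rule exp_bounds_small)
    have "max 1 (2 powr (of_int n)) \<le> (2::real) powr (of_int N1)"
      using that P by (auto intro!: powr_mono)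
    then show "\<bar>ln (x / r n)\<bar> \<le> \<mu> * K * 2 powr (of_int N1)"
      using ln mult_left_mono[of "max 1 (2 powr (of_int n))" "2 powr (of_int N1)" "\<mu> * K"] mK by linarith
    show "\<mu> * K * 2 powr (of_int N1) \<le> 1" using sm by (simp add: small_amplitude_def)
  qed
  have diff: "\<bar>x - r n\<bar> = r n * \<bar>exp (ln (x / r n)) - 1\<bar>"
  proof -
    have "x - r n = r n * (exp (ln (x / r n)) - 1)" using xr by (simp add: algebra_simps)
    then show ?thesis using rp by (metis abs_mult abs_of_pos)
  qed
  show "\<bar>x - r n\<bar> \<le> \<eta> * r n" if "n < N1"
  proof -
    have "\<bar>exp (ln (x / r n)) - 1\<bar> \<le> \<eta>" using close that sm by (auto simp: small_amplitude_def)
    then have "r n * \<bar>exp (ln (x / r n)) - 1\<bar> \<le> r n * \<eta>" using rp by (intro mult_left_mono) auto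
    then show ?thesis using diff by (simp add: mult.commute)
  qed
  show "x \<le> 3 * r n" if "n = 0"
  proof -
    have "\<bar>exp (ln (x / r n)) - 1\<bar> \<le> 2" using close that N1 sm by (auto simp: small_amplitude_def)
    then have "r n * exp (ln (x / r n)) \<le> r n * 3" using rp by (intro mult_left_mono) auto
    then show ?thesis using xr by (simp add: mult.commute)
  qed
  show "x \<le> (\<beta> - 1) / \<beta> / 2048 * 2 powr (- \<beta> * of_int n)" if "N1 \<le> n"
  proof -
    have p: "1 \<le> (2::real) powr (of_int n)" using N1 that by (intro ge_one_powr_ge_zero) auto
    have "ln (x / r n) \<le> \<mu> * K * 2 powr (of_int n)" using ln p by (simp add: max_def split: if_splits)
    also have "\<dots> \<le> \<kappa> * 2 powr (of_int n)" using sm by (intro mult_right_mono) (auto simp: small_amplitude_def)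
    finally have "r n * exp (ln (x / r n)) \<le> r n * exp (\<kappa> * 2 powr (of_int n))"
      using rp by (intro mult_left_mono) auto
    also have "\<dots> \<le> (\<beta> - 1) / \<beta> / 2048 * 2 powr (- \<beta> * of_int n)" by (rule tail[OF that])
    finally show ?thesis using xr by simp
  qed
qed


definition truncation :: "int \<Rightarrow> int \<Rightarrow> real" where
  "truncation N n = (if - N < n \<and> n \<le> N then D n else 0)"

lemma ratios_admissible:
  assumes sm: "small_amplitude \<mu>" and b: "\<And>n. 0 < b n"
    and ln: "\<And>n. - N \<le> n \<Longrightarrow> n < N \<Longrightarrow> \<bar>ln ((b (n + 1) / b n) / r n)\<bar> \<le> \<mu> * K * max 1 (2 powr (of_int n))"
  shows "admissible_ratios \<beta> \<eta> N1 r (\<lambda>n. if - N \<le> n \<and> n < N then b (n + 1) / b n else if n < N1 then r n else 0)"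
proof -
  have q: "0 < b (n + 1) / b n" for n using b by simp
  show ?thesis
    unfolding admissible_ratios_def
    using ratio_close(1)[OF sm q ln] ratio_close(2)[OF sm q ln] q eta a_pos beta
    by (auto intro: less_imp_le)
qed

text \<open>
  Both ends of the truncation help: the missing neighbours would contribute nonnegative terms
  to the bracket of the barrier.
\<close>

lemma chain_op_touching:
  assumes sm: "0 < \<mu>" and t: "0 \<le> t" and n: "- N < n" "n \<le> N" and b: "\<And>n. 0 < b n"
    and adm: "admissible_ratios \<beta> \<eta> N1 r (\<lambda>n. if - N \<le> n \<and> n < N then b (n + 1) / b n else if n < N1 then r n else 0)"
    and p: "\<And>m. - N < m \<Longrightarrow> m \<le> N \<Longrightarrow> \<bar>p m\<bar> \<le> barrier \<mu> m t" and pn: "\<bar>p n\<bar> = barrier \<mu> n t"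
  shows "sgn (p n) * chain_op (truncation N) (\<lambda>m. b (m + 1) / b m) p n
     < - (2 * (\<mu> * exp (- \<nu> * t) * (\<nu> * w n (1 - exp (- t)) - w' n (1 - exp (- t)))))"
proof -
  define q where "q = (\<lambda>n. if - N \<le> n \<and> n < N then b (n + 1) / b n else if n < N1 then r n else 0)"
  define y where "y = (\<lambda>m. barrier \<mu> m t)"
  define \<sigma> where "\<sigma> = sgn (p n)"
  have y0: "0 < y m" for m using barrier_pos[OF sm t] by (simp add: y_def)
  have q0: "0 \<le> q m" for m using b[of m] b[of "m+1"] a_pos[of m] a_pos[of "m+1"] by (simp add: q_def)
  have sp: "\<sigma> * p m \<le> \<bar>p m\<bar>" for m
    by (cases "p n" "0::real" rule: linorder_cases) (auto simp: \<sigma>_def)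
  have 1: "truncation N (n - 1) * (\<sigma> * p (n - 1)) \<le> D (n - 1) * y (n - 1)"
  proof (cases "- N < n - 1")
    case True
    then have "\<sigma> * p (n - 1) \<le> y (n - 1)" using p[of "n - 1"] sp[of "n - 1"] n by (simp add: y_def)
    then show ?thesis using True n D_pos[of "n-1"] by (simp add: truncation_def)
  next
    case False
    then show ?thesis using D_pos[of "n-1"] y0[of "n-1"] by (simp add: truncation_def)
  qed
  have 2: "4 * truncation N (n + 1) * (b (n + 1) / b n) * (\<sigma> * p (n + 1)) \<le> 4 * D (n + 1) * q n * y (n + 1)"
  proof (cases "n < N")
    case True
    then have "\<sigma> * p (n + 1) \<le> y (n + 1)" using p[of "n + 1"] sp[of "n + 1"] n by (simp add: y_def)
    then have "(4 * D (n + 1) * q n) * (\<sigma> * p (n + 1)) \<le> (4 * D (n + 1) * q n) * y (n + 1)"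
      using D_pos[of "n+1"] q0[of n] by (intro mult_left_mono) auto
    then show ?thesis using True n by (simp add: truncation_def q_def)
  next
    case False
    then show ?thesis using D_pos[of "n+1"] y0[of "n+1"] q0[of n] n by (simp add: truncation_def)
  qed
  have 3: "\<sigma> * p n = y n" using pn y0[of n] by (simp add: \<sigma>_def y_def sgn_mult_self_eq abs_sgn mult.commute)
  have tn: "truncation N n = D n" and qn: "q (n - 1) = b n / b (n - 1)" using n by (auto simp: truncation_def q_def)
  have "\<sigma> * chain_op (truncation N) (\<lambda>m. b (m + 1) / b m) p n
     = truncation N (n - 1) * (\<sigma> * p (n - 1)) + 4 * truncation N (n + 1) * (b (n + 1) / b n) * (\<sigma> * p (n + 1))
       - (D n + 4 * D n * q (n - 1)) * (\<sigma> * p n)"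
    by (simp add: chain_op_def tn qn algebra_simps)
  also have "\<dots> \<le> chain_op D q y n" unfolding 3 chain_op_def using 1 2 by linarith
  also have "\<dots> = \<mu> * exp (- \<nu> * t) * chain_op D q (\<lambda>m. w m (1 - exp (- t))) n"
    by (simp add: chain_op_def y_def barrier_def algebra_simps)
  also have "\<dots> < \<mu> * exp (- \<nu> * t) * (- (2 * (\<nu> * w n (1 - exp (- t)) - w' n (1 - exp (- t)))))"
    using adm sm t by (intro mult_strict_left_mono w_super) (auto simp: q_def)
  finally show ?thesis by (simp add: \<sigma>_def algebra_simps)
qed

text \<open>
  The barriers for the defects and the barrier for $\ln (b_0/a_0)$ are run simultaneously: the second keeps
  the ratios admissible, which the first needs, and the first bounds the derivative of $\ln b_0$.
\<close>

lemma truncated_a_priori: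
  fixes N :: int
  assumes N: "1 \<le> N" and sm: "small_amplitude \<mu>"
    and pos: "\<And>t n. 0 \<le> t \<Longrightarrow> 0 < b t n"
    and der: "\<And>n t. 0 \<le> t \<Longrightarrow> ((\<lambda>s. b s n) has_real_derivative net_flux (truncation N) \<zeta> (b t) n) (at t within {0..})"
    and init1: "\<And>n. \<bar>1 - \<zeta> (n - 1) * (b 0 (n - 1))\<^sup>2 / b 0 n\<bar> < \<mu> * c"
    and init2: "\<bar>ln (b 0 0 / a 0)\<bar> < \<mu> * Z1"
  shows "\<And>t n. 0 \<le> t \<Longrightarrow> - N < n \<Longrightarrow> n \<le> N \<Longrightarrow> \<bar>defect \<zeta> (b t) n\<bar> \<le> barrier \<mu> n t"
    and "\<And>t. 0 \<le> t \<Longrightarrow> \<bar>ln (b t 0 / a 0)\<bar> \<le> 2 * \<mu> * Z1"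
proof -
  have mu: "0 < \<mu>" "\<mu> * C \<le> 1/10" using sm by (auto simp: small_amplitude_def)
  define I where "I = insert None (Some ` {- N<..N})"
  define ratio where "ratio = (\<lambda>t m. b t (m + 1) / b t m)"
  define x where "x = (\<lambda>i t. case i of None \<Rightarrow> ln (b t 0 / a 0) | Some n \<Rightarrow> defect \<zeta> (b t) n)"
  \<comment> \<open>The index \<open>None\<close> stands for $\ln (b_0/a_0)$, the index \<open>Some n\<close> for the defect at \<open>n\<close>.\<close>
  define x' where "x' = (\<lambda>i t. case i of None \<Rightarrow> log_rate (truncation N) \<zeta> (b t) 0
     | Some n \<Rightarrow> (1 - 2 powr (of_int n) * defect \<zeta> (b t) n) * chain_op (truncation N) (ratio t) (defect \<zeta> (b t)) n)"
  define y where "y = (\<lambda>i t. case i of None \<Rightarrow> \<mu> * Z1 * (2 - exp (- \<nu> * t)) | Some n \<Rightarrow> barrier \<mu> n t)"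
  define y' where "y' = (\<lambda>i t. case i of None \<Rightarrow> \<mu> * Z1 * \<nu> * exp (- \<nu> * t)
     | Some n \<Rightarrow> \<mu> * exp (- \<nu> * t) * (exp (- t) * w' n (1 - exp (- t)) - \<nu> * w n (1 - exp (- t))))"
  have dx: "(x i has_real_derivative x' i t) (at t within {0..})" if t: "0 \<le> t" for i t
  proof (cases i)
    case None
    have nz: "b t 0 \<noteq> 0" "b t (0 + 1) \<noteq> 0" using pos[OF t] by (metis less_irrefl)+
    have "((\<lambda>s. b s 0) has_real_derivative log_rate (truncation N) \<zeta> (b t) 0 * b t 0) (at t within {0..})"
      using der[OF t, of 0] net_flux_log_rate[of "b t" 0, OF nz] by simp
    then have "((\<lambda>s. ln (b s 0 / a 0)) has_real_derivative log_rate (truncation N) \<zeta> (b t) 0) (at t within {0..})"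
      using pos[OF t, of 0] a_pos[of 0] by (auto intro!: derivative_eq_intros)
    then show ?thesis by (simp add: x_def[abs_def] x'_def None)
  next
    case (Some n)
    show ?thesis using defect_derivative[of b t "truncation N" \<zeta> "{0..}" n, OF pos der] t
      by (simp add: x_def[abs_def] x'_def Some ratio_def)
  qed
  have dy: "(y i has_real_derivative y' i t) (at t)" if t: "0 \<le> t" for i t
  proof (cases i)
    case None
    have "((\<lambda>t. \<mu> * Z1 * (2 - exp (- \<nu> * t))) has_real_derivative \<mu> * Z1 * \<nu> * exp (- \<nu> * t)) (at t)"
      by (auto intro!: derivative_eq_intros)
    then show ?thesis by (simp add: y_def[abs_def] y'_def None)
  next
    case (Some n)
    then show ?thesis using barrier_derivative[OF t, of \<mu> n] by (simp add: y_def[abs_def] y'_def)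
  qed
  have strict: "\<bar>x i t\<bar> < y i t" if "i \<in> I" "0 \<le> t" for i t
  proof (rule first_touching[where I = I and x = x and x' = x' and y = y and y' = y'])
    show "finite I" by (simp add: I_def)
    show "continuous_on {0..} (x i)" for i by (rule DERIV_continuous_on[OF dx]) auto
    show "continuous_on {0..} (y i)" for i
      by (rule DERIV_continuous_on[of _ _ "y' i"]) (auto intro!: has_field_derivative_at_within[OF dy])
    show "(x i has_real_derivative x' i t) (at t)" if "0 < t" for i t
      using dx[of t i] that by (simp add: at_within_atLeast_pos)
    show "(y i has_real_derivative y' i t) (at t)" if "0 < t" for i t using dy that by simp
    show "0 < y i t" if "0 \<le> t" for i t
    proof (cases i)
      case None
      have "exp (- \<nu> * t) \<le> 1" using nu that by simp
      then have "0 < 2 - exp (- \<nu> * t)" by linarith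
      then show ?thesis using None Z1_pos mu by (simp add: y_def)
    next
      case (Some n) then show ?thesis using barrier_pos mu that by (simp add: y_def)
    qed
    show "\<bar>x i 0\<bar> < y i 0" for i
    proof (cases i)
      case None then show ?thesis using init2 by (simp add: x_def y_def)
    next
      case (Some n)
      have "\<bar>defect \<zeta> (b 0) n\<bar> = 2 powr (- of_int n) * \<bar>1 - \<zeta> (n - 1) * (b 0 (n - 1))\<^sup>2 / b 0 n\<bar>"
        by (simp add: defect_def abs_mult)
      also have "\<dots> < 2 powr (- of_int n) * (\<mu> * c)" using init1 by (intro mult_strict_left_mono) auto
      also have "\<dots> \<le> \<mu> * w n 0" using w_lower[of n] mu by (simp add: mult.commute mult.left_commute)
      finally show ?thesis by (simp add: x_def y_def Some barrier_def)
    qed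
    show "sgn (x i t) * x' i t < y' i t"
      if i: "i \<in> I" and t: "0 < t" and le: "\<forall>j\<in>I. \<bar>x j t\<bar> \<le> y j t" and eq: "\<bar>x i t\<bar> = y i t" for i t
    proof -
      have t0: "0 \<le> t" using t by simp
      have bp: "0 < b t m" for m using pos t0 by blast
      have p: "\<bar>defect \<zeta> (b t) m\<bar> \<le> barrier \<mu> m t" if "- N < m" "m \<le> N" for m
        using le that by (auto simp: I_def x_def y_def)
      have q: "\<bar>1 - \<zeta> (m - 1) * (b t (m - 1))\<^sup>2 / b t m\<bar> \<le> \<mu> * C" if "- N < m" "m \<le> N" for m
      proof -
        have "\<bar>1 - \<zeta> (m - 1) * (b t (m - 1))\<^sup>2 / b t m\<bar> = 2 powr (of_int m) * \<bar>defect \<zeta> (b t) m\<bar>"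
          unfolding defect_quotient by (simp add: abs_mult)
        also have "\<dots> \<le> 2 powr (of_int m) * barrier \<mu> m t" using p[OF that] by (intro mult_left_mono) auto
        also have "\<dots> \<le> \<mu> * C" by (rule barrier_upper'[OF mu(1) t0])
        finally show ?thesis .
      qed
      have "\<bar>ln (b t 0 / a 0)\<bar> \<le> \<mu> * Z1 * (2 - exp (- \<nu> * t))" using le by (auto simp: I_def x_def y_def)
      also have "\<dots> \<le> \<mu> * Z1 * 2" using mu Z1_pos by (intro mult_left_mono) auto
      finally have Z: "\<bar>ln (b t 0 / a 0)\<bar> \<le> 2 * \<mu> * Z1" by simp
      have C2: "\<mu> * C \<le> 1/2" and N0: "0 < N" using mu N by auto
      have lnr: "\<bar>ln ((b t (m + 1) / b t m) / r m)\<bar> \<le> \<mu> * K * max 1 (2 powr (of_int m))" if "- N \<le> m" "m < N" for m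
      proof -
        have e: "\<mu> * K = 2 * \<mu> * Z1 + 4 * (\<mu> * C)" by (simp add: K_def algebra_simps)
        show ?thesis unfolding e
          using log_distance_bound(2)[of a \<zeta> "b t" "\<mu> * C" N "2 * \<mu> * Z1" m, OF a_pos a_rec zeta_pos bp C2 N0 q Z] that by simp
      qed
      note adm = ratios_admissible[of \<mu> "b t" N, OF sm bp lnr]
      show ?thesis
      proof (cases i)
        case (Some n)
        have n: "- N < n" "n \<le> N" using i Some by (auto simp: I_def)
        define X where "X = \<mu> * exp (- \<nu> * t) * (\<nu> * w n (1 - exp (- t)) - w' n (1 - exp (- t)))"
        have ws: "0 < w n (1 - exp (- t))" "w' n (1 - exp (- t)) \<le> 0" using w_pos w'_neg t0 by auto
        have "0 < \<nu> * w n (1 - exp (- t))" using nu ws by simp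
        then have X0: "0 < X" unfolding X_def using mu ws by (intro mult_pos_pos) auto
        have s: "sgn (defect \<zeta> (b t) n) * chain_op (truncation N) (ratio t) (defect \<zeta> (b t)) n < - (2 * X)"
          unfolding X_def ratio_def
          by (rule chain_op_touching[OF mu(1) t0 n bp adm p]) (use eq Some in \<open>auto simp: x_def y_def\<close>)
        have qn: "1/2 \<le> 1 - 2 powr (of_int n) * defect \<zeta> (b t) n"
          using q[OF n] C2 unfolding defect_quotient by linarith
        have "(1 - 2 powr (of_int n) * defect \<zeta> (b t) n) * (sgn (defect \<zeta> (b t) n) * chain_op (truncation N) (ratio t) (defect \<zeta> (b t)) n)
           < (1 - 2 powr (of_int n) * defect \<zeta> (b t) n) * (- (2 * X))"
          using s qn by (intro mult_strict_left_mono) auto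
        also have "\<dots> \<le> 1/2 * (- (2 * X))" using qn X0 by (intro mult_right_mono_neg) auto
        also have "\<dots> = \<mu> * exp (- \<nu> * t) * (w' n (1 - exp (- t)) - \<nu> * w n (1 - exp (- t)))"
          by (simp add: X_def algebra_simps)
        also have "\<dots> \<le> y' i t"
        proof -
          have "1 * w' n (1 - exp (- t)) \<le> exp (- t) * w' n (1 - exp (- t))"
            using ws t0 by (intro mult_right_mono_neg) auto
          then show ?thesis unfolding y'_def Some using mu by (simp add: mult_left_mono)
        qed
        finally show ?thesis by (simp add: x_def x'_def Some mult_ac)
      next
        case None
        define E where "E = \<mu> * exp (- \<nu> * t)"
        have E: "0 < E" using mu by (simp add: E_def)
        have p0: "\<bar>defect \<zeta> (b t) 0\<bar> \<le> E * C"
          using p[of 0] barrier_upper[OF mu(1) t0, of 0] N by (simp add: E_def)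
        have p1: "\<bar>defect \<zeta> (b t) 1\<bar> \<le> E * C"
        proof -
          have "E * (C * (2 powr - 1)) \<le> E * (C * 1)" using E C_pos by (intro mult_left_mono) (auto simp: powr_minus)
          then show ?thesis using p[of 1] barrier_upper[OF mu(1) t0, of 1] N by (simp add: E_def)
        qed
        have rb: "b t 1 / b t 0 \<le> 3 * r 0"
          using ratio_close(3)[OF sm _ lnr, of 0] bp[of 0] bp[of 1] N by simp
        have tr: "truncation N 0 = D 0" "truncation N 1 = D 1" using N by (auto simp: truncation_def)
        have "x' i t = - (D 0 * defect \<zeta> (b t) 0) + 4 * D 1 * (b t 1 / b t 0) * defect \<zeta> (b t) 1"
          by (simp add: x'_def None log_rate_def tr)
        then have "\<bar>x' i t\<bar> \<le> \<bar>D 0 * defect \<zeta> (b t) 0\<bar> + \<bar>4 * D 1 * (b t 1 / b t 0) * defect \<zeta> (b t) 1\<bar>"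
          by linarith
        also have "\<dots> = D 0 * \<bar>defect \<zeta> (b t) 0\<bar> + 4 * D 1 * (b t 1 / b t 0) * \<bar>defect \<zeta> (b t) 1\<bar>"
          using D_pos[of 0] D_pos[of 1] bp[of 0] bp[of 1] by (simp add: abs_mult)
        also have "\<dots> \<le> D 0 * (E * C) + 4 * D 1 * (3 * r 0) * (E * C)"
          using p0 p1 rb D_pos[of 0] D_pos[of 1] bp[of 0] bp[of 1] a_pos[of 0] a_pos[of 1] E C_pos
          by (intro add_mono mult_mono) auto
        also have "\<dots> < E * (Z1 * \<nu>)"
        proof -
          have "Z1 * \<nu> = D 0 * C + 4 * D 1 * (3 * r 0) * C + 1" using nu by (simp add: Z1_def)
          then have "E * (Z1 * \<nu>) = D 0 * (E * C) + 4 * D 1 * (3 * r 0) * (E * C) + E" by (simp add: algebra_simps)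
          then show ?thesis using E by linarith
        qed
        also have "\<dots> = y' i t" by (simp add: y'_def None E_def)
        finally have "\<bar>x' i t\<bar> < y' i t" .
        moreover have "sgn (x i t) * x' i t \<le> \<bar>x' i t\<bar>"
          by (cases "x i t" "0::real" rule: linorder_cases) auto
        ultimately show ?thesis by linarith
      qed
    qed
  qed (use that in auto)
  show "\<bar>defect \<zeta> (b t) n\<bar> \<le> barrier \<mu> n t" if "0 \<le> t" "- N < n" "n \<le> N" for t n
    using strict[of "Some n" t] that by (simp add: I_def x_def y_def)
  show "\<bar>ln (b t 0 / a 0)\<bar> \<le> 2 * \<mu> * Z1" if "0 \<le> t" for t
  proof -
    have "\<bar>ln (b t 0 / a 0)\<bar> \<le> \<mu> * Z1 * (2 - exp (- \<nu> * t))" using strict[of None t] that by (simp add: I_def x_def y_def)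
    also have "\<dots> \<le> \<mu> * Z1 * 2" using mu Z1_pos by (intro mult_left_mono) auto
    finally show ?thesis by simp
  qed
qed

end

section \<open>Global existence\<close>

lemma exp_two_powr_Suc: "exp (B * 2 powr (of_int (n + 1))) = (exp (B * 2 powr (of_int n)))\<^sup>2" for B :: real and n :: int
  by (simp add: powr_add power2_eq_square exp_add[symmetric])

context damped_network
begin

text \<open>
  The factor $e^{B 2^n}$ moves the state along the stationary family.
\<close>

lemma stationary_shift:
  "\<zeta> (n - 1) * (a (n - 1) * exp (B * 2 powr (of_int (n - 1))))\<^sup>2 = a n * exp (B * 2 powr (of_int n))"
  using a_rec[of "n - 1"] exp_two_powr_Suc[of B "n - 1"] by (simp add: power_mult_distrib)

text \<open>
  On a finite index set every positive datum lies between two members of the stationary family,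
  and these are equilibria of the truncated system.
\<close>

lemma truncated_exists:
  fixes N :: int and b0 :: "int \<Rightarrow> real"
  assumes b0: "\<And>n. 0 < b0 n"
  shows "\<exists>b. (\<forall>n. b 0 n = b0 n) \<and>
    (\<forall>n. \<forall>t\<ge>0. ((\<lambda>s. b s n) has_real_derivative net_flux (truncation N) \<zeta> (b t) n) (at t within {0..})) \<and>
    (\<forall>n. \<forall>t\<ge>0. 0 < b t n) \<and> (\<forall>n. \<forall>t\<ge>0. \<bar>n\<bar> > N \<longrightarrow> b t n = b0 n)"
proof -
  define L where "L = (\<lambda>n. \<bar>ln (b0 n / a n)\<bar> * 2 powr (- of_int n))"
  define B where "B = sum L {- N..N}"
  define l where "l = (\<lambda>n. if \<bar>n\<bar> \<le> N then a n * exp (- B * 2 powr (of_int n)) else b0 n)"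
  define u where "u = (\<lambda>n. if \<bar>n\<bar> \<le> N then a n * exp (B * 2 powr (of_int n)) else b0 n)"
  have LB: "\<bar>ln (b0 n / a n)\<bar> \<le> B * 2 powr (of_int n)" if "\<bar>n\<bar> \<le> N" for n
  proof -
    have "L n \<le> B" unfolding B_def using that by (intro member_le_sum) (auto simp: L_def)
    then have "L n * 2 powr (of_int n) \<le> B * 2 powr (of_int n)" by (intro mult_right_mono) auto
    moreover have "L n * 2 powr (of_int n) = \<bar>ln (b0 n / a n)\<bar> * (2 powr (- of_int n) * 2 powr (of_int n))"
      by (simp add: L_def)
    moreover have "2 powr (- of_int n) * 2 powr (of_int n) = (1::real)" by (simp only: powr_add[symmetric]) simp
    ultimately show ?thesis by simp
  qed
  have b0a: "b0 n = a n * exp (ln (b0 n / a n))" for n using b0[of n] a_pos[of n] by simp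
  have lp: "0 < l n" for n using b0 a_pos by (simp add: l_def)
  have lb: "l n \<le> b0 n" for n
  proof (cases "\<bar>n\<bar> \<le> N")
    case True
    have "a n * exp (- B * 2 powr (of_int n)) \<le> a n * exp (ln (b0 n / a n))"
      using LB[OF True] a_pos[of n] by (intro mult_left_mono) auto
    then show ?thesis using True b0a[of n] by (simp add: l_def)
  qed (simp add: l_def)
  have bu: "b0 n \<le> u n" for n
  proof (cases "\<bar>n\<bar> \<le> N")
    case True
    have "a n * exp (ln (b0 n / a n)) \<le> a n * exp (B * 2 powr (of_int n))"
      using LB[OF True] a_pos[of n] by (intro mult_left_mono) auto
    then show ?thesis using True b0a[of n] by (simp add: u_def)
  qed (simp add: u_def)
  have flux0: "truncation N n * (\<zeta> (n - 1) * (x (n - 1))\<^sup>2 - x n) = 0"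
    if "x = l \<or> x = u" for x n
  proof (cases "- N < n \<and> n \<le> N")
    case True
    then have "\<bar>n\<bar> \<le> N" "\<bar>n - 1\<bar> \<le> N" by auto
    then show ?thesis using that stationary_shift[of n B] stationary_shift[of n "- B"] by (auto simp: l_def u_def)
  qed (auto simp: truncation_def)
  have st: "net_flux (truncation N) \<zeta> x n = 0" if "x = l \<or> x = u" for x n
  proof -
    have 1: "truncation N n * (\<zeta> (n - 1) * (x (n - 1))\<^sup>2 - x n) = 0" by (rule flux0[OF that])
    have 2: "truncation N (n + 1) * (\<zeta> n * (x n)\<^sup>2 - x (n + 1)) = 0"
      using flux0[OF that, of "n + 1"] by (simp only: add_diff_cancel_right')
    show ?thesis unfolding net_flux_def mult.assoc 1 2 by simp
  qed
  have tr: "0 \<le> truncation N n" for n by (simp add: truncation_def less_imp_le[OF D_pos])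
  have stl: "0 \<le> net_flux (truncation N) \<zeta> l n" and stu: "net_flux (truncation N) \<zeta> u n \<le> 0" for n
    using st[of l n] st[of u n] by simp_all
  obtain b where "\<forall>n. b 0 n = b0 n"
    "\<forall>n. \<forall>t\<ge>0. ((\<lambda>s. b s n) has_real_derivative net_flux (truncation N) \<zeta> (b t) n) (at t within {0..})"
    "\<forall>n. \<forall>t\<ge>0. l n \<le> b t n \<and> b t n \<le> u n"
    using monotone_iteration[of "truncation N" \<zeta> l b0 u, OF tr less_imp_le[OF zeta_pos] less_imp_le[OF lp] lb bu stl stu]
    by blast
  moreover from this have "0 < b t n" if "0 \<le> t" for t n using lp[of n] that by (meson less_le_trans)
  moreover have "b t n = b0 n" if "0 \<le> t" "\<bar>n\<bar> > N" for t n
    using \<open>\<forall>n. \<forall>t\<ge>0. l n \<le> b t n \<and> b t n \<le> u n\<close>[rule_format, OF that(1), of n] that by (simp add: l_def u_def)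
  ultimately show ?thesis by blast
qed

lemma defect_quotient_bound:
  assumes "\<bar>defect \<zeta> x m\<bar> \<le> barrier \<mu> m t" "0 < \<mu>" "0 \<le> t"
  shows "\<bar>1 - \<zeta> (m - 1) * (x (m - 1))\<^sup>2 / x m\<bar> \<le> \<mu> * C"
proof -
  have "\<bar>1 - \<zeta> (m - 1) * (x (m - 1))\<^sup>2 / x m\<bar> = 2 powr (of_int m) * \<bar>defect \<zeta> x m\<bar>"
    unfolding defect_quotient by (simp add: abs_mult)
  also have "\<dots> \<le> 2 powr (of_int m) * barrier \<mu> m t" using assms(1) by (intro mult_left_mono) auto
  also have "\<dots> \<le> \<mu> * C" by (rule barrier_upper'[OF assms(2,3)])
  finally show ?thesis .
qed

theorem global_solution:
  assumes sm: "small_amplitude \<mu>" and b0: "\<And>n. 0 < b0 n"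
    and init1: "\<And>n. \<bar>1 - \<zeta> (n - 1) * (b0 (n - 1))\<^sup>2 / b0 n\<bar> < \<mu> * c"
    and init2: "\<bar>ln (b0 0 / a 0)\<bar> < \<mu> * Z1"
  shows "\<exists>b. (\<forall>n. b 0 n = b0 n) \<and>
     (\<forall>n. \<forall>t\<ge>0. ((\<lambda>s. b s n) has_real_derivative net_flux D \<zeta> (b t) n) (at t within {0..})) \<and>
     (\<forall>n. \<forall>t\<ge>0. 0 < b t n \<and> \<bar>ln (b t n / a n)\<bar> \<le> \<mu> * K * max 1 (2 powr (of_int n)) \<and>
        \<bar>defect \<zeta> (b t) n\<bar> \<le> barrier \<mu> n t) \<and>
     (\<forall>t\<ge>0. \<bar>ln (b t 0 / a 0)\<bar> \<le> 2 * \<mu> * Z1)"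
proof -
  have mu: "0 < \<mu>" "\<mu> * C \<le> 1/2" using sm by (auto simp: small_amplitude_def)
  have "\<forall>k. \<exists>b. (\<forall>n. b 0 n = b0 n) \<and>
    (\<forall>n. \<forall>t\<ge>0. ((\<lambda>s. b s n) has_real_derivative net_flux (truncation (int k + 1)) \<zeta> (b t) n) (at t within {0..})) \<and>
    (\<forall>n. \<forall>t\<ge>0. 0 < b t n) \<and> (\<forall>n. \<forall>t\<ge>0. \<bar>n\<bar> > int k + 1 \<longrightarrow> b t n = b0 n)"
    using truncated_exists[of b0, OF b0] by blast
  from choice[OF this] obtain bN where bN: "\<forall>k. (\<forall>n. bN k 0 n = b0 n) \<and>
    (\<forall>n. \<forall>t\<ge>0. ((\<lambda>s. bN k s n) has_real_derivative net_flux (truncation (int k + 1)) \<zeta> (bN k t) n) (at t within {0..})) \<and>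
    (\<forall>n. \<forall>t\<ge>0. 0 < bN k t n) \<and> (\<forall>n. \<forall>t\<ge>0. \<bar>n\<bar> > int k + 1 \<longrightarrow> bN k t n = b0 n)"
    by blast
  have bN0: "\<And>k n. bN k 0 n = b0 n"
    and bNd: "\<And>k n t. 0 \<le> t \<Longrightarrow> ((\<lambda>s. bN k s n) has_real_derivative net_flux (truncation (int k + 1)) \<zeta> (bN k t) n) (at t within {0..})"
    and bNp: "\<And>k n t. 0 \<le> t \<Longrightarrow> 0 < bN k t n"
    and bNout: "\<And>k n t. 0 \<le> t \<Longrightarrow> \<bar>n\<bar> > int k + 1 \<Longrightarrow> bN k t n = b0 n"
    using bN by blast+
  have ap1: "\<bar>defect \<zeta> (bN k t) n\<bar> \<le> barrier \<mu> n t" if "0 \<le> t" "- (int k + 1) < n" "n \<le> int k + 1" for k t n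
    by (rule truncated_a_priori(1)[of "int k + 1" \<mu> "bN k"]) (use sm bNp bNd bN0 init1 init2 that in auto)
  have ap2: "\<bar>ln (bN k t 0 / a 0)\<bar> \<le> 2 * \<mu> * Z1" if "0 \<le> t" for k t
    by (rule truncated_a_priori(2)[of "int k + 1" \<mu> "bN k"]) (use sm bNp bNd bN0 init1 init2 that in auto)
  have inside: "\<bar>ln (bN k t n / a n)\<bar> \<le> \<mu> * K * max 1 (2 powr (of_int n))"
    if t: "0 \<le> t" and n: "\<bar>n\<bar> \<le> int k + 1" for k t n
  proof -
    have q: "\<bar>1 - \<zeta> (m - 1) * (bN k t (m - 1))\<^sup>2 / bN k t m\<bar> \<le> \<mu> * C" if "- (int k + 1) < m" "m \<le> int k + 1" for m
      by (rule defect_quotient_bound[OF ap1[OF t that] mu(1) t])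
    have "\<bar>ln (bN k t n / a n)\<bar> \<le> (2 * \<mu> * Z1 + 2 * (\<mu> * C)) * max 1 (2 powr (of_int n))"
      by (rule log_distance_bound(1)[of a \<zeta> "bN k t" "\<mu> * C" "int k + 1"])
         (use a_pos a_rec zeta_pos bNp[OF t] mu q ap2[OF t] n in auto)
    also have "\<dots> \<le> \<mu> * K * max 1 (2 powr (of_int n))"
      using mu C_pos by (intro mult_right_mono) (auto simp: K_def algebra_simps)
    finally show ?thesis .
  qed
  have all: "\<bar>ln (bN k t n / a n)\<bar> \<le> \<mu> * K * max 1 (2 powr (of_int n))" if t: "0 \<le> t" for k t n
  proof (cases "\<bar>n\<bar> \<le> int k + 1")
    case True then show ?thesis by (rule inside[OF t])
  next
    case False
    then have "bN k t n = bN (nat \<bar>n\<bar>) 0 n" using bNout[OF t] bN0 by simp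
    then show ?thesis using inside[of 0 n "nat \<bar>n\<bar>"] by simp
  qed
  define M where "M = (\<lambda>n. \<mu> * K * max 1 (2 powr (of_int n)))"
  have bounds: "a n * exp (- M n) \<le> bN k t n \<and> bN k t n \<le> a n * exp (M n)" if t: "0 \<le> t" for k t n
  proof -
    have e: "bN k t n = a n * exp (ln (bN k t n / a n))" using bNp[OF t, of k n] a_pos[of n] by simp
    have "\<bar>ln (bN k t n / a n)\<bar> \<le> M n" using all[OF t] by (simp add: M_def)
    then have "a n * exp (- M n) \<le> a n * exp (ln (bN k t n / a n)) \<and> a n * exp (ln (bN k t n / a n)) \<le> a n * exp (M n)"
      using a_pos[of n] by (auto intro!: mult_left_mono)
    then show ?thesis using e by simp
  qed
  have fl: "\<exists>N0. \<forall>N\<ge>N0. \<forall>t\<ge>0. ((\<lambda>s. bN N s n) has_real_derivative net_flux D \<zeta> (bN N t) n) (at t within {0..})" for n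
  proof (intro exI[of _ "nat \<bar>n\<bar> + 1"] allI impI)
    fix N t assume N: "nat \<bar>n\<bar> + 1 \<le> N" and t: "0 \<le> (t::real)"
    have "net_flux (truncation (int N + 1)) \<zeta> (bN N t) n = net_flux D \<zeta> (bN N t) n"
      using N by (auto simp: net_flux_def truncation_def)
    then show "((\<lambda>s. bN N s n) has_real_derivative net_flux D \<zeta> (bN N t) n) (at t within {0..})"
      using bNd[OF t, of N n] by simp
  qed
  have bdd: "\<bar>bN k t n\<bar> \<le> a n * exp (M n)" if "0 \<le> t" for k t n
    using bounds[OF that, of n k] bNp[OF that, of k n] by simp
  from network_solution_limit[of bN "\<lambda>n. a n * exp (M n)" b0 D \<zeta>, OF bdd bN0 fl]
  obtain k b where k: "strict_mono k" and lim: "\<And>n t. 0 \<le> t \<Longrightarrow> (\<lambda>N. bN (k N) t n) \<longlonglongrightarrow> b t n"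
    and b0': "\<And>n. b 0 n = b0 n"
    and bd: "\<And>n t. 0 \<le> t \<Longrightarrow> ((\<lambda>s. b s n) has_real_derivative net_flux D \<zeta> (b t) n) (at t within {0..})"
    by blast
  have bp: "0 < b t n" if t: "0 \<le> t" for t n
  proof -
    have "a n * exp (- M n) \<le> b t n"
      by (rule LIMSEQ_le_const[OF lim[OF t]]) (use bounds[OF t] in auto)
    moreover have "0 < a n * exp (- M n)" using a_pos by simp
    ultimately show ?thesis by linarith
  qed
  have ln: "\<bar>ln (b t n / a n)\<bar> \<le> \<mu> * K * max 1 (2 powr (of_int n))" if t: "0 \<le> t" for t n
  proof (rule LIMSEQ_le_const2)
    have "b t n / a n \<noteq> 0" using bp[OF t, of n] a_pos[of n] by simp
    then show "(\<lambda>N. \<bar>ln (bN (k N) t n / a n)\<bar>) \<longlonglongrightarrow> \<bar>ln (b t n / a n)\<bar>"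
      using a_pos[of n] by (intro tendsto_intros lim t) auto
  qed (use all[OF t] in auto)
  have df: "\<bar>defect \<zeta> (b t) n\<bar> \<le> barrier \<mu> n t" if t: "0 \<le> t" for t n
  proof (rule LIMSEQ_le_const2)
    show "(\<lambda>N. \<bar>defect \<zeta> (bN (k N) t) n\<bar>) \<longlonglongrightarrow> \<bar>defect \<zeta> (b t) n\<bar>"
      unfolding defect_def using bp[OF t, of n] by (intro tendsto_intros lim t) auto
    show "\<exists>N0. \<forall>N\<ge>N0. \<bar>defect \<zeta> (bN (k N) t) n\<bar> \<le> barrier \<mu> n t"
    proof (intro exI[of _ "nat \<bar>n\<bar>"] allI impI)
      fix N assume "nat \<bar>n\<bar> \<le> N"
      then have "nat \<bar>n\<bar> \<le> k N" using seq_suble[OF k, of N] by linarith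
      then show "\<bar>defect \<zeta> (bN (k N) t) n\<bar> \<le> barrier \<mu> n t" by (intro ap1 t) auto
    qed
  qed
  have ln0: "\<bar>ln (b t 0 / a 0)\<bar> \<le> 2 * \<mu> * Z1" if t: "0 \<le> t" for t
  proof (rule LIMSEQ_le_const2)
    have "b t 0 / a 0 \<noteq> 0" using bp[OF t, of 0] a_pos[of 0] by simp
    then show "(\<lambda>N. \<bar>ln (bN (k N) t 0 / a 0)\<bar>) \<longlonglongrightarrow> \<bar>ln (b t 0 / a 0)\<bar>"
      using a_pos[of 0] by (intro tendsto_intros lim t) auto
  qed (use ap2[OF t] in auto)
  show ?thesis using b0' bd bp ln df ln0 by blast
qed

end

section \<open>The asymptotic coefficient of a solution\<close>

lemma geometric_limit_bound:
  fixes x :: "nat \<Rightarrow> real"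
  assumes step: "\<And>k. \<bar>x (Suc k) - x k\<bar> \<le> E * \<rho> ^ Suc k" and \<rho>: "0 \<le> \<rho>" "\<rho> \<le> 1/2" and E: "0 \<le> E"
  shows "x \<longlonglongrightarrow> lim x" and "\<bar>x k - lim x\<bar> \<le> E * \<rho> ^ k"
proof -
  have part: "\<bar>x (k + i) - x k\<bar> \<le> E * \<rho> ^ k - E * \<rho> ^ (k + i)" for k i
  proof (induction i)
    case (Suc i)
    have "2 * (E * \<rho> ^ Suc (k + i)) \<le> E * \<rho> ^ (k + i)"
    proof -
      have "E * \<rho> ^ (k + i) * (2 * \<rho>) \<le> E * \<rho> ^ (k + i) * 1"
        using E \<rho> by (intro mult_left_mono) auto
      then show ?thesis by (simp add: mult_ac)
    qed
    moreover have "\<bar>x (k + Suc i) - x (k + i)\<bar> \<le> E * \<rho> ^ Suc (k + i)" using step[of "k + i"] by simp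
    ultimately show ?case using Suc by simp
  qed simp
  have pb: "\<bar>x (k + i) - x k\<bar> \<le> E * \<rho> ^ k" for k i
  proof -
    have "0 \<le> E * \<rho> ^ (k + i)" using E \<rho> by simp
    then show ?thesis using part[of k i] by linarith
  qed
  have "(\<lambda>k. E * \<rho> ^ k) \<longlonglongrightarrow> E * 0" using \<rho> by (intro tendsto_intros LIMSEQ_power_zero) auto
  then have small: "eventually (\<lambda>k. E * \<rho> ^ k < e) sequentially" if "0 < e" for e
    using order_tendstoD(2)[of _ "E * 0" sequentially e] that by simp
  have "Cauchy x"
  proof (rule metric_CauchyI)
    fix e :: real assume "0 < e"
    then obtain M where M: "E * \<rho> ^ M < e / 2" using small[of "e/2"] by (auto simp: eventually_sequentially)
    show "\<exists>M. \<forall>m\<ge>M. \<forall>n\<ge>M. dist (x m) (x n) < e"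
    proof (intro exI[of _ M] allI impI)
      fix m n assume "M \<le> m" "M \<le> n"
      then have "\<bar>x m - x M\<bar> \<le> E * \<rho> ^ M" "\<bar>x n - x M\<bar> \<le> E * \<rho> ^ M" using pb[of M "m - M"] pb[of M "n - M"] by auto
      then show "dist (x m) (x n) < e" using M unfolding dist_real_def by linarith
    qed
  qed
  then show lim: "x \<longlonglongrightarrow> lim x" using Cauchy_convergent convergent_LIMSEQ_iff by blast
  have "(\<lambda>i. \<bar>x k - x (i + k)\<bar>) \<longlonglongrightarrow> \<bar>x k - lim x\<bar>"
    by (intro tendsto_intros LIMSEQ_ignore_initial_segment lim)
  then show "\<bar>x k - lim x\<bar> \<le> E * \<rho> ^ k"
    by (rule LIMSEQ_le_const2) (use pb[of k] in \<open>auto simp: abs_minus_commute add.commute\<close>)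
qed

text \<open>
  A quantity that relaxes at a positive rate and starts at zero never exceeds the size of its
  forcing relative to the rate.
\<close>

lemma relaxation_bound:
  fixes X R rate :: "real \<Rightarrow> real"
  assumes d: "\<And>t. t0 \<le> t \<Longrightarrow> (X has_real_derivative - rate t * X t + R t) (at t)"
    and R: "\<And>t. t0 < t \<Longrightarrow> \<bar>R t\<bar> \<le> rate t * S" and rate: "\<And>t. t0 < t \<Longrightarrow> 0 < rate t"
    and S: "0 \<le> S" and X0: "X t0 = 0" and t: "t0 \<le> t"
  shows "\<bar>X t\<bar> \<le> S"
proof (rule field_le_epsilon)
  fix e :: real assume e: "0 < e"
  define x where "x = (\<lambda>(_::unit) s. X (t0 + s))"
  define x' where "x' = (\<lambda>(_::unit) s. - rate (t0 + s) * X (t0 + s) + R (t0 + s))"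
  have dx: "(x i has_real_derivative x' i s) (at s)" if "0 \<le> s" for i s
    unfolding x_def x'_def
    using DERIV_shift[of X "- rate (t0 + s) * X (t0 + s) + R (t0 + s)" s t0] d[of "t0 + s"] that
    by (simp add: add.commute)
  have "\<bar>x () (t - t0)\<bar> < S + e"
  proof (rule first_touching[where I = "{()}" and x = x and x' = x' and y = "\<lambda>_ _. S + e" and y' = "\<lambda>_ _. 0"])
    show "continuous_on {0..} (x i)" for i
      by (rule DERIV_continuous_on[of _ _ "x' i"]) (auto intro!: has_field_derivative_at_within[OF dx])
    show "(x i has_real_derivative x' i s) (at s)" if "0 < s" for i s using dx that by simp
    show "\<bar>x i 0\<bar> < S + e" for i using X0 S e by (simp add: x_def)
    show "sgn (x i s) * x' i s < 0" if s: "0 < s" and eq: "\<bar>x i s\<bar> = S + e" for i s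
    proof -
      have l: "0 < rate (t0 + s)" using rate s by simp
      have "sgn (x i s) * x' i s = - rate (t0 + s) * (sgn (x i s) * x i s) + sgn (x i s) * R (t0 + s)"
        by (simp add: x_def x'_def algebra_simps)
      also have "sgn (x i s) * x i s = S + e" using eq by (simp add: abs_sgn mult.commute)
      also have "sgn (x i s) * R (t0 + s) \<le> \<bar>R (t0 + s)\<bar>"
        by (cases "x i s" "0::real" rule: linorder_cases) auto
      also have "\<bar>R (t0 + s)\<bar> \<le> rate (t0 + s) * S" using R s by simp
      also have "- rate (t0 + s) * (S + e) + rate (t0 + s) * S = - (rate (t0 + s) * e)" by (simp add: algebra_simps)
      also have "\<dots> < 0" using mult_pos_pos[OF l e] by simp
      finally show ?thesis by simp
    qed
  qed (use S e t in auto)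
  then show "\<bar>X t\<bar> \<le> S + e" by (simp add: x_def)
qed

lemma two_powr_inverse: "2 powr (of_int n) * 2 powr (- of_int n) = (1::real)"
  by (simp only: powr_add[symmetric]) simp

text \<open>
  \<open>D_growth\<close> is the contraction behind the convergence of $D_n p_n$: its constant leaves
  room for the variation of $q_n$.
\<close>

locale damped_solution = damped_network D \<zeta> a w w' \<beta> \<nu> \<eta> \<kappa> c C N1
  for D \<zeta> a :: "int \<Rightarrow> real" and w w' :: "int \<Rightarrow> real \<Rightarrow> real"
    and \<beta> \<nu> \<eta> \<kappa> c C :: real and N1 :: int +
  fixes \<mu> :: real and b :: "real \<Rightarrow> int \<Rightarrow> real" and N2 :: int
  assumes sm: "small_amplitude \<mu>"
    and der: "\<And>n t. 0 \<le> t \<Longrightarrow> ((\<lambda>s. b s n) has_real_derivative net_flux D \<zeta> (b t) n) (at t within {0..})"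
    and pos: "\<And>n t. 0 \<le> t \<Longrightarrow> 0 < b t n"
    and ln_bound: "\<And>n t. 0 \<le> t \<Longrightarrow> \<bar>ln (b t n / a n)\<bar> \<le> \<mu> * K * max 1 (2 powr (of_int n))"
    and ln0_bound: "\<And>t. 0 \<le> t \<Longrightarrow> \<bar>ln (b t 0 / a 0)\<bar> \<le> 2 * \<mu> * Z1"
    and defect_bound: "\<And>n t. 0 \<le> t \<Longrightarrow> \<bar>defect \<zeta> (b t) n\<bar> \<le> barrier \<mu> n t"
    and N2: "N1 + 2 \<le> N2" and D_growth: "\<And>n. N2 \<le> n \<Longrightarrow> D (n - 1) \<le> 3/5 * D n"
begin

definition z :: "int \<Rightarrow> real \<Rightarrow> real" where "z n t = 2 powr (- of_int n) * ln (b t n / a n)"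
definition z_lim :: "real \<Rightarrow> real" where "z_lim t = lim (\<lambda>k. z (int k) t)"
text \<open>
  This is $\varepsilon_n(t)$, and $A(t)$ is the reference parameter minus \<open>z_lim t\<close>.
\<close>

definition excess :: "int \<Rightarrow> real \<Rightarrow> real" where "excess n t = exp (2 powr (of_int n) * (z n t - z_lim t)) - 1"

lemma mu: "0 < \<mu>" "\<mu> * C \<le> 1/10"
  using sm by (auto simp: small_amplitude_def)

lemma quotient_close: "0 \<le> t \<Longrightarrow> \<bar>1 - \<zeta> (n - 1) * (b t (n - 1))\<^sup>2 / b t n\<bar> \<le> \<mu> * C"
  by (rule defect_quotient_bound[OF defect_bound mu(1)])

lemma z_step:
  assumes t: "0 \<le> t" shows "\<bar>z n t - z (n - 1) t\<bar> \<le> 2 * barrier \<mu> n t"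
proof -
  define q where "q = \<zeta> (n - 1) * (b t (n - 1))\<^sup>2 / b t n"
  have an: "a n = \<zeta> (n - 1) * (a (n - 1))\<^sup>2" using a_rec[of "n - 1"] by simp
  have L: "ln (b t n / a n) = 2 * ln (b t (n - 1) / a (n - 1)) - ln q"
    using a_pos[of n] a_pos[of "n-1"] pos[OF t, of n] pos[OF t, of "n-1"] zeta_pos[of "n-1"] an
    by (simp add: q_def ln_mult ln_div ln_realpow)
  have p: "2 powr (- of_int (n - 1)) = 2 * (2::real) powr (- of_int n)"
    using powr_add[of "2::real" 1 "- of_int n"] by (simp add: algebra_simps)
  have "z n t - z (n - 1) t = - (2 powr (- of_int n) * ln q)"
    unfolding z_def L p by (simp add: algebra_simps)
  then have "\<bar>z n t - z (n - 1) t\<bar> = 2 powr (- of_int n) * \<bar>ln q\<bar>" by (simp add: abs_mult)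
  also have "\<dots> \<le> 2 powr (- of_int n) * (2 * \<bar>1 - q\<bar>)"
    using quotient_close[OF t, of n] mu by (intro mult_left_mono abs_ln_le) (auto simp: q_def)
  also have "\<dots> = 2 * \<bar>defect \<zeta> (b t) n\<bar>" by (simp add: defect_def q_def abs_mult)
  also have "\<dots> \<le> 2 * barrier \<mu> n t" using defect_bound[OF t, of n] by simp
  finally show ?thesis .
qed

text \<open>
  The two bounds on the tail of the increments correspond to the two sizes of the weights, $2^{-n}$ and
  $s^{-\theta} 2^{-\beta n}$.
\<close>

lemma z_convergence:
  assumes t: "0 \<le> t"
  defines "E \<equiv> 2 * \<mu> * C * exp (- \<nu> * t)"
  shows "(\<lambda>k. z (int k) t) \<longlonglongrightarrow> z_lim t"
    and "\<bar>z n t - z_lim t\<bar> \<le> E * 2 powr (- of_int n)"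
    and "0 < t \<Longrightarrow> 0 \<le> n \<Longrightarrow> \<bar>z n t - z_lim t\<bar> \<le> E * (1 - exp (- t)) powr (- ((\<beta> - 1) / \<beta>)) * 2 powr (- \<beta> * of_int n)"
proof -
  have E: "0 \<le> E" using mu C_pos by (simp add: E_def)
  have s1: "\<bar>z m t - z (m - 1) t\<bar> \<le> E * 2 powr (- of_int m)" for m
    using order_trans[OF z_step[OF t, of m] mult_left_mono[OF barrier_upper[OF mu(1) t, of m], of 2]]
    by (simp add: E_def mult_ac)
  have h: "(1/2) ^ k = (2::real) powr (- of_int (int k))" for k
    by (simp add: powr_minus powr_realpow power_divide inverse_eq_divide)
  have step1: "\<bar>z (int (Suc k)) t - z (int k) t\<bar> \<le> E * (1/2) ^ Suc k" for k
    unfolding h using s1[of "int (Suc k)"] by simp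
  show lim: "(\<lambda>k. z (int k) t) \<longlonglongrightarrow> z_lim t"
    unfolding z_lim_def using geometric_limit_bound(1)[of "\<lambda>k. z (int k) t" E "1/2"] step1 E by simp
  have up: "\<bar>z (int k) t - z_lim t\<bar> \<le> E * 2 powr (- of_int (int k))" for k
    unfolding z_lim_def h[symmetric] using geometric_limit_bound(2)[of "\<lambda>k. z (int k) t" E "1/2"] step1 E by simp
  have down: "\<bar>z (- int m) t - z 0 t\<bar> \<le> E * (2 ^ m - 1)" for m
  proof (induction m)
    case (Suc m)
    have e: "- int m - 1 = - int (Suc m)" by simp
    have "\<bar>z (- int m) t - z (- int (Suc m)) t\<bar> \<le> E * 2 powr (- of_int (- int m))"
      using s1[of "- int m"] unfolding e .
    also have "2 powr (- of_int (- int m)) = (2::real) ^ m" by (simp add: powr_realpow)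
    finally have "\<bar>z (- int (Suc m)) t - z 0 t\<bar> \<le> E * (2 ^ m - 1) + E * 2 ^ m" using Suc by linarith
    then show ?case by (simp add: algebra_simps)
  qed simp
  show "\<bar>z n t - z_lim t\<bar> \<le> E * 2 powr (- of_int n)"
  proof (cases "0 \<le> n")
    case True then show ?thesis using up[of "nat n"] by simp
  next
    case False
    define m where "m = nat (- n)"
    have m: "n = - int m" using False by (simp add: m_def)
    have "\<bar>z n t - z_lim t\<bar> \<le> E * (2 ^ m - 1) + E"
    proof -
      have "\<bar>z 0 t - z_lim t\<bar> \<le> E" using up[of 0] by simp
      then show ?thesis using down[of m] unfolding m by linarith
    qed
    also have "\<dots> = E * 2 powr (- of_int n)" by (simp add: m powr_realpow algebra_simps)
    finally show ?thesis .
  qed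
  show "\<bar>z n t - z_lim t\<bar> \<le> E * (1 - exp (- t)) powr (- ((\<beta> - 1) / \<beta>)) * 2 powr (- \<beta> * of_int n)"
    if t0: "0 < t" and n: "0 \<le> n"
  proof -
    define S where "S = (1 - exp (- t)) powr (- ((\<beta> - 1) / \<beta>))"
    have S: "0 \<le> S" by (simp add: S_def)
    have g: "((2::real) powr (- \<beta>)) ^ k = 2 powr (- \<beta> * of_int (int k))" for k
      by (simp add: powr_realpow[symmetric] powr_powr)
    have half: "(2::real) powr (- \<beta>) \<le> 1/2"
      using powr_mono[of "- \<beta>" "- 1" "2::real"] beta by (simp add: powr_minus)
    have "\<bar>z (int (Suc k)) t - z (int k) t\<bar> \<le> E * S * (2 powr (- \<beta>)) ^ Suc k" for k
    proof -
      have "\<bar>z (int (Suc k)) t - z (int k) t\<bar> \<le> 2 * barrier \<mu> (int (Suc k)) t"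
        using z_step[OF t, of "int (Suc k)"] by simp
      also have "\<dots> \<le> 2 * (\<mu> * exp (- \<nu> * t) * (C * S * 2 powr (- \<beta> * of_int (int (Suc k)))))"
        unfolding barrier_def S_def using mu t0 by (intro mult_left_mono w_smooth) auto
      finally show ?thesis unfolding g by (simp add: E_def mult_ac)
    qed
    from geometric_limit_bound(2)[of "\<lambda>k. z (int k) t", OF this _ half, of "nat n"]
    have "\<bar>z n t - z_lim t\<bar> \<le> E * S * 2 powr (- \<beta> * of_int n)"
      using E S n unfolding g z_lim_def by simp
    then show ?thesis by (simp add: S_def)
  qed
qed

lemma state_eq: "0 \<le> t \<Longrightarrow> b t n = a n * exp (2 powr (of_int n) * z_lim t) * (1 + excess n t)"
proof -
  assume t: "0 \<le> t"
  have "2 powr (of_int n) * z n t = ln (b t n / a n)"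
    using two_powr_inverse[of n] by (simp add: z_def mult.assoc[symmetric])
  moreover have "b t n = a n * exp (ln (b t n / a n))" using pos[OF t, of n] a_pos[of n] by simp
  ultimately show ?thesis by (simp add: excess_def exp_add[symmetric] right_diff_distrib mult.assoc)
qed

lemma z_lim_bound: "0 \<le> t \<Longrightarrow> \<bar>z_lim t\<bar> \<le> \<mu> * (K + 2 * C)"
proof -
  assume t: "0 \<le> t"
  have "exp (- \<nu> * t) \<le> 1" using nu t by simp
  then have "2 * \<mu> * C * exp (- \<nu> * t) \<le> 2 * \<mu> * C * 1" using mu C_pos by (intro mult_left_mono) auto
  moreover have "\<bar>z 0 t - z_lim t\<bar> \<le> 2 * \<mu> * C * exp (- \<nu> * t)" using z_convergence(2)[OF t, of 0] by simp
  moreover have "\<bar>z 0 t\<bar> \<le> \<mu> * K" using ln_bound[OF t, of 0] by (simp add: z_def)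
  ultimately show ?thesis by (simp add: distrib_left)
qed

lemma excess_bound:
  assumes t: "0 \<le> t"
  shows "\<bar>excess n t\<bar> \<le> 4 * \<mu> * C * exp (- \<nu> * t)"
    and "0 < t \<Longrightarrow> 0 \<le> n \<Longrightarrow> 2 powr ((\<beta> - 1) * of_int n) * \<bar>excess n t\<bar>
       \<le> 4 * \<mu> * C * exp (- \<nu> * t) * (1 - exp (- t)) powr (- ((\<beta> - 1) / \<beta>))"
proof -
  define E where "E = 2 * \<mu> * C * exp (- \<nu> * t)"
  define x where "x = 2 powr (of_int n) * (z n t - z_lim t)"
  have x: "\<bar>x\<bar> = 2 powr (of_int n) * \<bar>z n t - z_lim t\<bar>" by (simp add: x_def abs_mult)
  have "2 powr (of_int n) * \<bar>z n t - z_lim t\<bar> \<le> 2 powr (of_int n) * (E * 2 powr (- of_int n))"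
    using z_convergence(2)[OF t, of n] by (intro mult_left_mono) (auto simp: E_def)
  also have "\<dots> = E * (2 powr (of_int n) * 2 powr (- of_int n))" by simp
  finally have xE: "\<bar>x\<bar> \<le> E" unfolding x two_powr_inverse by simp
  have "exp (- \<nu> * t) \<le> 1" using nu t by simp
  then have "E \<le> 2 * \<mu> * C * 1" unfolding E_def using mu C_pos by (intro mult_left_mono) auto
  then have E1: "E \<le> 1" using mu by simp
  have ex: "\<bar>excess n t\<bar> \<le> 2 * \<bar>x\<bar>"
    unfolding excess_def x_def[symmetric] using xE E1 by (intro exp_bounds_small) auto
  then show "\<bar>excess n t\<bar> \<le> 4 * \<mu> * C * exp (- \<nu> * t)" using xE by (simp add: E_def)
  assume t0: "0 < t" and n: "0 \<le> n"
  define S where "S = (1 - exp (- t)) powr (- ((\<beta> - 1) / \<beta>))"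
  have "\<bar>x\<bar> \<le> 2 powr (of_int n) * (E * S * 2 powr (- \<beta> * of_int n))"
    unfolding x using z_convergence(3)[OF t t0 n] by (intro mult_left_mono) (auto simp: E_def S_def)
  then have "2 powr ((\<beta> - 1) * of_int n) * \<bar>excess n t\<bar>
     \<le> 2 powr ((\<beta> - 1) * of_int n) * (2 * (2 powr (of_int n) * (E * S * 2 powr (- \<beta> * of_int n))))"
    using ex by (intro mult_left_mono) auto
  also have "\<dots> = 2 * E * S * (2 powr ((\<beta> - 1) * of_int n) * 2 powr (of_int n) * 2 powr (- \<beta> * of_int n))" by simp
  also have "2 powr ((\<beta> - 1) * of_int n) * 2 powr (of_int n) * 2 powr (- \<beta> * of_int n) = (1::real)"
    by (simp only: powr_add[symmetric]) (simp add: algebra_simps)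
  finally show "2 powr ((\<beta> - 1) * of_int n) * \<bar>excess n t\<bar>
       \<le> 4 * \<mu> * C * exp (- \<nu> * t) * (1 - exp (- t)) powr (- ((\<beta> - 1) / \<beta>))"
    by (simp add: E_def S_def)
qed


definition scaled_defect :: "int \<Rightarrow> real \<Rightarrow> real" where "scaled_defect n t = D n * defect \<zeta> (b t) n"
definition back_flow :: "int \<Rightarrow> real \<Rightarrow> real" where
  "back_flow n t = 4 * (b t (n + 1) / b t n) * scaled_defect (n + 1) t"
definition relax_rate :: "int \<Rightarrow> real \<Rightarrow> real" where
  "relax_rate n t = D n * (1 - 2 powr (of_int n) * defect \<zeta> (b t) n)"

lemma relax_rate_bounds: "0 \<le> t \<Longrightarrow> 9/10 * D n \<le> relax_rate n t \<and> relax_rate n t \<le> 11/10 * D n"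
proof -
  assume "0 \<le> t"
  then have "\<bar>1 - (1 - 2 powr (of_int n) * defect \<zeta> (b t) n)\<bar> \<le> 1/10"
    using quotient_close[of t n] mu unfolding defect_quotient by linarith
  then have "9/10 \<le> 1 - 2 powr (of_int n) * defect \<zeta> (b t) n" "1 - 2 powr (of_int n) * defect \<zeta> (b t) n \<le> 11/10"
    by linarith+
  then have "D n * (9/10) \<le> relax_rate n t" "relax_rate n t \<le> D n * (11/10)"
    unfolding relax_rate_def using D_pos[of n] by (auto intro: mult_left_mono)
  then show ?thesis by simp
qed

text \<open>
  In terms of $F_n = D_n p_n$ the equation for the defect is a relaxation towards $F_{n-1}$; the remaining terms
  carry the small factor $b_{n+1}/b_n$.
\<close>

lemma scaled_defect_derivative:
  assumes t: "0 < t"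
  shows "(scaled_defect n has_real_derivative
     relax_rate n t * (scaled_defect (n - 1) t - scaled_defect n t + (back_flow n t - back_flow (n - 1) t))) (at t)"
proof -
  have "((\<lambda>s. D n * defect \<zeta> (b s) n) has_real_derivative
     D n * ((1 - 2 powr (of_int n) * defect \<zeta> (b t) n) * chain_op D (\<lambda>m. b t (m + 1) / b t m) (defect \<zeta> (b t)) n)) (at t)"
    using defect_derivative[of b t D \<zeta> "{0..}" n, OF pos der] t
    by (intro DERIV_cmult) (simp add: at_within_atLeast_pos)
  moreover have "chain_op D (\<lambda>m. b t (m + 1) / b t m) (defect \<zeta> (b t)) n
      = scaled_defect (n - 1) t - scaled_defect n t + (back_flow n t - back_flow (n - 1) t)"
    by (simp add: chain_op_def scaled_defect_def back_flow_def algebra_simps)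
  ultimately show ?thesis by (simp add: scaled_defect_def[abs_def] relax_rate_def mult.assoc)
qed

lemma z_derivative:
  assumes t: "0 < t"
  shows "(z n has_real_derivative (back_flow n t - scaled_defect n t)) (at t)"
proof -
  have nz: "b t n \<noteq> 0" "b t (n + 1) \<noteq> 0" using pos[of t] t by (metis less_imp_le less_irrefl)+
  have "((\<lambda>s. b s n) has_real_derivative 2 powr (of_int n) * log_rate D \<zeta> (b t) n * b t n) (at t)"
    using der[of t n] net_flux_log_rate[of "b t" n D \<zeta>, OF nz] t by (simp add: at_within_atLeast_pos)
  then have "((\<lambda>s. 2 powr (- of_int n) * ln (b s n / a n)) has_real_derivative
     2 powr (- of_int n) * (2 powr (of_int n) * log_rate D \<zeta> (b t) n)) (at t)"
    using pos[of t n] a_pos[of n] t nz by (auto intro!: derivative_eq_intros)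
  moreover have "2 powr (- of_int n) * (2 powr (of_int n) * log_rate D \<zeta> (b t) n) = log_rate D \<zeta> (b t) n"
  proof -
    have "2 powr (- of_int n) * (2 powr (of_int n) * log_rate D \<zeta> (b t) n)
       = (2 powr (of_int n) * 2 powr (- of_int n)) * log_rate D \<zeta> (b t) n" by (simp only: mult_ac)
    then show ?thesis by (simp only: two_powr_inverse mult_1_left)
  qed
  moreover have "log_rate D \<zeta> (b t) n = back_flow n t - scaled_defect n t"
    by (simp add: log_rate_def back_flow_def scaled_defect_def)
  ultimately show ?thesis unfolding z_def[abs_def] by (simp only:)
qed

lemma scaled_defect_bound:
  assumes t: "0 < t" and n: "N1 \<le> n"
  shows "\<bar>scaled_defect n t\<bar> \<le> \<mu> * C * exp (- \<nu> * t) * (1 - exp (- t)) powr (- ((\<beta> - 1) / \<beta>))"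
proof -
  have "\<bar>scaled_defect n t\<bar> = D n * \<bar>defect \<zeta> (b t) n\<bar>" using D_pos[of n] by (simp add: scaled_defect_def abs_mult)
  also have "\<dots> \<le> D n * barrier \<mu> n t" using D_pos[of n] defect_bound[of t n] t by (intro mult_left_mono) auto
  also have "\<dots> = \<mu> * exp (- \<nu> * t) * (D n * w n (1 - exp (- t)))" by (simp add: barrier_def)
  also have "\<dots> \<le> \<mu> * exp (- \<nu> * t) * (C * (1 - exp (- t)) powr (- ((\<beta> - 1) / \<beta>)))"
    using mu t n by (intro mult_left_mono Dw_smooth) auto
  finally show ?thesis by (simp add: mult_ac)
qed

lemma ratio_small:
  assumes t: "0 \<le> t" and n: "N1 \<le> n"
  shows "4 * (b t (n + 1) / b t n) \<le> 2 powr (- of_int n)"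
proof -
  have x: "0 < b t (n + 1) / b t n" using pos[OF t] by simp
  have "\<bar>ln ((b t (n + 1) / b t n) / r n)\<bar> \<le> (2 * \<mu> * Z1 + 4 * (\<mu> * C)) * max 1 (2 powr (of_int n))"
  proof (rule log_distance_bound(2)[of a \<zeta> "b t" "\<mu> * C" "\<bar>n\<bar> + 1"])
    show "\<mu> * C \<le> 1 / 2" using mu by simp
    show "\<bar>ln (b t 0 / a 0)\<bar> \<le> 2 * \<mu> * Z1" by (rule ln0_bound[OF t])
  qed (use a_pos a_rec zeta_pos pos[OF t] quotient_close[OF t] in auto)
  also have "2 * \<mu> * Z1 + 4 * (\<mu> * C) = \<mu> * K" by (simp add: K_def algebra_simps)
  finally have "b t (n + 1) / b t n \<le> (\<beta> - 1) / \<beta> / 2048 * 2 powr (- \<beta> * of_int n)"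
    by (rule ratio_close(2)[OF sm x _ n])
  also have "\<dots> \<le> 1/4 * 2 powr (- of_int n)"
  proof (intro mult_mono powr_mono)
    show "(\<beta> - 1) / \<beta> / 2048 \<le> 1/4" using beta by (simp add: field_simps)
    show "- \<beta> * of_int n \<le> - of_int n" using mult_right_mono[of 1 \<beta> "of_int n"] beta N1 n by simp
  qed auto
  finally show ?thesis by linarith
qed


lemma growth_iterate: "D N2 \<le> (3/5) ^ k * D (N2 + int k)"
proof (induction k)
  case (Suc k)
  have "D (N2 + int k) \<le> 3/5 * D (N2 + int (Suc k))" using D_growth[of "N2 + int (Suc k)"] by simp
  then have "(3/5) ^ k * D (N2 + int k) \<le> (3/5) ^ k * (3/5 * D (N2 + int (Suc k)))" by (intro mult_left_mono) auto
  from order_trans[OF Suc this] show ?case by (simp add: mult_ac)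
qed simp

text \<open>
  The increments $F_n - F_{n-1}$ obey a relaxation equation whose forcing is the previous increment times
  the ratio of consecutive rates, which is below $3/4$, plus summable terms.  The factor that
  vanishes at \<open>t0\<close> removes the initial value, of which nothing better than boundedness is known.
\<close>

lemma scaled_defect_increments:
  assumes t0: "0 < t0"
  shows "\<exists>Q\<ge>0. \<forall>k. \<forall>t\<ge>t0. \<bar>(1 - exp (- (t - t0))) * (scaled_defect (N2 + 1 + int k) t - scaled_defect (N2 + int k) t)\<bar> \<le> Q * (7/8) ^ k"
proof -
  define F where "F = scaled_defect"
  define G where "G = back_flow"
  define M where "M = \<mu> * C * (1 - exp (- t0)) powr (- ((\<beta> - 1) / \<beta>))"
  have M0: "0 \<le> M" using mu C_pos by (simp add: M_def)
  have FM: "\<bar>F n t\<bar> \<le> M" if "N1 \<le> n" "t0 \<le> t" for n t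
  proof -
    have e: "exp (- \<nu> * t) \<le> 1" using nu t0 that by simp
    have s: "(1 - exp (- t)) powr (- ((\<beta> - 1) / \<beta>)) \<le> (1 - exp (- t0)) powr (- ((\<beta> - 1) / \<beta>))"
      using t0 that beta by (intro powr_mono2') auto
    have "\<bar>F n t\<bar> \<le> \<mu> * C * exp (- \<nu> * t) * (1 - exp (- t)) powr (- ((\<beta> - 1) / \<beta>))"
      unfolding F_def using t0 that by (intro scaled_defect_bound) auto
    also have "\<dots> \<le> \<mu> * C * 1 * (1 - exp (- t0)) powr (- ((\<beta> - 1) / \<beta>))"
      using mu C_pos e s by (intro mult_mono) auto
    finally show ?thesis by (simp add: M_def)
  qed
  have GM: "\<bar>G n t\<bar> \<le> 2 powr (- of_int n) * M" if "N1 \<le> n" "t0 \<le> t" for n t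
  proof -
    have "\<bar>G n t\<bar> = 4 * (b t (n + 1) / b t n) * \<bar>F (n + 1) t\<bar>"
      using pos[of t n] pos[of t "n+1"] t0 that by (simp add: G_def F_def back_flow_def abs_mult)
    also have "\<dots> \<le> 2 powr (- of_int n) * M"
      using FM[of "n+1" t] ratio_small[of t n] t0 that by (intro mult_mono) auto
    finally show ?thesis .
  qed
  define \<tau> where "\<tau> = (\<lambda>n t. G n t - G (n - 1) t)"
  have \<tau>M: "\<bar>\<tau> (N2 + int j) t\<bar> \<le> 3 * M * (1/2) ^ j" if t: "t0 \<le> t" for j t
  proof -
    define n where "n = N2 + int j"
    have n: "N1 \<le> n" "N1 \<le> n - 1" "int j \<le> n" using N1 N2 by (auto simp: n_def)
    have p: "2 powr (- of_int (n - 1)) = 2 * (2::real) powr (- of_int n)"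
      using powr_add[of "2::real" 1 "- of_int n"] by (simp add: algebra_simps)
    have h: "(2::real) powr (- of_int n) \<le> (1/2) ^ j"
    proof -
      have "(2::real) powr (- of_int n) \<le> 2 powr (- of_int (int j))" using n by (intro powr_mono) auto
      also have "\<dots> = (1/2) ^ j" by (simp add: powr_minus powr_realpow power_divide inverse_eq_divide)
      finally show ?thesis .
    qed
    have "\<bar>\<tau> n t\<bar> \<le> 2 powr (- of_int n) * M + 2 powr (- of_int (n - 1)) * M"
      unfolding \<tau>_def using GM[OF n(1) t] GM[OF n(2) t] by linarith
    also have "\<dots> = 3 * M * 2 powr (- of_int n)" unfolding p by simp
    also have "\<dots> \<le> 3 * M * (1/2) ^ j" using h M0 by (intro mult_left_mono) auto
    finally show ?thesis by (simp add: n_def)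
  qed
  \<comment> \<open>All forcing terms other than the previous increment are at most \<open>Y * (7/8) ^ k\<close> times the rate, so the bound \<open>Q * (7/8) ^ k\<close> reproduces itself because \<open>3/4 * Q + Y \<le> 7/8 * Q\<close>.\<close>
  define Y where "Y = 3 * M / D N2 + 8 * M"
  have Y0: "0 \<le> Y" using M0 D_pos[of N2] by (simp add: Y_def)
  define Q where "Q = 8 * Y + 2 * M"
  have Q0: "0 \<le> Q" using Y0 M0 by (simp add: Q_def)
  define \<phi> where "\<phi> = (\<lambda>t. 1 - exp (- (t - t0)))"
  have \<phi>: "0 \<le> \<phi> t" "\<phi> t \<le> 1" if "t0 \<le> t" for t using that by (auto simp: \<phi>_def)
  define X where "X = (\<lambda>k t. \<phi> t * (F (N2 + 1 + int k) t - F (N2 + int k) t))"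
  have "\<forall>t\<ge>t0. \<bar>X k t\<bar> \<le> Q * (7/8) ^ k" for k
  proof (induction k)
    case 0
    show ?case
    proof (intro allI impI)
      fix t assume t: "t0 \<le> t"
      have "\<bar>X 0 t\<bar> \<le> 1 * \<bar>F (N2 + 1) t - F N2 t\<bar>"
        unfolding X_def abs_mult using \<phi>[OF t] by (intro mult_mono) auto
      also have "\<dots> \<le> 2 * M" using FM[of "N2 + 1" t] FM[of N2 t] t N2 by auto
      also have "\<dots> \<le> Q" using Y0 by (simp add: Q_def)
      finally show "\<bar>X 0 t\<bar> \<le> Q * (7/8) ^ 0" by simp
    qed
  next
    case (Suc k)
    define n where "n = N2 + int k + 2"
    have nj: "n = N2 + int (k + 2)" "n - 1 = N2 + int (k + 1)" by (auto simp: n_def)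
    have XS: "X (Suc k) = (\<lambda>t. \<phi> t * (F n t - F (n - 1) t))"
      by (simp add: X_def n_def fun_eq_iff algebra_simps)
    have Xk: "X k = (\<lambda>t. \<phi> t * (F (n - 1) t - F (n - 2) t))"
      by (simp add: X_def n_def fun_eq_iff algebra_simps)
    define R where "R = (\<lambda>t. exp (- (t - t0)) * (F n t - F (n - 1) t) + \<phi> t * (relax_rate n t * \<tau> n t)
        + relax_rate (n - 1) t * X k t - relax_rate (n - 1) t * (\<phi> t * \<tau> (n - 1) t))"
    have d: "(X (Suc k) has_real_derivative - relax_rate n t * X (Suc k) t + R t) (at t)" if t: "t0 \<le> t" for t
    proof -
      have tp: "0 < t" using t t0 by simp
      have d1: "(F n has_real_derivative relax_rate n t * (F (n - 1) t - F n t + \<tau> n t)) (at t)"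
        using scaled_defect_derivative[OF tp, of n] by (simp add: F_def G_def \<tau>_def)
      have d2: "(F (n - 1) has_real_derivative relax_rate (n - 1) t * (F (n - 2) t - F (n - 1) t + \<tau> (n - 1) t)) (at t)"
        using scaled_defect_derivative[OF tp, of "n - 1"] by (simp add: F_def G_def \<tau>_def)
      have d3: "(\<phi> has_real_derivative exp (- (t - t0))) (at t)"
        unfolding \<phi>_def by (auto intro!: derivative_eq_intros)
      have "(X (Suc k) has_real_derivative exp (- (t - t0)) * (F n t - F (n - 1) t)
         + (relax_rate n t * (F (n - 1) t - F n t + \<tau> n t) - relax_rate (n - 1) t * (F (n - 2) t - F (n - 1) t + \<tau> (n - 1) t)) * \<phi> t) (at t)"
        unfolding XS by (intro DERIV_mult DERIV_diff d1 d2 d3)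
      then show ?thesis by (rule back_subst[of "\<lambda>v. (X (Suc k) has_real_derivative v) (at t)"])
          (simp add: R_def XS Xk algebra_simps)
    qed
    have ratep: "0 < relax_rate m t" if "t0 \<le> t" for m t
      using relax_rate_bounds[of t m] D_pos[of m] t0 that by simp
    have R: "\<bar>R t\<bar> \<le> relax_rate n t * (Q * (7/8) ^ Suc k)" if t: "t0 < t" for t
    proof -
      have t': "t0 \<le> t" "0 \<le> t" using t t0 by auto
      define rn where "rn = relax_rate n t"
      define rm where "rm = relax_rate (n - 1) t"
      have ln: "0 < rn" and lm: "0 < rm" using ratep t' by (auto simp: rn_def rm_def)
      have lmn: "rm \<le> 3/4 * rn"
      proof -
        have "rm \<le> 11/10 * D (n - 1)" using relax_rate_bounds[OF t'(2)] by (simp add: rm_def)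
        moreover have "D (n - 1) \<le> 3/5 * D n" by (rule D_growth) (simp add: n_def)
        moreover have "9/10 * D n \<le> rn" using relax_rate_bounds[OF t'(2)] by (simp add: rn_def)
        ultimately show ?thesis using ln by linarith
      qed
      have a1: "\<bar>exp (- (t - t0)) * (F n t - F (n - 1) t)\<bar> \<le> rn * (3 * M / D N2 * (3/5) ^ k)"
      proof -
        have "\<bar>exp (- (t - t0)) * (F n t - F (n - 1) t)\<bar> \<le> 1 * (2 * M)"
          unfolding abs_mult using FM[of n t] FM[of "n - 1" t] t' N2 by (intro mult_mono) (auto simp: n_def)
        also have "1 * (2 * M) \<le> (9/10 * D n * (3/5) ^ (k+2) / D N2) * (3 * M)"
        proof -
          have "1 \<le> (3/5) ^ (k+2) * D n / D N2" using growth_iterate[of "k+2"] D_pos[of N2] by (simp add: nj)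
          then have "(27/10 * M) * 1 \<le> (27/10 * M) * ((3/5) ^ (k+2) * D n / D N2)" using M0 by (intro mult_left_mono) auto
          then show ?thesis using M0 by (simp add: mult_ac)
        qed
        also have "\<dots> = (9/10 * D n) * (3 * M / D N2 * (3/5) ^ (k+2))" by simp
        also have "\<dots> \<le> rn * (3 * M / D N2 * (3/5) ^ k)"
          using relax_rate_bounds[OF t'(2), of n] M0 D_pos[of N2] D_pos[of n]
          by (intro mult_mono mult_left_mono power_decreasing) (auto simp: rn_def)
        finally show ?thesis .
      qed
      have a2: "\<bar>\<phi> t * (rn * \<tau> n t)\<bar> \<le> rn * (3 * M * (1/2) ^ k)"
      proof -
        have "\<bar>\<tau> n t\<bar> \<le> 3 * M * (1/2) ^ (k+2)" using \<tau>M[OF t'(1), of "k+2"] by (simp add: nj)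
        also have "\<dots> \<le> 3 * M * (1/2) ^ k" using M0 by (intro mult_left_mono power_decreasing) auto
        finally have "\<phi> t * (rn * \<bar>\<tau> n t\<bar>) \<le> 1 * (rn * (3 * M * (1/2) ^ k))"
          using \<phi>[OF t'(1)] ln by (intro mult_mono) auto
        then show ?thesis using \<phi>[OF t'(1)] ln by (simp add: abs_mult)
      qed
      have a3: "\<bar>rm * X k t\<bar> \<le> rn * (3/4 * (Q * (7/8) ^ k))"
      proof -
        have "rm * \<bar>X k t\<bar> \<le> (3/4 * rn) * (Q * (7/8) ^ k)" using lmn Suc t' ln by (intro mult_mono) auto
        then show ?thesis using lm by (simp add: abs_mult mult_ac)
      qed
      have a4: "\<bar>rm * (\<phi> t * \<tau> (n - 1) t)\<bar> \<le> rn * (3 * M * (1/2) ^ k)"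
      proof -
        have "\<bar>\<tau> (n - 1) t\<bar> \<le> 3 * M * (1/2) ^ (k+1)" using \<tau>M[OF t'(1), of "k+1"] unfolding nj(2) .
        also have "\<dots> \<le> 3 * M * (1/2) ^ k" using M0 by (intro mult_left_mono power_decreasing) auto
        finally have "\<phi> t * \<bar>\<tau> (n - 1) t\<bar> \<le> 1 * (3 * M * (1/2) ^ k)"
          using \<phi>[OF t'(1)] by (intro mult_mono) auto
        moreover have "rm \<le> rn" using lmn ln by linarith
        ultimately have "rm * (\<phi> t * \<bar>\<tau> (n - 1) t\<bar>) \<le> rn * (1 * (3 * M * (1/2) ^ k))"
          using mult_mono[of rm rn "\<phi> t * \<bar>\<tau> (n - 1) t\<bar>" "1 * (3 * M * (1/2) ^ k)"] ln \<phi>[OF t'(1)] by simp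
        then show ?thesis using \<phi>[OF t'(1)] lm by (simp add: abs_mult)
      qed
      have "\<bar>R t\<bar> \<le> rn * (3 * M / D N2 * (3/5) ^ k) + rn * (3 * M * (1/2) ^ k) + rn * (3/4 * (Q * (7/8) ^ k)) + rn * (3 * M * (1/2) ^ k)"
        using a1 a2 a3 a4 unfolding R_def rn_def[symmetric] rm_def[symmetric] by linarith
      also have "\<dots> = rn * (3 * M / D N2 * (3/5) ^ k + 6 * M * (1/2) ^ k + 3/4 * (Q * (7/8) ^ k))"
        by (simp add: algebra_simps)
      also have "\<dots> \<le> rn * (3 * M / D N2 * (7/8) ^ k + 6 * M * (7/8) ^ k + 3/4 * (Q * (7/8) ^ k))"
        using ln M0 Q0 D_pos[of N2] by (intro mult_left_mono add_mono power_mono) auto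
      also have "\<dots> = rn * ((3 * M / D N2 + 6 * M + 3/4 * Q) * (7/8) ^ k)" by (simp add: algebra_simps)
      also have "\<dots> \<le> rn * ((7/8 * Q) * (7/8) ^ k)"
      proof (intro mult_left_mono mult_right_mono)
        have "3 * M / D N2 + 6 * M \<le> Y" using M0 by (simp add: Y_def)
        moreover have "8 * Y \<le> Q" using M0 by (simp add: Q_def)
        ultimately show "3 * M / D N2 + 6 * M + 3/4 * Q \<le> 7/8 * Q" by linarith
      qed (use ln in auto)
      finally show ?thesis by (simp add: rn_def mult_ac)
    qed
    show ?case
    proof (intro allI impI)
      fix t assume t: "t0 \<le> t"
      show "\<bar>X (Suc k) t\<bar> \<le> Q * (7/8) ^ Suc k"
        by (rule relaxation_bound[where X = "X (Suc k)" and R = R and rate = "relax_rate n" and ?t0.0 = t0])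
           (use d R ratep Q0 t in \<open>auto simp: X_def \<phi>_def\<close>)
    qed
  qed
  then show ?thesis using Q0 by (intro exI[of _ Q]) (auto simp: X_def \<phi>_def F_def)
qed

lemma z_lim_derivative:
  assumes t: "0 < t"
  shows "\<exists>d. (z_lim has_real_derivative d) (at t) \<and>
     \<bar>d\<bar> \<le> \<mu> * C * exp (- \<nu> * t) * (1 - exp (- t)) powr (- ((\<beta> - 1) / \<beta>))"
proof -
  define t0 where "t0 = t / 4"
  define t1 where "t1 = t / 2"
  have ts: "0 < t0" "t0 < t1" "t1 < t" using t by (auto simp: t0_def t1_def)
  obtain Q where Q: "0 \<le> Q" and inc: "\<And>k s. t0 \<le> s \<Longrightarrow>
     \<bar>(1 - exp (- (s - t0))) * (scaled_defect (N2 + 1 + int k) s - scaled_defect (N2 + int k) s)\<bar> \<le> Q * (7/8) ^ k"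
    using scaled_defect_increments[OF ts(1)] by blast
  define \<phi>1 where "\<phi>1 = 1 - exp (- (t1 - t0))"
  have \<phi>1: "0 < \<phi>1" using ts by (simp add: \<phi>1_def)
  define f where "f = (\<lambda>k s. scaled_defect (N2 + 1 + int k) s - scaled_defect (N2 + int k) s)"
  have fb: "norm (f k s) \<le> Q / \<phi>1 * (7/8) ^ k" if s: "s \<in> {t1<..}" for k s
  proof -
    have "exp (- (s - t0)) \<le> exp (- (t1 - t0))" using s by simp
    then have "\<phi>1 \<le> 1 - exp (- (s - t0))" by (simp add: \<phi>1_def)
    then have "\<phi>1 * \<bar>f k s\<bar> \<le> \<bar>1 - exp (- (s - t0))\<bar> * \<bar>f k s\<bar>" by (intro mult_right_mono) auto
    also have "\<dots> \<le> Q * (7/8) ^ k" using inc[of s k] s ts by (simp add: f_def abs_mult)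
    finally show ?thesis using \<phi>1 by (simp add: field_simps)
  qed
  have sm': "summable (\<lambda>k. Q / \<phi>1 * (7/8) ^ k)" by (intro summable_mult summable_geometric) auto
  define Fl where "Fl = (\<lambda>s. scaled_defect N2 s + (\<Sum>k. f k s))"
  have tel: "scaled_defect N2 s + (\<Sum>i<k. f i s) = scaled_defect (N2 + int k) s" for k s
    by (induction k) (auto simp: f_def algebra_simps)
  have u0: "uniform_limit {t1<..} (\<lambda>k s. \<Sum>i<k. f i s) (\<lambda>s. \<Sum>k. f k s) sequentially"
    by (rule Weierstrass_m_test[OF fb sm'])
  have ul: "uniform_limit {t1<..} (\<lambda>k s. scaled_defect (N2 + int k) s) Fl sequentially"
  proof -
    have "uniform_limit {t1<..} (\<lambda>k s. scaled_defect N2 s + (\<Sum>i<k. f i s)) Fl sequentially"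
      unfolding Fl_def by (intro uniform_limit_intros u0)
    then show ?thesis by (simp only: tel)
  qed
  define M where "M = \<mu> * C * (1 - exp (- t1)) powr (- ((\<beta> - 1) / \<beta>))"
  have M0: "0 \<le> M" using mu C_pos by (simp add: M_def)
  have FM: "\<bar>scaled_defect n s\<bar> \<le> M" if "N1 \<le> n" "t1 < s" for n s
  proof -
    have e: "exp (- \<nu> * s) \<le> 1" using nu ts that by simp
    have p: "(1 - exp (- s)) powr (- ((\<beta> - 1) / \<beta>)) \<le> (1 - exp (- t1)) powr (- ((\<beta> - 1) / \<beta>))"
      using ts that beta by (intro powr_mono2') auto
    have "\<bar>scaled_defect n s\<bar> \<le> \<mu> * C * exp (- \<nu> * s) * (1 - exp (- s)) powr (- ((\<beta> - 1) / \<beta>))"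
      using ts that by (intro scaled_defect_bound) auto
    also have "\<dots> \<le> \<mu> * C * 1 * (1 - exp (- t1)) powr (- ((\<beta> - 1) / \<beta>))"
      using mu C_pos e p by (intro mult_mono) auto
    finally show ?thesis by (simp add: M_def)
  qed
  have gb: "norm (back_flow (N2 + int k) s - 0) \<le> M * (1/2) ^ k" if s: "s \<in> {t1<..}" for k s
  proof -
    define n where "n = N2 + int k"
    have n: "N1 \<le> n" "int k \<le> n" using N1 N2 by (auto simp: n_def)
    have "\<bar>back_flow n s\<bar> = 4 * (b s (n + 1) / b s n) * \<bar>scaled_defect (n + 1) s\<bar>"
      using pos[of s n] pos[of s "n+1"] ts s by (simp add: back_flow_def abs_mult)
    also have "\<dots> \<le> 2 powr (- of_int n) * M"
      using FM[of "n+1" s] ratio_small[of s n] ts s n by (intro mult_mono) auto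
    also have "\<dots> \<le> 2 powr (- of_int (int k)) * M" using n M0 by (intro mult_right_mono powr_mono) auto
    also have "\<dots> = M * (1/2) ^ k" by (simp add: powr_minus powr_realpow power_divide inverse_eq_divide)
    finally show ?thesis by (simp add: n_def)
  qed
  have "uniform_limit {t1<..} (\<lambda>k s. back_flow (N2 + int k) s) (\<lambda>s. 0) sequentially"
  proof (rule uniform_limitI)
    fix e :: real assume "0 < e"
    have "(\<lambda>k. M * (1/2) ^ k) \<longlonglongrightarrow> M * 0" by (intro tendsto_intros LIMSEQ_power_zero) auto
    then have "eventually (\<lambda>k. M * (1/2) ^ k < e) sequentially" using \<open>0 < e\<close> by (intro order_tendstoD(2)) auto
    then show "\<forall>\<^sub>F k in sequentially. \<forall>s\<in>{t1<..}. dist (back_flow (N2 + int k) s) 0 < e"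
      by eventually_elim (use gb in \<open>auto simp: dist_real_def intro: le_less_trans\<close>)
  qed
  from uniform_limit_minus[OF this ul]
  have ul2: "uniform_limit {t1<..} (\<lambda>k s. back_flow (N2 + int k) s - scaled_defect (N2 + int k) s) (\<lambda>s. - Fl s) sequentially"
    by simp
  have "\<exists>g. \<forall>s\<in>{t1<..}. (\<lambda>k. z (N2 + int k) s) \<longlonglongrightarrow> g s \<and> (g has_derivative (\<lambda>h. h * (- Fl s))) (at s within {t1<..})"
  proof (rule has_derivative_sequence[where f' = "\<lambda>k s h. h * (back_flow (N2 + int k) s - scaled_defect (N2 + int k) s)"
        and ?x0.0 = t and l = "z_lim t"])
    show "convex {t1<..}" by (rule convex_real_interval)
    show "t \<in> {t1<..}" using ts by simp
    show "(z (N2 + int k) has_derivative (\<lambda>h. h * (back_flow (N2 + int k) s - scaled_defect (N2 + int k) s))) (at s within {t1<..})"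
      if "s \<in> {t1<..}" for k s
      using z_derivative[of s "N2 + int k"] that ts
      by (auto simp: has_field_derivative_def mult.commute[of _ "_ - _"] intro: has_derivative_at_withinI)
    show "\<forall>\<^sub>F k in sequentially. \<forall>s\<in>{t1<..}. \<forall>h. norm (h * (back_flow (N2 + int k) s - scaled_defect (N2 + int k) s) - h * (- Fl s)) \<le> e * norm h"
      if e: "0 < e" for e
      using uniform_limitD[OF ul2 e]
    proof eventually_elim
      case (elim k)
      show ?case
      proof (intro ballI allI)
        fix s h assume s: "s \<in> {t1<..}"
        define v where "v = back_flow (N2 + int k) s - scaled_defect (N2 + int k) s"
        have "\<bar>v - (- Fl s)\<bar> \<le> e" using elim s by (force simp: dist_real_def v_def)
        then have "\<bar>h\<bar> * \<bar>v - (- Fl s)\<bar> \<le> \<bar>h\<bar> * e" by (intro mult_left_mono) auto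
        moreover have "norm (h * v - h * (- Fl s)) = \<bar>h\<bar> * \<bar>v - (- Fl s)\<bar>"
          by (simp only: abs_mult[symmetric] right_diff_distrib real_norm_def)
        ultimately show "norm (h * (back_flow (N2 + int k) s - scaled_defect (N2 + int k) s) - h * (- Fl s)) \<le> e * norm h"
          unfolding v_def[symmetric] by (simp add: mult.commute)
      qed
    qed
    have "(\<lambda>k. z (int (k + nat N2)) t) \<longlonglongrightarrow> z_lim t"
      by (rule LIMSEQ_ignore_initial_segment[OF z_convergence(1)]) (use t in simp)
    moreover have "int (k + nat N2) = N2 + int k" for k using N1 N2 by simp
    ultimately show "(\<lambda>k. z (N2 + int k) t) \<longlonglongrightarrow> z_lim t" by (simp only:)
  qed
  then obtain g where g1: "\<And>s. t1 < s \<Longrightarrow> (\<lambda>k. z (N2 + int k) s) \<longlonglongrightarrow> g s"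
    and g2: "\<And>s. t1 < s \<Longrightarrow> (g has_derivative (\<lambda>h. h * (- Fl s))) (at s within {t1<..})" by auto
  have gz: "g s = z_lim s" if "t1 < s" for s
  proof -
    have "(\<lambda>k. z (int (k + nat N2)) s) \<longlonglongrightarrow> z_lim s"
      by (rule LIMSEQ_ignore_initial_segment[OF z_convergence(1)]) (use that ts in simp)
    moreover have "int (k + nat N2) = N2 + int k" for k using N1 N2 by simp
    ultimately have "(\<lambda>k. z (N2 + int k) s) \<longlonglongrightarrow> z_lim s" by (simp only:)
    then show ?thesis using LIMSEQ_unique[OF g1[OF that]] by blast
  qed
  have "(g has_real_derivative - Fl t) (at t)"
  proof -
    have "at t within {t1<..} = at t" using ts by (intro at_within_open) auto
    moreover have "(\<lambda>h. h * (- Fl t)) = (*) (- Fl t)" by (auto simp: mult.commute)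
    ultimately show ?thesis using g2[OF ts(3)] by (simp only: has_field_derivative_def)
  qed
  then have d: "(z_lim has_real_derivative - Fl t) (at t)"
    by (rule has_field_derivative_transform_within_open[where S = "{t1<..}"]) (use ts gz in auto)
  have "(\<lambda>k. \<bar>scaled_defect (N2 + int k) t\<bar>) \<longlonglongrightarrow> \<bar>Fl t\<bar>"
    using tendsto_uniform_limitI[OF ul, of t] ts by (intro tendsto_rabs) auto
  then have "\<bar>Fl t\<bar> \<le> \<mu> * C * exp (- \<nu> * t) * (1 - exp (- t)) powr (- ((\<beta> - 1) / \<beta>))"
    by (rule LIMSEQ_le_const2) (use scaled_defect_bound[OF t] N2 in auto)
  then show ?thesis using d by (intro exI[of _ "- Fl t"]) auto
qed

end

section \<open>Uniform bounds on the kernels\<close>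

text \<open>
  Applied to logarithms of quotients of kernels, this turns asymptotics at both ends into two-sided bounds that are
  uniform in $\rho$.
\<close>

lemma bounded_between_limits:
  fixes f :: "real \<Rightarrow> real"
  assumes cont: "continuous_on {0<..} f" and l0: "(f \<longlongrightarrow> l0) (at_right 0)" and l1: "(f \<longlongrightarrow> l1) at_top"
  shows "\<exists>B>0. \<forall>x>0. \<bar>f x\<bar> \<le> B"
proof -
  have "eventually (\<lambda>x. \<bar>f x\<bar> < \<bar>l0\<bar> + 1) (at_right 0)"
    by (rule order_tendstoD(2)[OF tendsto_rabs[OF l0]]) simp
  then obtain d where d: "0 < d" "\<And>x. 0 < x \<Longrightarrow> x < d \<Longrightarrow> \<bar>f x\<bar> < \<bar>l0\<bar> + 1"
    by (auto simp: eventually_at_right_field)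
  have "eventually (\<lambda>x. \<bar>f x\<bar> < \<bar>l1\<bar> + 1) at_top"
    by (rule order_tendstoD(2)[OF tendsto_rabs[OF l1]]) simp
  then obtain X where X: "\<And>x. X \<le> x \<Longrightarrow> \<bar>f x\<bar> < \<bar>l1\<bar> + 1" by (auto simp: eventually_at_top_linorder)
  have "compact (f ` {d..X})"
    by (rule compact_continuous_image[OF continuous_on_subset[OF cont]]) (use d in auto)
  then obtain B where B: "0 < B" "\<And>x. x \<in> {d..X} \<Longrightarrow> \<bar>f x\<bar> \<le> B"
    using bounded_pos[of "f ` {d..X}"] by (auto simp: compact_imp_bounded)
  have "\<bar>f x\<bar> \<le> B + \<bar>l0\<bar> + \<bar>l1\<bar> + 1" if x: "0 < x" for x
  proof -
    consider "x < d" | "x \<in> {d..X}" | "X \<le> x" by force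
    then show ?thesis
    proof cases
      case 1 then show ?thesis using d(2)[OF x] B(1) by linarith
    next
      case 2 then show ?thesis using B(2)[of x] by linarith
    next
      case 3 then show ?thesis using X[of x] B(1) by linarith
    qed
  qed
  then show ?thesis using B(1) by (intro exI[of _ "B + \<bar>l0\<bar> + \<bar>l1\<bar> + 1"]) auto
qed

lemma limit_at_0_from_bigo:
  assumes "(\<lambda>\<xi>. f \<xi> - l) \<in> O[at_right 0](\<lambda>\<xi>. \<xi> powr p)" "0 < (p::real)"
  shows "(f \<longlongrightarrow> l) (at_right (0::real))"
proof -
  have p0: "((\<lambda>\<xi>::real. \<xi> powr p) \<longlongrightarrow> 0) (at_right 0)"
    using tendsto_powr'[of "\<lambda>x. x" 0 "at_right (0::real)" "\<lambda>_. p" p] assms(2)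
    by (auto simp: eventually_at_filter)
  obtain c where "c > 0" and c: "eventually (\<lambda>\<xi>. norm (f \<xi> - l) \<le> c * norm (\<xi> powr p)) (at_right 0)"
    using landau_o.bigE[OF assms(1)] by blast
  have "((\<lambda>\<xi>. c * norm (\<xi> powr p)) \<longlongrightarrow> 0) (at_right 0)"
    using tendsto_mult[OF tendsto_const[of c] tendsto_norm[OF p0]] by simp
  then have "((\<lambda>\<xi>. f \<xi> - l) \<longlongrightarrow> 0) (at_right 0)"
    by (rule Lim_null_comparison[OF c])
  then show ?thesis by (simp add: LIM_zero_iff)
qed

lemma scale_at_right: "(c::real) > 0 \<Longrightarrow> filterlim (\<lambda>\<xi>. c * \<xi>) (at_right 0) (at_right 0)"
  by (auto simp: filterlim_at eventually_at_filter intro!: tendsto_eq_intros)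

lemma scale_at_top: "(c::real) > 0 \<Longrightarrow> filterlim (\<lambda>\<xi>. c * \<xi>) at_top at_top"
  by (rule filterlim_tendsto_pos_mult_at_top[OF tendsto_const _ filterlim_ident])

lemma max_1_at_right: "\<forall>\<^sub>F \<xi> in at_right (0::real). max 1 \<xi> = 1"
  by (auto simp: eventually_at_right_field intro!: exI[of _ 1])

context coag_frag_kernels
begin

lemma k_lim_0: "(k \<longlongrightarrow> k0) (at_right 0)"
  using limit_at_0_from_bigo[OF k_at_0] alphabar by simp

lemma gamma_lim_0: "(\<gamma> \<longlongrightarrow> \<gamma>0) (at_right 0)"
  using limit_at_0_from_bigo[OF gamma_at_0] betabar by simp

lemma k_lim_top: "((\<lambda>\<xi>. k \<xi> / \<xi> powr (\<alpha> + 1)) \<longlongrightarrow> 1) at_top"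
  by (rule asymp_equivD_strong[OF k_at_top])
     (auto intro!: eventually_mono[OF eventually_gt_at_top[of 0]])

lemma gamma_lim_top: "((\<lambda>\<xi>. \<gamma> \<xi> / \<xi> powr \<beta>) \<longlongrightarrow> 1) at_top"
  by (rule asymp_equivD_strong[OF gamma_at_top])
     (auto intro!: eventually_mono[OF eventually_gt_at_top[of 0]])

lemma scaled_limits:
  assumes "c > 0"
  shows "((\<lambda>\<xi>. k (c * \<xi>)) \<longlongrightarrow> k0) (at_right 0)" "((\<lambda>\<xi>. \<gamma> (c * \<xi>)) \<longlongrightarrow> \<gamma>0) (at_right 0)"
    "((\<lambda>\<xi>. k (c * \<xi>) / \<xi> powr (\<alpha> + 1)) \<longlongrightarrow> c powr (\<alpha> + 1)) at_top"
    "((\<lambda>\<xi>. \<gamma> (c * \<xi>) / \<xi> powr \<beta>) \<longlongrightarrow> c powr \<beta>) at_top"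
proof -
  show "((\<lambda>\<xi>. k (c * \<xi>)) \<longlongrightarrow> k0) (at_right 0)" "((\<lambda>\<xi>. \<gamma> (c * \<xi>)) \<longlongrightarrow> \<gamma>0) (at_right 0)"
    using filterlim_compose[OF k_lim_0 scale_at_right[OF assms]] filterlim_compose[OF gamma_lim_0 scale_at_right[OF assms]] by auto
  have *: "((\<lambda>\<xi>. f (c * \<xi>) / \<xi> powr p) \<longlongrightarrow> c powr p) at_top"
    if f: "((\<lambda>\<xi>. f \<xi> / \<xi> powr p) \<longlongrightarrow> 1) at_top" for f :: "real \<Rightarrow> real" and p
  proof -
    have "((\<lambda>\<xi>. c powr p * (f (c * \<xi>) / (c * \<xi>) powr p)) \<longlongrightarrow> c powr p * 1) at_top"
      by (intro tendsto_intros filterlim_compose[OF f scale_at_top[OF assms]])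
    moreover have "\<forall>\<^sub>F \<xi> in at_top. c powr p * (f (c * \<xi>) / (c * \<xi>) powr p) = f (c * \<xi>) / \<xi> powr p"
      using eventually_gt_at_top[of "0::real"] by eventually_elim (use assms in \<open>simp add: powr_mult\<close>)
    ultimately have "((\<lambda>\<xi>. f (c * \<xi>) / \<xi> powr p) \<longlongrightarrow> c powr p * 1) at_top" by (rule Lim_transform_eventually)
    then show ?thesis by simp
  qed
  show "((\<lambda>\<xi>. k (c * \<xi>) / \<xi> powr (\<alpha> + 1)) \<longlongrightarrow> c powr (\<alpha> + 1)) at_top"
    "((\<lambda>\<xi>. \<gamma> (c * \<xi>) / \<xi> powr \<beta>) \<longlongrightarrow> c powr \<beta>) at_top"
    using *[OF k_lim_top] *[OF gamma_lim_top] by auto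
qed

lemma kernel_cont:
  assumes "c > 0"
  shows "continuous_on {0<..} (\<lambda>\<xi>. k (c * \<xi>))" "continuous_on {0<..} (\<lambda>\<xi>. \<gamma> (c * \<xi>))"
  using assms
  by (auto intro!: continuous_on_compose2[OF k_cont] continuous_on_compose2[OF gamma_cont] continuous_intros)

text \<open>
  $\ln \vartheta_{n,\rho}$ as a function of $\xi = 2^{n+\rho}$.
\<close>

definition ln_theta :: "real \<Rightarrow> real" where
  "ln_theta \<xi> = ln (k (2 * \<xi>) * \<gamma> (2 * \<xi>) / (k \<xi> * \<gamma> (4 * \<xi>)))"

lemma ln_theta_lim_0: "(ln_theta \<longlongrightarrow> 0) (at_right 0)"
proof -
  have "((\<lambda>\<xi>. ln (k (2 * \<xi>) * \<gamma> (2 * \<xi>) / (k (1 * \<xi>) * \<gamma> (4 * \<xi>)))) \<longlongrightarrow> ln (k0 * \<gamma>0 / (k0 * \<gamma>0))) (at_right 0)"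
    using k0_pos gamma0_pos by (intro tendsto_intros scaled_limits) auto
  then show ?thesis using k0_pos gamma0_pos by (simp add: ln_theta_def[abs_def])
qed

lemma ln_theta_bounded: "\<exists>B>0. \<forall>\<xi>>0. \<bar>ln_theta \<xi>\<bar> \<le> B"
proof (rule bounded_between_limits[OF _ ln_theta_lim_0])
  have "continuous_on {0<..} (\<lambda>\<xi>. ln (k (2 * \<xi>) * \<gamma> (2 * \<xi>) / (k (1 * \<xi>) * \<gamma> (4 * \<xi>))))"
    using k_pos gamma_pos
    by (intro continuous_intros kernel_cont) (auto simp: less_imp_le less_imp_neq[symmetric])
  then show "continuous_on {0<..} ln_theta" by (simp add: ln_theta_def[abs_def])
  have "((\<lambda>\<xi>. ln ((k (2 * \<xi>) / \<xi> powr (\<alpha> + 1)) * (\<gamma> (2 * \<xi>) / \<xi> powr \<beta>) / ((k (1 * \<xi>) / \<xi> powr (\<alpha> + 1)) * (\<gamma> (4 * \<xi>) / \<xi> powr \<beta>))))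
     \<longlongrightarrow> ln (2 powr (\<alpha> + 1) * 2 powr \<beta> / (1 powr (\<alpha> + 1) * 4 powr \<beta>))) at_top"
    by (intro tendsto_intros scaled_limits) auto
  moreover have "\<forall>\<^sub>F \<xi> in at_top. ln ((k (2 * \<xi>) / \<xi> powr (\<alpha> + 1)) * (\<gamma> (2 * \<xi>) / \<xi> powr \<beta>) / ((k (1 * \<xi>) / \<xi> powr (\<alpha> + 1)) * (\<gamma> (4 * \<xi>) / \<xi> powr \<beta>)))
      = ln_theta \<xi>"
    using eventually_gt_at_top[of "0::real"] by eventually_elim (simp add: ln_theta_def)
  ultimately show "(ln_theta \<longlongrightarrow> ln (2 powr (\<alpha> + 1) * 2 powr \<beta> / (1 powr (\<alpha> + 1) * 4 powr \<beta>))) at_top"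
    by (rule Lim_transform_eventually)
qed

lemma gamma_power_bounds: "\<exists>c>0. \<exists>C>0. \<forall>\<xi>>0. c * max 1 \<xi> powr \<beta> \<le> \<gamma> \<xi> \<and> \<gamma> \<xi> \<le> C * max 1 \<xi> powr \<beta>"
proof -
  have "\<exists>B>0. \<forall>\<xi>>0. \<bar>ln (\<gamma> \<xi> / max 1 \<xi> powr \<beta>)\<bar> \<le> B"
  proof (rule bounded_between_limits)
    show "continuous_on {0<..} (\<lambda>\<xi>. ln (\<gamma> \<xi> / max 1 \<xi> powr \<beta>))"
      using gamma_pos by (intro continuous_intros gamma_cont) (auto simp: less_imp_neq[symmetric])
    have "((\<lambda>\<xi>. ln (\<gamma> \<xi>)) \<longlongrightarrow> ln \<gamma>0) (at_right 0)" using gamma0_pos by (intro tendsto_intros gamma_lim_0) auto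
    moreover have "\<forall>\<^sub>F \<xi> in at_right 0. ln (\<gamma> \<xi>) = ln (\<gamma> \<xi> / max 1 \<xi> powr \<beta>)"
      using max_1_at_right by eventually_elim simp
    ultimately show "((\<lambda>\<xi>. ln (\<gamma> \<xi> / max 1 \<xi> powr \<beta>)) \<longlongrightarrow> ln \<gamma>0) (at_right 0)" by (rule Lim_transform_eventually)
    have "((\<lambda>\<xi>. ln (\<gamma> \<xi> / \<xi> powr \<beta>)) \<longlongrightarrow> ln 1) at_top" by (intro tendsto_intros gamma_lim_top) auto
    moreover have "\<forall>\<^sub>F \<xi> in at_top. ln (\<gamma> \<xi> / \<xi> powr \<beta>) = ln (\<gamma> \<xi> / max 1 \<xi> powr \<beta>)"
      using eventually_ge_at_top[of "1::real"] by eventually_elim (simp add: max_def)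
    ultimately show "((\<lambda>\<xi>. ln (\<gamma> \<xi> / max 1 \<xi> powr \<beta>)) \<longlongrightarrow> ln 1) at_top" by (rule Lim_transform_eventually)
  qed
  then obtain B where B: "\<And>\<xi>. 0 < \<xi> \<Longrightarrow> \<bar>ln (\<gamma> \<xi> / max 1 \<xi> powr \<beta>)\<bar> \<le> B" by blast
  show ?thesis
  proof (rule exI[of _ "exp (- B)"], rule conjI, simp, rule exI[of _ "exp B"], intro conjI allI impI)
    fix \<xi> :: real assume \<xi>: "0 < \<xi>"
    define y where "y = \<gamma> \<xi> / max 1 \<xi> powr \<beta>"
    have p: "0 < max 1 \<xi> powr \<beta>" by simp
    have y: "0 < y" "\<gamma> \<xi> = y * max 1 \<xi> powr \<beta>" using gamma_pos[OF \<xi>] p by (auto simp: y_def)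
    have "exp (- B) \<le> exp (ln y)" "exp (ln y) \<le> exp B" using B[OF \<xi>] by (auto simp: y_def abs_le_iff)
    then have "exp (- B) \<le> y" "y \<le> exp B" using y by auto
    then show "exp (- B) * max 1 \<xi> powr \<beta> \<le> \<gamma> \<xi>" "\<gamma> \<xi> \<le> exp B * max 1 \<xi> powr \<beta>"
      unfolding y(2) by (auto intro!: mult_right_mono)
  qed auto
qed

text \<open>
  The quotient governs $1/\zeta_{n,\rho}$.
\<close>

lemma gamma_k_power_bounds:
  "\<exists>c>0. \<exists>C>0. \<forall>\<xi>>0. c * max 1 \<xi> powr (\<beta> - \<alpha> - 1) \<le> \<gamma> (2 * \<xi>) / k \<xi> \<and> \<gamma> (2 * \<xi>) / k \<xi> \<le> C * max 1 \<xi> powr (\<beta> - \<alpha> - 1)"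
proof -
  define p where "p = \<beta> - \<alpha> - 1"
  have "\<exists>B>0. \<forall>\<xi>>0. \<bar>ln (\<gamma> (2 * \<xi>) / k (1 * \<xi>) / max 1 \<xi> powr p)\<bar> \<le> B"
  proof (rule bounded_between_limits)
    show "continuous_on {0<..} (\<lambda>\<xi>. ln (\<gamma> (2 * \<xi>) / k (1 * \<xi>) / max 1 \<xi> powr p))"
      using gamma_pos k_pos by (intro continuous_intros kernel_cont) (auto simp: less_imp_neq[symmetric])
    have "((\<lambda>\<xi>. ln (\<gamma> (2 * \<xi>) / k (1 * \<xi>))) \<longlongrightarrow> ln (\<gamma>0 / k0)) (at_right 0)"
      using gamma0_pos k0_pos by (intro tendsto_intros scaled_limits) auto
    moreover have "\<forall>\<^sub>F \<xi> in at_right 0. ln (\<gamma> (2 * \<xi>) / k (1 * \<xi>)) = ln (\<gamma> (2 * \<xi>) / k (1 * \<xi>) / max 1 \<xi> powr p)"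
      using max_1_at_right by eventually_elim simp
    ultimately show "((\<lambda>\<xi>. ln (\<gamma> (2 * \<xi>) / k (1 * \<xi>) / max 1 \<xi> powr p)) \<longlongrightarrow> ln (\<gamma>0 / k0)) (at_right 0)"
      by (rule Lim_transform_eventually)
    have "((\<lambda>\<xi>. ln ((\<gamma> (2 * \<xi>) / \<xi> powr \<beta>) / (k (1 * \<xi>) / \<xi> powr (\<alpha> + 1)))) \<longlongrightarrow> ln (2 powr \<beta> / 1 powr (\<alpha> + 1))) at_top"
      by (intro tendsto_intros scaled_limits) auto
    moreover have "\<forall>\<^sub>F \<xi> in at_top. ln ((\<gamma> (2 * \<xi>) / \<xi> powr \<beta>) / (k (1 * \<xi>) / \<xi> powr (\<alpha> + 1))) = ln (\<gamma> (2 * \<xi>) / k (1 * \<xi>) / max 1 \<xi> powr p)"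
      using eventually_ge_at_top[of "1::real"]
    proof eventually_elim
      case (elim \<xi>)
      have "\<xi> powr p = \<xi> powr \<beta> / \<xi> powr (\<alpha> + 1)" by (simp add: powr_diff[symmetric] p_def algebra_simps)
      then show ?case using elim by (simp add: max_def mult.commute)
    qed
    ultimately show "((\<lambda>\<xi>. ln (\<gamma> (2 * \<xi>) / k (1 * \<xi>) / max 1 \<xi> powr p)) \<longlongrightarrow> ln (2 powr \<beta> / 1 powr (\<alpha> + 1))) at_top"
      by (rule Lim_transform_eventually)
  qed
  then obtain B where B: "\<And>\<xi>. 0 < \<xi> \<Longrightarrow> \<bar>ln (\<gamma> (2 * \<xi>) / k \<xi> / max 1 \<xi> powr p)\<bar> \<le> B" by auto
  show ?thesis
    unfolding p_def[symmetric]
  proof (rule exI[of _ "exp (- B)"], rule conjI, simp, rule exI[of _ "exp B"], intro conjI allI impI)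
    fix \<xi> :: real assume \<xi>: "0 < \<xi>"
    define y where "y = \<gamma> (2 * \<xi>) / k \<xi> / max 1 \<xi> powr p"
    have p: "0 < max 1 \<xi> powr p" by simp
    have y: "0 < y" "\<gamma> (2 * \<xi>) / k \<xi> = y * max 1 \<xi> powr p"
      using gamma_pos[of "2 * \<xi>"] k_pos[of \<xi>] \<xi> p by (auto simp: y_def)
    have "exp (- B) \<le> exp (ln y)" "exp (ln y) \<le> exp B" using B[OF \<xi>] by (auto simp: y_def abs_le_iff)
    then have "exp (- B) \<le> y" "y \<le> exp B" using y by auto
    then show "exp (- B) * max 1 \<xi> powr p \<le> \<gamma> (2 * \<xi>) / k \<xi>" "\<gamma> (2 * \<xi>) / k \<xi> \<le> exp B * max 1 \<xi> powr p"
      unfolding y(2) by (auto intro!: mult_right_mono)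
  qed auto
qed

lemma zeta_pos: "0 < zeta k \<gamma> \<rho> n"
  using k_pos[of "2 powr (of_int n + \<rho>)"] gamma_pos[of "2 powr (of_int n + \<rho> + 1)"]
  by (simp add: zeta_def)

lemma ln_vartheta: "ln (vartheta k \<gamma> \<rho> n) = ln_theta (2 powr (of_int n + \<rho>))"
proof -
  define \<xi> where "\<xi> = (2::real) powr (of_int n + \<rho>)"
  have e: "(2::real) powr (of_int n + \<rho> + 1) = 2 * \<xi>" "(2::real) powr (of_int (n + 1) + \<rho>) = 2 * \<xi>"
    "(2::real) powr (of_int (n + 1) + \<rho> + 1) = 4 * \<xi>"
    by (simp_all add: \<xi>_def powr_add)
  have x: "0 < \<xi>" by (simp add: \<xi>_def)
  have "vartheta k \<gamma> \<rho> n = k (2 * \<xi>) * \<gamma> (2 * \<xi>) / (k \<xi> * \<gamma> (4 * \<xi>))"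
    unfolding vartheta_def zeta_def e \<xi>_def[symmetric] using x by (simp add: field_simps)
  then show ?thesis by (simp add: ln_theta_def \<xi>_def)
qed

end

section \<open>Stationary states and their mass\<close>

lemma exp_neg_bounds:
  fixes x :: real assumes "0 < x"
  shows "exp (- x) \<le> 1 / x" "exp (- x) \<le> 256 / x ^ 4"
proof -
  have "x \<le> exp x" using exp_ge_add_one_self[of x] by linarith
  then have "1 / exp x \<le> 1 / x" using assms by (intro divide_left_mono) auto
  then show "exp (- x) \<le> 1 / x" by (simp add: exp_minus inverse_eq_divide)
  have "x / 4 \<le> exp (x / 4)" using exp_ge_add_one_self[of "x/4"] by linarith
  then have "(x / 4) ^ 4 \<le> exp (x / 4) ^ 4" using assms by (intro power_mono) auto
  also have "\<dots> = exp x" by (simp add: exp_of_nat_mult[symmetric])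
  finally have "x ^ 4 / 256 \<le> exp x" by (simp add: power_divide)
  then have "1 / exp x \<le> 1 / (x ^ 4 / 256)" using assms by (intro divide_left_mono) auto
  then show "exp (- x) \<le> 256 / x ^ 4" by (simp add: exp_minus inverse_eq_divide)
qed

lemma summable_two_powr_abs: "(\<lambda>n::int. (2::real) powr (- of_int \<bar>n\<bar>)) summable_on UNIV"
proof -
  have g: "(\<lambda>k::nat. (1/2::real) ^ k) summable_on UNIV"
    by (rule norm_summable_imp_summable_on) (simp add: summable_geometric)
  have e: "(2::real) powr (- real k) = (1/2) ^ k" for k
    by (simp add: powr_minus powr_realpow power_divide inverse_eq_divide)
  have 1: "(\<lambda>n::int. (2::real) powr (- of_int \<bar>n\<bar>)) summable_on (int ` UNIV)"
    by (subst summable_on_reindex) (use g in \<open>auto simp: o_def e\<close>)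
  have 2: "(\<lambda>n::int. (2::real) powr (- of_int \<bar>n\<bar>)) summable_on ((\<lambda>k. - int k) ` UNIV)"
    by (subst summable_on_reindex) (use g in \<open>auto simp: o_def e inj_on_def\<close>)
  have "UNIV = int ` UNIV \<union> ((\<lambda>k. - int k) ` UNIV - int ` UNIV)"
  proof (intro equalityI subsetI)
    fix n :: int
    show "n \<in> int ` UNIV \<union> ((\<lambda>k. - int k) ` UNIV - int ` UNIV)"
    proof (cases "0 \<le> n")
      case True then have "n = int (nat n)" by simp
      then show ?thesis by blast
    next
      case False
      then have "n = - int (nat (- n))" by simp
      then have "n \<in> (\<lambda>k. - int k) ` UNIV" by blast
      then show ?thesis by blast
    qed
  qed simp
  moreover have "(\<lambda>n::int. (2::real) powr (- of_int \<bar>n\<bar>)) summable_on (int ` UNIV \<union> ((\<lambda>k. - int k) ` UNIV - int ` UNIV))"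
    by (intro summable_on_Un_disjoint 1 summable_on_subset_banach[OF 2]) auto
  ultimately show ?thesis by simp
qed

context coag_frag_kernels
begin

text \<open>
  The second exponent in $\alpha_n(A,\rho)$, with the opposite sign.
\<close>

definition drift :: "real \<Rightarrow> int \<Rightarrow> real" where
  "drift \<rho> n = 2 powr (of_int n) * (\<Sum>i. 2 powr (- of_int (n + 1 + int i)) * ln_theta (2 powr (of_int (n + int i) + \<rho>)))"

lemma alpha_coeff_eq: "alpha_coeff k \<gamma> A \<rho> n = exp (- (A * 2 powr (of_int n)) - drift \<rho> n)"
proof -
  have p: "(2::real) powi m = 2 powr (of_int m)" for m by (simp add: powr_real_of_int')
  have "(\<Sum>i. let j = n + 1 + int i in 2 powi (- j) * ln (vartheta k \<gamma> \<rho> (j - 1)))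
     = (\<Sum>i. 2 powr (- of_int (n + 1 + int i)) * ln_theta (2 powr (of_int (n + int i) + \<rho>)))"
    unfolding Let_def ln_vartheta p by (rule suminf_cong) (simp add: algebra_simps)
  then show ?thesis unfolding alpha_coeff_def p drift_def by (simp add: exp_add[symmetric])
qed

lemma drift_recursion:
  "drift \<rho> n = (drift \<rho> (n + 1) + ln_theta (2 powr (of_int n + \<rho>))) / 2" (is ?rec)
  and drift_bound: "\<lbrakk>\<And>\<xi>. 0 < \<xi> \<Longrightarrow> \<bar>ln_theta \<xi>\<bar> \<le> B\<rbrakk> \<Longrightarrow> \<bar>drift \<rho> n\<bar> \<le> B"
proof -
  define f where "f = (\<lambda>n i. 2 powr (- of_int (n + 1 + int i)) * ln_theta (2 powr (of_int (n + int i) + \<rho>)))"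
  have d: "drift \<rho> n = 2 powr (of_int n) * suminf (f n)" for n by (simp add: drift_def f_def)
  have e: "(2::real) powr (- of_int (n + 1 + int i)) = 2 powr (- of_int (n + 1)) * (1/2) ^ i" for n i
  proof -
    have "(2::real) powr (- of_int (n + 1 + int i)) = 2 powr (- of_int (n + 1)) * 2 powr (- real i)"
      by (simp only: powr_add[symmetric]) (simp add: algebra_simps)
    also have "(2::real) powr (- real i) = (1/2) ^ i"
      by (simp add: powr_minus powr_realpow power_divide inverse_eq_divide)
    finally show ?thesis .
  qed
  have geo: "(\<lambda>i. c * (1/2::real) ^ i) sums (c * 2)" for c
    using sums_mult[OF geometric_sums[of "1/2::real"], of c] by simp
  have fb: "norm (f n i) \<le> (2 powr (- of_int (n + 1)) * B) * (1/2) ^ i"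
    if B: "\<And>\<xi>. 0 < \<xi> \<Longrightarrow> \<bar>ln_theta \<xi>\<bar> \<le> B" for B n i
  proof -
    have "norm (f n i) = 2 powr (- of_int (n + 1)) * (1/2) ^ i * \<bar>ln_theta (2 powr (of_int (n + int i) + \<rho>))\<bar>"
      unfolding f_def e by (simp add: abs_mult)
    also have "\<dots> \<le> 2 powr (- of_int (n + 1)) * (1/2) ^ i * B" by (intro mult_left_mono B) auto
    finally show ?thesis by (simp add: mult_ac)
  qed
  obtain B0 where B0: "\<And>\<xi>. 0 < \<xi> \<Longrightarrow> \<bar>ln_theta \<xi>\<bar> \<le> B0" using ln_theta_bounded by blast
  have sm: "summable (f n)" for n
    by (rule summable_comparison_test'[OF sums_summable[OF geo] fb[OF B0]])
  have two: "2 powr (of_int n) * (2::real) powr (- of_int (n + 1)) = 1/2" for n :: int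
    by (simp only: powr_add[symmetric]) (simp add: powr_minus)
  have fS: "f n (Suc i) = f (n + 1) i" for i by (simp add: f_def algebra_simps)
  have "suminf (f n) = f n 0 + suminf (f (n + 1))"
    using suminf_split_head[OF sm[of n]] by (simp add: fS)
  then have "drift \<rho> n = 2 powr (of_int n) * f n 0 + 2 powr (of_int n) * suminf (f (n + 1))"
    by (simp add: d distrib_left)
  also have "2 powr (of_int n) * f n 0 = 1/2 * ln_theta (2 powr (of_int n + \<rho>))"
    using two[of n] by (simp add: f_def mult.assoc[symmetric])
  also have "2 powr (of_int n) * suminf (f (n + 1)) = drift \<rho> (n + 1) / 2"
    by (simp add: d powr_add)
  finally show ?rec by simp
  assume B: "\<And>\<xi>. 0 < \<xi> \<Longrightarrow> \<bar>ln_theta \<xi>\<bar> \<le> B"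
  have "norm (suminf (f n)) \<le> (\<Sum>i. (2 powr (- of_int (n + 1)) * B) * (1/2) ^ i)"
    by (rule norm_suminf_le[OF fb[OF B] sums_summable[OF geo]])
  also have "\<dots> = (2 powr (- of_int (n + 1)) * B) * 2" using sums_unique[OF geo] by simp
  finally have "2 powr (of_int n) * \<bar>suminf (f n)\<bar> \<le> 2 powr (of_int n) * ((2 powr (- of_int (n + 1)) * B) * 2)"
    by (intro mult_left_mono) auto
  also have "\<dots> = (2 powr (of_int n) * 2 powr (- of_int (n + 1))) * (B * 2)" by simp
  finally show "\<bar>drift \<rho> n\<bar> \<le> B" unfolding two by (simp add: d abs_mult)
qed

text \<open>
  By \<open>drift_recursion\<close> the drift is halved at each step to the left, up to $\ln\vartheta$, which tends to zero
  there uniformly in $\rho$.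
\<close>

lemma drift_small_left:
  assumes "0 < e" shows "\<exists>n1. \<forall>n\<le>n1. \<forall>\<rho>. 0 \<le> \<rho> \<longrightarrow> \<rho> < 1 \<longrightarrow> \<bar>drift \<rho> n\<bar> \<le> e"
proof -
  obtain B where B: "0 < B" "\<And>\<xi>. 0 < \<xi> \<Longrightarrow> \<bar>ln_theta \<xi>\<bar> \<le> B" using ln_theta_bounded by blast
  have "eventually (\<lambda>\<xi>. \<bar>ln_theta \<xi>\<bar> < e/2) (at_right 0)"
    using assms by (intro order_tendstoD(2)[OF tendsto_rabs[OF ln_theta_lim_0]]) auto
  then obtain d where d: "0 < d" "\<And>\<xi>. 0 < \<xi> \<Longrightarrow> \<xi> < d \<Longrightarrow> \<bar>ln_theta \<xi>\<bar> < e/2"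
    by (auto simp: eventually_at_right_field)
  obtain N :: nat where N: "(1/2) ^ N < d / 2" using real_arch_pow_inv[of "d/2" "1/2"] d by auto
  obtain K :: nat where K: "(1/2) ^ K < e / 2 / B" using real_arch_pow_inv[of "e / 2 / B" "1/2"] assms B by auto
  have small: "\<bar>ln_theta (2 powr (of_int n + \<rho>))\<bar> \<le> e/2" if n: "n \<le> - int N" and \<rho>: "\<rho> < 1" for n \<rho>
  proof -
    have "(2::real) powr (of_int n + \<rho>) \<le> 2 powr (- of_int (int N) + 1)" using n \<rho> by (intro powr_mono) auto
    also have "\<dots> = 2 * (1/2) ^ N" by (simp add: powr_diff powr_realpow power_divide)
    also have "\<dots> < d" using N by simp
    finally show ?thesis using d(2)[of "2 powr (of_int n + \<rho>)"] by simp
  qed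
  have it: "\<bar>drift \<rho> (- int N - int m)\<bar> \<le> B * (1/2) ^ m + e/2" if \<rho>: "\<rho> < 1" for m \<rho>
  proof (induction m)
    case 0 show ?case using drift_bound[OF B(2), of \<rho> "- int N"] assms by simp
  next
    case (Suc m)
    have "drift \<rho> (- int N - int (Suc m)) = (drift \<rho> (- int N - int m) + ln_theta (2 powr (of_int (- int N - int (Suc m)) + \<rho>))) / 2"
      using drift_recursion[of \<rho> "- int N - int (Suc m)"] by (simp add: algebra_simps)
    moreover have "\<bar>ln_theta (2 powr (of_int (- int N - int (Suc m)) + \<rho>))\<bar> \<le> e/2" by (rule small) (use \<rho> in auto)
    moreover have gen: "x = (y + z) / 2 \<Longrightarrow> \<bar>z\<bar> \<le> a \<Longrightarrow> \<bar>y\<bar> \<le> Y \<Longrightarrow> \<bar>x\<bar> \<le> (Y + a) / 2" for x y z a Y :: real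
      using abs_triangle_ineq[of y z] by simp
    ultimately have "\<bar>drift \<rho> (- int N - int (Suc m))\<bar> \<le> (B * (1/2) ^ m + e/2 + e/2) / 2"
      using Suc by (intro gen)
    then show ?case by simp
  qed
  show ?thesis
  proof (intro exI[of _ "- int N - int K"] allI impI)
    fix n \<rho> assume n: "n \<le> - int N - int K" and \<rho>: "\<rho> < (1::real)"
    define m where "m = nat (- int N - n)"
    have m: "n = - int N - int m" "K \<le> m" using n by (auto simp: m_def)
    have "B * (1/2) ^ m \<le> B * (1/2) ^ K" using m B by (intro mult_left_mono power_decreasing) auto
    also have "\<dots> \<le> e / 2" using K B by (simp add: field_simps)
    finally show "\<bar>drift \<rho> n\<bar> \<le> e" using it[OF \<rho>, of m] m by simp
  qed
qed

lemma a_coeff_pos: "0 < a_coeff k \<gamma> A \<rho> n"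
  by (simp add: a_coeff_def alpha_coeff_eq zeta_pos)

lemma alpha_coeff_Suc: "alpha_coeff k \<gamma> A \<rho> (n + 1) = vartheta k \<gamma> \<rho> n * (alpha_coeff k \<gamma> A \<rho> n)\<^sup>2"
proof -
  have v: "0 < vartheta k \<gamma> \<rho> n" using zeta_pos by (simp add: vartheta_def)
  have "drift \<rho> (n + 1) = 2 * drift \<rho> n - ln (vartheta k \<gamma> \<rho> n)"
    using drift_recursion[of \<rho> n] by (simp add: ln_vartheta)
  then have E: "- (A * 2 powr (of_int (n + 1))) - drift \<rho> (n + 1)
     = ln (vartheta k \<gamma> \<rho> n) + 2 * (- (A * 2 powr (of_int n)) - drift \<rho> n)"
    by (simp add: powr_add algebra_simps)
  show ?thesis unfolding alpha_coeff_eq E exp_add exp_double using v by simp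
qed

lemma a_coeff_Suc: "a_coeff k \<gamma> A \<rho> (n + 1) = zeta k \<gamma> \<rho> n * (a_coeff k \<gamma> A \<rho> n)\<^sup>2"
  unfolding a_coeff_def alpha_coeff_Suc vartheta_def
  using zeta_pos[of \<rho> n] zeta_pos[of \<rho> "n+1"] by (simp add: power2_eq_square)

lemma a_coeff_ratio: "a_coeff k \<gamma> A \<rho> (n + 1) / a_coeff k \<gamma> A \<rho> n = 2 * exp (- (A * 2 powr (of_int n)) - drift \<rho> n)"
  using zeta_pos[of \<rho> n] a_coeff_pos[of A \<rho> n] unfolding a_coeff_Suc
  by (simp add: a_coeff_def alpha_coeff_eq power2_eq_square)

lemma a_coeff_shift: "a_coeff k \<gamma> (A - y) \<rho> n = a_coeff k \<gamma> A \<rho> n * exp (2 powr (of_int n) * y)"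
  by (simp add: a_coeff_def alpha_coeff_eq exp_add[symmetric] algebra_simps)

definition mass_term :: "real \<Rightarrow> real \<Rightarrow> int \<Rightarrow> real" where
  "mass_term \<rho> A n = 2 powr (of_int n + \<rho>) * a_coeff k \<gamma> A \<rho> n"

lemma mass_term_pos: "0 < mass_term \<rho> A n"
  by (simp add: mass_term_def a_coeff_pos)

lemma mass_term_eq:
  fixes \<rho> :: real and n :: int
  defines "x \<equiv> (2::real) powr (of_int n + \<rho>)"
  shows "mass_term \<rho> A n = 2 / ln 2 * x\<^sup>2 * (\<gamma> (2 * x) / k x) * exp (- (A * 2 powr (of_int n)) - drift \<rho> n)"
proof -
  have e: "(2::real) powr (of_int n + \<rho> + 1) = 2 * x" by (simp add: x_def powr_add)
  have "0 < x" by (simp add: x_def)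
  then show ?thesis
    unfolding mass_term_def a_coeff_def alpha_coeff_eq zeta_def e x_def[symmetric]
    by (simp add: field_simps power2_eq_square)
qed

lemma mass_term_bounds:
  "\<exists>c>0. \<exists>C>0. \<forall>\<rho> n A. 0 \<le> \<rho> \<longrightarrow> \<rho> < 1 \<longrightarrow>
     mass_term \<rho> A n \<le> C * (2 powr (of_int n))\<^sup>2 * max 1 (2 powr (of_int n)) * exp (- (A * 2 powr (of_int n))) \<and>
     (0 \<le> n \<longrightarrow> c * 2 powr (of_int n) * exp (- (A * 2 powr (of_int n))) \<le> mass_term \<rho> A n)"
proof -
  obtain B where B: "0 < B" "\<And>\<xi>. 0 < \<xi> \<Longrightarrow> \<bar>ln_theta \<xi>\<bar> \<le> B" using ln_theta_bounded by blast
  obtain c0 C0 where c0: "0 < c0" "0 < C0"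
    and cC: "\<And>\<xi>. 0 < \<xi> \<Longrightarrow> c0 * max 1 \<xi> powr (\<beta> - \<alpha> - 1) \<le> \<gamma> (2 * \<xi>) / k \<xi>"
      "\<And>\<xi>. 0 < \<xi> \<Longrightarrow> \<gamma> (2 * \<xi>) / k \<xi> \<le> C0 * max 1 \<xi> powr (\<beta> - \<alpha> - 1)"
    using gamma_k_power_bounds by blast
  have l2: "0 < ln (2::real)" by simp
  show ?thesis
  proof (rule exI[of _ "2 / ln 2 * c0 * exp (- B)"], rule conjI, use c0 in simp,
      rule exI[of _ "16 / ln 2 * C0 * exp B"], rule conjI, use c0 in simp, intro allI impI conjI)
    fix \<rho> A :: real and n :: int assume \<rho>: "0 \<le> \<rho>" "\<rho> < 1"
    define u where "u = (2::real) powr (of_int n)"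
    define x where "x = (2::real) powr (of_int n + \<rho>)"
    have u: "0 < u" by (simp add: u_def)
    have x: "u \<le> x" "x \<le> 2 * u"
    proof -
      have "x = u * 2 powr \<rho>" by (simp add: x_def u_def powr_add)
      moreover have "1 \<le> (2::real) powr \<rho>" "2 powr \<rho> \<le> (2::real)" using \<rho> powr_mono[of \<rho> 1 "2::real"] by (auto intro: ge_one_powr_ge_zero)
      ultimately show "u \<le> x" "x \<le> 2 * u" using u by auto
    qed
    have xp: "0 < x" using u x by linarith
    have dr: "\<bar>drift \<rho> n\<bar> \<le> B" by (rule drift_bound[OF B(2)])
    have mt: "mass_term \<rho> A n = 2 / ln 2 * x\<^sup>2 * (\<gamma> (2 * x) / k x) * (exp (- (A * u)) * exp (- drift \<rho> n))"
      unfolding mass_term_eq x_def[symmetric] u_def[symmetric] by (simp add: exp_add[symmetric])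
    have p1: "max 1 x powr (\<beta> - \<alpha> - 1) \<le> 2 * max 1 u"
    proof -
      have "max 1 x powr (\<beta> - \<alpha> - 1) \<le> max 1 x powr 1" using alpha beta by (intro powr_mono) auto
      also have "\<dots> = max 1 x" by simp
      also have "\<dots> \<le> 2 * max 1 u" using x u by auto
      finally show ?thesis .
    qed
    have "\<gamma> (2 * x) / k x \<le> C0 * (2 * max 1 u)"
      using cC(2)[OF xp] mult_left_mono[OF p1, of C0] c0 by linarith
    moreover have "x\<^sup>2 \<le> (2 * u)\<^sup>2" using x xp by (intro power_mono) auto
    moreover have "exp (- drift \<rho> n) \<le> exp B" using dr by (simp add: abs_le_iff)
    moreover have "0 < \<gamma> (2 * x) / k x" using gamma_pos[of "2 * x"] k_pos[of x] xp by simp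
    ultimately have "mass_term \<rho> A n \<le> 2 / ln 2 * (2 * u)\<^sup>2 * (C0 * (2 * max 1 u)) * (exp (- (A * u)) * exp B)"
      unfolding mt using l2 c0 u by (intro mult_mono) auto
    also have "\<dots> = 16 / ln 2 * C0 * exp B * u\<^sup>2 * max 1 u * exp (- (A * u))"
      by (simp add: power2_eq_square)
    finally show "mass_term \<rho> A n \<le> 16 / ln 2 * C0 * exp B * (2 powr (of_int n))\<^sup>2 * max 1 (2 powr (of_int n)) * exp (- (A * 2 powr (of_int n)))"
      by (simp add: u_def)
    assume n: "0 \<le> n"
    have x1: "1 \<le> x" using n \<rho> by (auto simp: x_def intro: ge_one_powr_ge_zero)
    have "x powr (-1) \<le> x powr (\<beta> - \<alpha> - 1)" using alpha beta x1 by (intro powr_mono) auto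
    then have "c0 * x powr (-1) \<le> \<gamma> (2 * x) / k x"
      using cC(1)[OF xp] x1 c0 mult_left_mono[of "x powr (-1)" "x powr (\<beta> - \<alpha> - 1)" c0] by (simp add: max_def split: if_splits)
    moreover have "exp (- B) \<le> exp (- drift \<rho> n)" using dr by (simp add: abs_le_iff)
    moreover have "0 < \<gamma> (2 * x) / k x" using gamma_pos[of "2 * x"] k_pos[of x] xp by simp
    ultimately have "2 / ln 2 * x\<^sup>2 * (c0 * x powr (-1)) * (exp (- (A * u)) * exp (- B)) \<le> mass_term \<rho> A n"
      unfolding mt using l2 c0 xp by (intro mult_mono mult_nonneg_nonneg) auto
    moreover have "2 / ln 2 * x\<^sup>2 * (c0 * x powr (-1)) * (exp (- (A * u)) * exp (- B))
       = 2 / ln 2 * c0 * exp (- B) * x * exp (- (A * u))"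
    proof -
      have x0: "x\<^sup>2 * (c0 * x powr (-1)) = c0 * x" using xp by (simp add: powr_minus power2_eq_square field_simps)
      show ?thesis unfolding mult.assoc[of "2 / ln 2" "x\<^sup>2"] x0 by simp
    qed
    ultimately have "2 / ln 2 * c0 * exp (- B) * x * exp (- (A * u)) \<le> mass_term \<rho> A n" by (simp only:)
    moreover have "2 / ln 2 * c0 * exp (- B) * u * exp (- (A * u)) \<le> 2 / ln 2 * c0 * exp (- B) * x * exp (- (A * u))"
      using x l2 c0 by (intro mult_right_mono mult_left_mono) auto
    ultimately show "2 / ln 2 * c0 * exp (- B) * 2 powr (of_int n) * exp (- (A * 2 powr (of_int n))) \<le> mass_term \<rho> A n"
      by (simp add: u_def)
  qed
qed


lemma mass_term_decay:
  "\<exists>C>0. \<forall>\<rho> n A. 0 \<le> \<rho> \<longrightarrow> \<rho> < 1 \<longrightarrow> 0 < A \<longrightarrow> mass_term \<rho> A n \<le> C * (1 / A + 256 / A ^ 4) * 2 powr (- of_int \<bar>n\<bar>)"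
proof -
  obtain C where C: "0 < C" and b: "\<And>\<rho> n A. 0 \<le> \<rho> \<Longrightarrow> \<rho> < 1 \<Longrightarrow>
     mass_term \<rho> A n \<le> C * (2 powr (of_int n))\<^sup>2 * max 1 (2 powr (of_int n)) * exp (- (A * 2 powr (of_int n)))"
    using mass_term_bounds by blast
  have "mass_term \<rho> A n \<le> C * (1 / A + 256 / A ^ 4) * 2 powr (- of_int \<bar>n\<bar>)"
    if \<rho>: "0 \<le> \<rho>" "\<rho> < 1" and A: "0 < A" for \<rho> n A
  proof -
    define u where "u = (2::real) powr (of_int n)"
    have u: "0 < u" by (simp add: u_def)
    have m: "mass_term \<rho> A n \<le> C * u\<^sup>2 * max 1 u * exp (- (A * u))" using b[OF \<rho>] by (simp add: u_def)
    show ?thesis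
    proof (cases "0 \<le> n")
      case False
      then have u1: "u \<le> 1" using powr_mono[of "of_int n" 0 "2::real"] by (simp add: u_def)
      have "C * u\<^sup>2 * max 1 u * exp (- (A * u)) \<le> C * u\<^sup>2 * 1 * (1 / (A * u))"
        using u1 C u A exp_neg_bounds(1)[of "A * u"] by (intro mult_mono) auto
      also have "\<dots> = C * (1 / A) * u" using u A by (simp add: power2_eq_square)
      also have "\<dots> \<le> C * (1 / A + 256 / A ^ 4) * u" using C A u by (intro mult_right_mono mult_left_mono) auto
      finally have le: "mass_term \<rho> A n \<le> C * (1 / A + 256 / A ^ 4) * u" using m by linarith
      have "2 powr (- of_int \<bar>n\<bar>) = u" using False by (simp add: u_def)
      then show ?thesis using le by simp
    next
      case True
      then have u1: "1 \<le> u" by (auto simp: u_def intro: ge_one_powr_ge_zero)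
      have "C * u\<^sup>2 * max 1 u * exp (- (A * u)) \<le> C * u\<^sup>2 * u * (256 / (A * u) ^ 4)"
        using u1 C u A exp_neg_bounds(2)[of "A * u"] by (intro mult_mono) auto
      also have "\<dots> = C * (256 / A ^ 4) * (1 / u)" using u A
        by (simp add: power_mult_distrib field_simps power2_eq_square power4_eq_xxxx)
      also have "\<dots> \<le> C * (1 / A + 256 / A ^ 4) * (1 / u)" using C A u by (intro mult_right_mono mult_left_mono) auto
      finally have le: "mass_term \<rho> A n \<le> C * (1 / A + 256 / A ^ 4) * (1 / u)" using m by linarith
      have "2 powr (- of_int \<bar>n\<bar>) = 1 / u" using True by (simp add: u_def powr_minus inverse_eq_divide)
      then show ?thesis using le by (simp only:)
    qed
  qed
  then show ?thesis using C by blast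
qed

lemma mass_term_summable: "0 \<le> \<rho> \<Longrightarrow> \<rho> < 1 \<Longrightarrow> 0 < A \<Longrightarrow> mass_term \<rho> A summable_on UNIV"
proof -
  assume \<rho>: "0 \<le> \<rho>" "\<rho> < 1" and A: "0 < A"
  obtain C where C: "\<And>n. mass_term \<rho> A n \<le> C * (1 / A + 256 / A ^ 4) * 2 powr (- of_int \<bar>n\<bar>)"
    using mass_term_decay \<rho> A by metis
  show "mass_term \<rho> A summable_on UNIV"
    by (rule summable_on_comparison_test[OF summable_on_cmult_right[OF summable_two_powr_abs]])
       (use C mass_term_pos in \<open>auto intro: less_imp_le\<close>)
qed

definition total_mass :: "real \<Rightarrow> real \<Rightarrow> real" where "total_mass \<rho> A = infsum (mass_term \<rho> A) UNIV"

lemma has_mass_a_coeff: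
  assumes "0 \<le> \<rho>" "\<rho> < 1" "0 < A"
  shows "has_mass \<rho> (a_coeff k \<gamma> A \<rho>) M \<longleftrightarrow> total_mass \<rho> A = M"
proof -
  have "has_mass \<rho> (a_coeff k \<gamma> A \<rho>) M \<longleftrightarrow> (mass_term \<rho> A has_sum M) UNIV"
    by (simp add: has_mass_def mass_term_def[abs_def])
  also have "\<dots> \<longleftrightarrow> total_mass \<rho> A = M"
    using has_sum_infsum[OF mass_term_summable[OF assms]] infsumI[of "mass_term \<rho> A" UNIV M]
    by (auto simp: total_mass_def)
  finally show ?thesis .
qed

lemma mass_term_mono: "A < B \<Longrightarrow> mass_term \<rho> B n < mass_term \<rho> A n"
  using a_coeff_shift[of B "B - A" \<rho> n] a_coeff_pos[of B \<rho> n] by (simp add: mass_term_def)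

lemma total_mass_strict_mono:
  assumes "0 \<le> \<rho>" "\<rho> < 1" "0 < A" "A < B" shows "total_mass \<rho> B < total_mass \<rho> A"
proof -
  have "infsum (mass_term \<rho> B) UNIV < infsum (mass_term \<rho> A) UNIV"
  proof (rule has_sum_strict_mono)
    show "(mass_term \<rho> B has_sum infsum (mass_term \<rho> B) UNIV) UNIV" "(mass_term \<rho> A has_sum infsum (mass_term \<rho> A) UNIV) UNIV"
      using mass_term_summable assms by (auto intro!: has_sum_infsum)
    show "mass_term \<rho> B 0 < mass_term \<rho> A 0" by (rule mass_term_mono[OF assms(4)])
  qed (use mass_term_mono[OF assms(4)] in \<open>auto intro: less_imp_le\<close>)
  then show ?thesis by (simp add: total_mass_def)
qed

text \<open>
  A factor $2^n$ from differentiating in \<open>A\<close> is absorbed by half of the exponential decay.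
\<close>

lemma mass_term_lipschitz:
  assumes "0 < m" "m \<le> A" "m \<le> B"
  shows "\<bar>mass_term \<rho> A n - mass_term \<rho> B n\<bar> \<le> \<bar>A - B\<bar> * (2 / m) * mass_term \<rho> (m / 2) n"
proof -
  have key: "mass_term \<rho> A n - mass_term \<rho> B n \<le> (B - A) * (2 / m) * mass_term \<rho> (m / 2) n \<and> 0 \<le> mass_term \<rho> A n - mass_term \<rho> B n"
    if AB: "A \<le> B" "m \<le> A" for A B
  proof
    define u where "u = (2::real) powr (of_int n)"
    have u: "0 < u" by (simp add: u_def)
    define P where "P = 2 powr (of_int n + \<rho>) * a_coeff k \<gamma> m \<rho> n"
    have P: "0 < P" by (simp add: P_def a_coeff_pos)
    have sh: "mass_term \<rho> X n = P * exp (u * (m - X))" for X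
      using a_coeff_shift[of m "m - X" \<rho> n] by (simp add: mass_term_def P_def u_def)
    have "exp (u * (m - A)) * (1 - u * (B - A)) \<le> exp (u * (m - A)) * exp (- (u * (B - A)))"
      using exp_ge_add_one_self[of "- (u * (B - A))"] by (intro mult_left_mono) auto
    also have "\<dots> = exp (u * (m - B))" by (simp add: exp_add[symmetric] algebra_simps)
    finally have "exp (u * (m - A)) - exp (u * (m - B)) \<le> u * (B - A) * exp (u * (m - A))" by (simp add: algebra_simps)
    also have "\<dots> \<le> u * (B - A) * 1" using AB u by (intro mult_left_mono) (auto intro: mult_nonneg_nonpos)
    also have "\<dots> = (B - A) * (2 / m) * (u * (m / 2))" using assms(1) by simp
    also have "\<dots> \<le> (B - A) * (2 / m) * exp (u * (m / 2))"
    proof (rule mult_left_mono)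
      show "u * (m / 2) \<le> exp (u * (m / 2))" using exp_ge_add_one_self[of "u * (m / 2)"] by linarith
    qed (use AB assms(1) in auto)
    finally have "P * (exp (u * (m - A)) - exp (u * (m - B))) \<le> P * ((B - A) * (2 / m) * exp (u * (m / 2)))"
      using P by (intro mult_left_mono) auto
    then show "mass_term \<rho> A n - mass_term \<rho> B n \<le> (B - A) * (2 / m) * mass_term \<rho> (m / 2) n"
      unfolding sh by (simp add: algebra_simps)
    have "u * (m - B) \<le> u * (m - A)" using u AB by (intro mult_left_mono) auto
    then have "P * exp (u * (m - B)) \<le> P * exp (u * (m - A))" using P by (intro mult_left_mono) auto
    then show "0 \<le> mass_term \<rho> A n - mass_term \<rho> B n" unfolding sh by simp
  qed
  show ?thesis
  proof (cases "A \<le> B")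
    case True then show ?thesis using key[of A B] assms by simp
  next
    case False then show ?thesis using key[of B A] assms by simp
  qed
qed

lemma total_mass_lipschitz:
  assumes \<rho>: "0 \<le> \<rho>" "\<rho> < 1" and m: "0 < m" "m \<le> A" "m \<le> B"
  shows "\<bar>total_mass \<rho> A - total_mass \<rho> B\<bar> \<le> 2 / m * total_mass \<rho> (m / 2) * \<bar>A - B\<bar>"
proof -
  have s: "mass_term \<rho> X summable_on UNIV" if "0 < X" for X using mass_term_summable[OF \<rho> that] .
  have hs: "(mass_term \<rho> X has_sum total_mass \<rho> X) UNIV" if "0 < X" for X
    using s[OF that] by (simp add: total_mass_def)
  have "norm (total_mass \<rho> A + - total_mass \<rho> B) \<le> \<bar>A - B\<bar> * (2 / m) * total_mass \<rho> (m / 2)"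
  proof (rule norm_infsum_le)
    show "((\<lambda>n. mass_term \<rho> A n + - mass_term \<rho> B n) has_sum (total_mass \<rho> A + - total_mass \<rho> B)) UNIV"
      using m by (intro has_sum_add has_sum_uminusI hs) auto
    show "((\<lambda>n. \<bar>A - B\<bar> * (2 / m) * mass_term \<rho> (m / 2) n) has_sum \<bar>A - B\<bar> * (2 / m) * total_mass \<rho> (m / 2)) UNIV"
      using m by (intro has_sum_cmult_right hs) auto
  qed (use mass_term_lipschitz[OF m] in simp)
  then show ?thesis by (simp add: mult_ac)
qed

text \<open>
  Continuity and strict monotonicity of the mass in \<open>A\<close> give existence and uniqueness.  The bounds are uniform in
  $\rho$: a small \<open>A\<close> makes a single term of the mass exceed \<open>M\<close>, and a large \<open>A\<close> makes the dominating series smaller than \<open>M\<close>.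
\<close>

lemma A_of_mass_bounds:
  assumes "0 < M"
  shows "\<exists>Al Ah. 0 < Al \<and> (\<forall>\<rho>. 0 \<le> \<rho> \<longrightarrow> \<rho> < 1 \<longrightarrow>
     Al \<le> A_of_mass k \<gamma> \<rho> M \<and> A_of_mass k \<gamma> \<rho> M \<le> Ah \<and> total_mass \<rho> (A_of_mass k \<gamma> \<rho> M) = M)"
proof -
  obtain c where c: "0 < c" and low: "\<And>\<rho> n A. 0 \<le> \<rho> \<Longrightarrow> \<rho> < 1 \<Longrightarrow> 0 \<le> n \<Longrightarrow>
     c * 2 powr (of_int n) * exp (- (A * 2 powr (of_int n))) \<le> mass_term \<rho> A n"
    using mass_term_bounds by metis
  obtain C where C: "0 < C" and up: "\<And>\<rho> n A. 0 \<le> \<rho> \<Longrightarrow> \<rho> < 1 \<Longrightarrow> 0 < A \<Longrightarrow>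
     mass_term \<rho> A n \<le> C * (1 / A + 256 / A ^ 4) * 2 powr (- of_int \<bar>n\<bar>)"
    using mass_term_decay by metis
  define T where "T = infsum (\<lambda>n::int. (2::real) powr (- of_int \<bar>n\<bar>)) UNIV"
  have T0: "0 \<le> T" unfolding T_def by (intro infsum_nonneg) auto
  obtain N :: nat where N: "M * exp 1 / c < 2 ^ N" using real_arch_pow[of 2 "M * exp 1 / c"] by auto
  define Al where "Al = (1/2::real) ^ N"
  define Ah where "Ah = 1 + Al + 257 * C * T / M"
  have Al0: "0 < Al" by (simp add: Al_def)
  have Ah1: "1 \<le> Ah" "Al \<le> Ah" using C T0 assms Al0 by (auto simp: Ah_def)
  have lo: "M < total_mass \<rho> A" if \<rho>: "0 \<le> \<rho>" "\<rho> < 1" and A: "0 < A" "A \<le> Al" for \<rho> A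
  proof -
    have "A * 2 ^ N \<le> Al * 2 ^ N" using A by (intro mult_right_mono) auto
    also have "\<dots> = 1" by (simp add: Al_def power_one_over)
    finally have AN: "A * 2 ^ N \<le> 1" .
    have "M * exp 1 < c * 2 ^ N" using N c by (simp add: field_simps)
    then have "M < c * 2 ^ N * exp (- 1)" by (simp add: exp_minus field_simps)
    also have "\<dots> \<le> c * 2 ^ N * exp (- (A * 2 ^ N))" using AN c by (intro mult_left_mono) auto
    also have "\<dots> \<le> mass_term \<rho> A (int N)" using low[OF \<rho>, of "int N" A] by (simp add: powr_realpow)
    also have "\<dots> = infsum (mass_term \<rho> A) {int N}" by simp
    also have "\<dots> \<le> total_mass \<rho> A"
      unfolding total_mass_def using mass_term_summable[OF \<rho> A(1)] mass_term_pos
      by (intro infsum_mono2) (auto intro: less_imp_le)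
    finally show ?thesis .
  qed
  have hi: "total_mass \<rho> Ah \<le> M" if \<rho>: "0 \<le> \<rho>" "\<rho> < 1" for \<rho>
  proof -
    have "1 / Ah + 256 / Ah ^ 4 \<le> 257 / Ah"
    proof -
      have "Ah ^ 1 \<le> Ah ^ 4" using Ah1 by (intro power_increasing) auto
      then have "256 / Ah ^ 4 \<le> 256 / Ah" using Ah1 by (intro divide_left_mono) auto
      moreover have "1 / Ah + 256 / Ah = 257 / Ah" by (simp add: add_divide_distrib[symmetric])
      ultimately show ?thesis by linarith
    qed
    then have co: "C * (1 / Ah + 256 / Ah ^ 4) \<le> C * (257 / Ah)" using C by (intro mult_left_mono) auto
    have "total_mass \<rho> Ah \<le> infsum (\<lambda>n::int. C * (1 / Ah + 256 / Ah ^ 4) * (2::real) powr (- of_int \<bar>n\<bar>)) UNIV"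
      unfolding total_mass_def using mass_term_summable[OF \<rho>, of Ah] up[OF \<rho>, of Ah] Ah1
      by (intro infsum_mono summable_on_cmult_right summable_two_powr_abs) auto
    also have "\<dots> = C * (1 / Ah + 256 / Ah ^ 4) * T" by (simp add: T_def infsum_cmult_right')
    also have "\<dots> \<le> C * (257 / Ah) * T" using co T0 by (intro mult_right_mono) auto
    also have "\<dots> \<le> M"
    proof -
      have "257 * C * T / M \<le> Ah" using Al0 by (simp add: Ah_def)
      then have "257 * C * T \<le> M * Ah" using assms by (simp add: field_simps)
      then show ?thesis using Ah1 by (simp add: field_simps)
    qed
    finally show ?thesis .
  qed
  have "Al \<le> A_of_mass k \<gamma> \<rho> M \<and> A_of_mass k \<gamma> \<rho> M \<le> Ah \<and> total_mass \<rho> (A_of_mass k \<gamma> \<rho> M) = M"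
    if \<rho>: "0 \<le> \<rho>" "\<rho> < 1" for \<rho>
  proof -
    define L where "L = 2 / Al * total_mass \<rho> (Al / 2)"
    have L0: "0 \<le> L" unfolding L_def total_mass_def using Al0 mass_term_pos
      by (intro mult_nonneg_nonneg infsum_nonneg) (auto intro: less_imp_le)
    have "continuous_on {Al..Ah} (total_mass \<rho>)"
      by (rule lipschitz_on_continuous_on[of L])
         (use total_mass_lipschitz[OF \<rho> Al0] L0 in \<open>auto simp: lipschitz_on_def dist_real_def L_def\<close>)
    then obtain A where A: "Al \<le> A" "A \<le> Ah" "total_mass \<rho> A = M"
      using IVT2'[of "total_mass \<rho>" Ah M Al] hi[OF \<rho>] lo[OF \<rho> Al0 order_refl] Ah1 by auto
    have "A_of_mass k \<gamma> \<rho> M = A"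
      unfolding A_of_mass_def
    proof (rule the_equality)
      show "0 < A \<and> has_mass \<rho> (a_coeff k \<gamma> A \<rho>) M" using A Al0 has_mass_a_coeff[OF \<rho>, of A M] by auto
      fix B assume B: "0 < B \<and> has_mass \<rho> (a_coeff k \<gamma> B \<rho>) M"
      then have "total_mass \<rho> B = total_mass \<rho> A" using A has_mass_a_coeff[OF \<rho>, of B M] by auto
      then show "B = A" using total_mass_strict_mono[OF \<rho>, of A B] total_mass_strict_mono[OF \<rho>, of B A] A Al0 B
        by (cases A B rule: linorder_cases) auto
    qed
    then show ?thesis using A by simp
  qed
  then show ?thesis using Al0 by blast
qed

end

section \<open>Mass conservation\<close>

lemma sum_telescope_int:
  fixes f :: "int \<Rightarrow> real"
  shows "(\<Sum>n = - int m..int m. f n - f (n + 1)) = f (- int m) - f (int m + 1)"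
proof (induction m)
  case (Suc m)
  have "{- int (Suc m)..int (Suc m)} = insert (- int (Suc m)) (insert (int (Suc m)) {- int m..int m})" by auto
  then have "(\<Sum>n = - int (Suc m)..int (Suc m). f n - f (n + 1))
     = (f (- int (Suc m)) - f (- int (Suc m) + 1)) + ((f (int (Suc m)) - f (int (Suc m) + 1)) + (\<Sum>n = - int m..int m. f n - f (n + 1)))"
    by simp
  moreover have "- int (Suc m) + 1 = - int m" "int (Suc m) = int m + 1" by simp_all
  ultimately show ?case using Suc by (simp add: add.commute)
qed simp

lemma symmetric_intervals_exhaust: "filterlim (\<lambda>m. {- int m..int m}) (finite_subsets_at_top UNIV) sequentially"
proof (rule filterlim_finite_subsets_at_top[THEN iffD2], intro allI impI)
  fix X :: "int set" assume "finite X \<and> X \<subseteq> UNIV"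
  then obtain B where B: "\<And>x. x \<in> X \<Longrightarrow> \<bar>x\<bar> \<le> B"
    using finite_imageI[of X abs] by (metis Max_ge finite_imageI image_eqI)
  show "\<forall>\<^sub>F m in sequentially. finite {- int m..int m} \<and> X \<subseteq> {- int m..int m} \<and> {- int m..int m} \<subseteq> UNIV"
    using eventually_ge_at_top[of "nat B"]
  proof eventually_elim
    case (elim m)
    have "x \<in> {- int m..int m}" if "x \<in> X" for x using B[OF that] elim by auto
    then show ?case by auto
  qed
qed

context coag_frag_kernels
begin

definition frag_rate :: "real \<Rightarrow> int \<Rightarrow> real" where "frag_rate \<rho> n = \<gamma> (2 powr (of_int n + \<rho>)) / 4"

lemma frag_rate_pos: "0 < frag_rate \<rho> n"
  using gamma_pos by (simp add: frag_rate_def)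

lemma coeff_rhs_eq: "coeff_rhs k \<gamma> \<rho> b n = net_flux (frag_rate \<rho>) (zeta k \<gamma> \<rho>) b n"
proof -
  have "of_int (n + 1) + \<rho> = of_int n + 1 + \<rho>" by simp
  then show ?thesis by (simp add: coeff_rhs_def net_flux_def frag_rate_def)
qed

lemma two_powr_shift_bounds:
  fixes \<rho> :: real assumes "0 \<le> \<rho>" "\<rho> < 1"
  shows "2 powr (of_int n) \<le> 2 powr (of_int n + \<rho>)" "2 powr (of_int n + \<rho>) \<le> 2 * 2 powr (of_int n)"
proof -
  have "(2::real) powr (of_int n + \<rho>) \<le> 2 powr (of_int n + 1)" using assms by (intro powr_mono) auto
  then show "2 powr (of_int n + \<rho>) \<le> 2 * 2 powr (of_int n)" by (simp add: powr_add)
qed (use assms in auto)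

lemma frag_rate_left: "\<exists>n1. \<forall>n\<le>n1. \<forall>\<rho>. 0 \<le> \<rho> \<longrightarrow> \<rho> < 1 \<longrightarrow> \<bar>frag_rate \<rho> n - \<gamma>0 / 4\<bar> \<le> \<gamma>0 / 4 / 50"
proof -
  have "eventually (\<lambda>\<xi>. dist (\<gamma> \<xi>) \<gamma>0 < \<gamma>0 / 50) (at_right 0)"
    using tendstoD[OF gamma_lim_0, of "\<gamma>0 / 50"] gamma0_pos by simp
  then obtain d where d: "0 < d" "\<And>\<xi>. 0 < \<xi> \<Longrightarrow> \<xi> < d \<Longrightarrow> \<bar>\<gamma> \<xi> - \<gamma>0\<bar> < \<gamma>0 / 50"
    by (auto simp: eventually_at_right_field dist_real_def)
  obtain N :: nat where N: "(1/2) ^ N < d / 2" using real_arch_pow_inv[of "d/2" "1/2"] d by auto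
  show ?thesis
  proof (intro exI[of _ "- int N"] allI impI)
    fix n :: int and \<rho> :: real assume n: "n \<le> - int N" and \<rho>: "0 \<le> \<rho>" "\<rho> < 1"
    have "(2::real) powr (of_int n) \<le> 2 powr (- real N)" using n by (intro powr_mono) auto
    also have "\<dots> = (1/2) ^ N" by (simp add: powr_minus powr_realpow power_divide inverse_eq_divide)
    finally have "2 powr (of_int n + \<rho>) < d" using two_powr_shift_bounds(2)[OF \<rho>, of n] N by linarith
    then show "\<bar>frag_rate \<rho> n - \<gamma>0 / 4\<bar> \<le> \<gamma>0 / 4 / 50"
    proof -
      assume lt: "2 powr (of_int n + \<rho>) < d"
      have "frag_rate \<rho> n - \<gamma>0 / 4 = (\<gamma> (2 powr (of_int n + \<rho>)) - \<gamma>0) / 4" by (simp add: frag_rate_def diff_divide_distrib)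
      then have "\<bar>frag_rate \<rho> n - \<gamma>0 / 4\<bar> = \<bar>\<gamma> (2 powr (of_int n + \<rho>)) - \<gamma>0\<bar> / 4" by (simp only: abs_divide abs_numeral)
      moreover have "\<bar>\<gamma> (2 powr (of_int n + \<rho>)) - \<gamma>0\<bar> < \<gamma>0 / 50" using d(2)[OF _ lt] by simp
      ultimately show ?thesis by simp
    qed
  qed
qed

lemma frag_rate_power:
  "\<exists>c>0. \<exists>C>0. \<forall>n \<rho>. n0 \<le> n \<longrightarrow> 0 \<le> \<rho> \<longrightarrow> \<rho> < 1 \<longrightarrow>
     c * 2 powr (\<beta> * of_int n) \<le> frag_rate \<rho> n \<and> frag_rate \<rho> n \<le> C * 2 powr (\<beta> * of_int n)"
proof -
  obtain c C where c: "0 < c" "0 < C" and cC: "\<And>\<xi>. 0 < \<xi> \<Longrightarrow> c * max 1 \<xi> powr \<beta> \<le> \<gamma> \<xi> \<and> \<gamma> \<xi> \<le> C * max 1 \<xi> powr \<beta>"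
    using gamma_power_bounds by blast
  define Y where "Y = max 2 ((2::real) powr (- of_int n0))"
  have b: "c / 4 * 2 powr (\<beta> * of_int n) \<le> frag_rate \<rho> n \<and> frag_rate \<rho> n \<le> C / 4 * Y powr \<beta> * 2 powr (\<beta> * of_int n)"
    if n: "n0 \<le> n" and \<rho>: "0 \<le> \<rho>" "\<rho> < 1" for n \<rho>
  proof -
    define u where "u = (2::real) powr (of_int n)"
    define x where "x = (2::real) powr (of_int n + \<rho>)"
    have u: "0 < u" by (simp add: u_def)
    have x: "u \<le> x" "x \<le> 2 * u" using two_powr_shift_bounds[OF \<rho>, of n] by (auto simp: u_def x_def)
    have up: "u powr \<beta> = 2 powr (\<beta> * of_int n)" by (simp add: u_def powr_powr mult.commute)
    have lo: "u powr \<beta> \<le> max 1 x powr \<beta>" using x u beta by (intro powr_mono2) auto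
    have "2 powr (of_int n0) \<le> u" unfolding u_def using n by (intro powr_mono) auto
    then have "2 powr (- of_int n0) * 2 powr (of_int n0) \<le> 2 powr (- of_int n0) * u" by (intro mult_left_mono) auto
    then have "1 \<le> 2 powr (- of_int n0) * u" using two_powr_inverse[of n0] by (simp add: mult.commute)
    also have "\<dots> \<le> Y * u" using u by (intro mult_right_mono) (auto simp: Y_def)
    finally have "1 \<le> Y * u" .
    moreover have "2 * u \<le> Y * u" using u by (intro mult_right_mono) (auto simp: Y_def)
    ultimately have "max 1 x \<le> Y * u" using x by auto
    then have "max 1 x powr \<beta> \<le> (Y * u) powr \<beta>" using beta by (intro powr_mono2) auto
    also have "\<dots> = Y powr \<beta> * u powr \<beta>" using u by (simp add: powr_mult Y_def)
    finally have hi: "max 1 x powr \<beta> \<le> Y powr \<beta> * u powr \<beta>" .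
    have g: "c * max 1 x powr \<beta> \<le> \<gamma> x \<and> \<gamma> x \<le> C * max 1 x powr \<beta>" by (rule cC) (simp add: x_def)
    have "c * u powr \<beta> \<le> \<gamma> x" using g mult_left_mono[OF lo, of c] c by linarith
    moreover have "\<gamma> x \<le> C * (Y powr \<beta> * u powr \<beta>)" using g mult_left_mono[OF hi, of C] c by linarith
    ultimately show ?thesis by (simp add: frag_rate_def x_def[symmetric] up)
  qed
  have "0 < C / 4 * Y powr \<beta>" using c by (simp add: Y_def)
  moreover have "0 < c / 4" using c by simp
  ultimately show ?thesis using b by blast
qed

text \<open>
  The limit of the quotient is $2^{-\beta} < 1/2$.
\<close>

lemma frag_rate_growth: "\<exists>N. \<forall>n\<ge>N. \<forall>\<rho>. 0 \<le> \<rho> \<longrightarrow> frag_rate \<rho> (n - 1) \<le> 3/5 * frag_rate \<rho> n"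
proof -
  have l: "((\<lambda>\<xi>. (\<gamma> (1 * \<xi>) / \<xi> powr \<beta>) / (\<gamma> (2 * \<xi>) / \<xi> powr \<beta>)) \<longlongrightarrow> 1 powr \<beta> / 2 powr \<beta>) at_top"
    by (intro tendsto_intros scaled_limits) auto
  have "1 powr \<beta> / 2 powr \<beta> < (3/5::real)"
    using two_powr_bounds(1)[OF beta] by (simp add: field_simps)
  from eventually_conj[OF order_tendstoD(2)[OF l this] eventually_gt_at_top[of 0]]
  obtain X where X: "\<And>\<xi>. X \<le> \<xi> \<Longrightarrow> (\<gamma> (1 * \<xi>) / \<xi> powr \<beta>) / (\<gamma> (2 * \<xi>) / \<xi> powr \<beta>) < 3/5 \<and> 0 < \<xi>"
    by (auto simp: eventually_at_top_linorder)
  obtain N :: nat where N: "X < 2 ^ N" using real_arch_pow[of 2 X] by auto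
  show ?thesis
  proof (intro exI[of _ "int N + 1"] allI impI)
    fix n :: int and \<rho> :: real assume n: "int N + 1 \<le> n" and \<rho>: "0 \<le> \<rho>"
    define \<xi> where "\<xi> = (2::real) powr (of_int (n - 1) + \<rho>)"
    have "(2::real) ^ N = 2 powr (real N)" by (simp add: powr_realpow)
    also have "\<dots> \<le> \<xi>" unfolding \<xi>_def using n \<rho> by (intro powr_mono) auto
    finally have "X \<le> \<xi>" using N by linarith
    then have "(\<gamma> (1 * \<xi>) / \<xi> powr \<beta>) / (\<gamma> (2 * \<xi>) / \<xi> powr \<beta>) < 3/5" using X by blast
    moreover have "0 < \<gamma> (2 * \<xi>)" using gamma_pos by (simp add: \<xi>_def)
    moreover have "(\<gamma> (1 * \<xi>) / \<xi> powr \<beta>) / (\<gamma> (2 * \<xi>) / \<xi> powr \<beta>) = \<gamma> \<xi> / \<gamma> (2 * \<xi>)"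
      by (simp add: \<xi>_def)
    ultimately have "\<gamma> \<xi> / \<gamma> (2 * \<xi>) < 3/5" "0 < \<gamma> (2 * \<xi>)" by simp_all
    then have "\<gamma> \<xi> \<le> 3/5 * \<gamma> (2 * \<xi>)" by (simp add: field_simps)
    moreover have "2 * \<xi> = 2 powr (of_int n + \<rho>)"
      using powr_add[of "2::real" 1 "of_int (n - 1) + \<rho>"] by (simp add: \<xi>_def)
    ultimately show "frag_rate \<rho> (n - 1) \<le> 3/5 * frag_rate \<rho> n" by (simp add: frag_rate_def \<xi>_def)
  qed
qed

text \<open>
  This bounds the mass flux through the level \<open>n\<close>.
\<close>

lemma flux_weight_decay:
  assumes \<rho>: "0 \<le> \<rho>" "\<rho> < 1" and A: "0 < A"
  shows "\<exists>Q\<ge>0. \<forall>n. frag_rate \<rho> n * mass_term \<rho> A n \<le> Q * 2 powr (- of_int \<bar>n\<bar>)"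
proof -
  obtain C where C: "0 < C" and g: "\<And>\<xi>. 0 < \<xi> \<Longrightarrow> \<gamma> \<xi> \<le> C * max 1 \<xi> powr \<beta>"
    using gamma_power_bounds by blast
  obtain C' where C': "0 < C'" and dec: "\<And>n. mass_term \<rho> (A / 2) n \<le> C' * (1 / (A / 2) + 256 / (A / 2) ^ 4) * 2 powr (- of_int \<bar>n\<bar>)"
    using mass_term_decay \<rho> A by (metis half_gt_zero)
  define E where "E = 1 + 256 / (A / 2) ^ 4"
  have E0: "0 \<le> E" using A by (simp add: E_def)
  have main: "frag_rate \<rho> n * mass_term \<rho> A n \<le> C * E * mass_term \<rho> (A / 2) n" for n
  proof -
    define u where "u = (2::real) powr (of_int n)"
    define x where "x = (2::real) powr (of_int n + \<rho>)"
    have u: "0 < u" by (simp add: u_def)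
    have x: "u \<le> x" "x \<le> 2 * u" using two_powr_shift_bounds[OF \<rho>, of n] by (auto simp: u_def x_def)
    have "max 1 x powr \<beta> \<le> max 1 x powr 2" using beta by (intro powr_mono) auto
    also have "\<dots> = (max 1 x)\<^sup>2" by (simp add: powr_numeral)
    also have "\<dots> \<le> (2 * max 1 u)\<^sup>2" using x u by (intro power_mono) auto
    finally have p: "max 1 x powr \<beta> \<le> 4 * (max 1 u)\<^sup>2" by (simp add: power_mult_distrib)
    have "\<gamma> x \<le> C * (4 * (max 1 u)\<^sup>2)" using g[of x] mult_left_mono[OF p, of C] C x u by linarith
    then have f: "frag_rate \<rho> n \<le> C * (max 1 u)\<^sup>2" by (simp add: frag_rate_def x_def)
    have e: "(max 1 u)\<^sup>2 * exp (- (A / 2 * u)) \<le> E"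
    proof (cases "u \<le> 1")
      case True
      then have "(max 1 u)\<^sup>2 * exp (- (A / 2 * u)) \<le> 1" using A u by simp
      then show ?thesis using A by (simp add: E_def add_increasing2)
    next
      case False
      have "(max 1 u)\<^sup>2 * exp (- (A / 2 * u)) \<le> u\<^sup>2 * (256 / (A / 2 * u) ^ 4)"
        using False exp_neg_bounds(2)[of "A / 2 * u"] A u by (intro mult_mono) auto
      also have "\<dots> = 256 / (A / 2) ^ 4 * (1 / u\<^sup>2)" using u A by (simp add: power_mult_distrib field_simps power2_eq_square power4_eq_xxxx)
      also have "\<dots> \<le> 256 / (A / 2) ^ 4 * 1" using False A by (intro mult_left_mono) auto
      finally show ?thesis by (simp add: E_def)
    qed
    have "mass_term \<rho> A n = mass_term \<rho> (A / 2) n * exp (- (A / 2 * u))"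
      using a_coeff_shift[of "A / 2" "- (A / 2)" \<rho> n] by (simp add: mass_term_def u_def mult_ac)
    then have "frag_rate \<rho> n * mass_term \<rho> A n \<le> C * (max 1 u)\<^sup>2 * (mass_term \<rho> (A / 2) n * exp (- (A / 2 * u)))"
      using f mass_term_pos[of \<rho> "A/2" n] by (simp add: mult_right_mono)
    also have "\<dots> = C * mass_term \<rho> (A / 2) n * ((max 1 u)\<^sup>2 * exp (- (A / 2 * u)))" by simp
    also have "\<dots> \<le> C * mass_term \<rho> (A / 2) n * E" using e C mass_term_pos[of \<rho> "A/2" n] by (intro mult_left_mono) auto
    finally show ?thesis by (simp add: mult_ac)
  qed
  define Q where "Q = C * E * (C' * (1 / (A / 2) + 256 / (A / 2) ^ 4))"
  have "frag_rate \<rho> n * mass_term \<rho> A n \<le> Q * 2 powr (- of_int \<bar>n\<bar>)" for n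
  proof -
    have "C * E * mass_term \<rho> (A / 2) n \<le> C * E * (C' * (1 / (A / 2) + 256 / (A / 2) ^ 4) * 2 powr (- of_int \<bar>n\<bar>))"
      using dec[of n] C E0 by (intro mult_left_mono) auto
    then show ?thesis using main[of n] by (simp add: Q_def mult_ac)
  qed
  moreover have "0 \<le> Q" using C C' E0 A by (simp add: Q_def)
  ultimately show ?thesis by blast
qed

text \<open>
  The mass between the levels \<open>-m\<close> and \<open>m\<close> changes only by the fluxes through these two levels, which are
  of order $2^{-m}$ uniformly in time.
\<close>

lemma mass_conserved:
  assumes \<rho>: "0 \<le> \<rho>" "\<rho> < 1" and A: "0 < A"
    and pos: "\<And>t n. 0 \<le> t \<Longrightarrow> 0 < b t n"
    and der: "\<And>t n. 0 \<le> t \<Longrightarrow> ((\<lambda>s. b s n) has_real_derivative net_flux (frag_rate \<rho>) (zeta k \<gamma> \<rho>) (b t) n) (at t within {0..})"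
    and dom: "\<And>t n. 0 \<le> t \<Longrightarrow> 2 powr (of_int n + \<rho>) * b t n \<le> 2 * mass_term \<rho> A n"
    and quo: "\<And>t n. 0 \<le> t \<Longrightarrow> \<bar>1 - zeta k \<gamma> \<rho> (n - 1) * (b t (n - 1))\<^sup>2 / b t n\<bar> \<le> 1"
    and init: "has_mass \<rho> (b 0) M" and t: "0 \<le> t"
  shows "has_mass \<rho> (b t) M"
proof -
  obtain Q where Q: "0 \<le> Q" "\<And>n. frag_rate \<rho> n * mass_term \<rho> A n \<le> Q * 2 powr (- of_int \<bar>n\<bar>)"
    using flux_weight_decay[OF \<rho> A] by blast
  define J where "J = (\<lambda>s n. 2 powr (of_int n + \<rho>) * (frag_rate \<rho> n * (zeta k \<gamma> \<rho> (n - 1) * (b s (n - 1))\<^sup>2 - b s n)))"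
  define P where "P = (\<lambda>m s. \<Sum>n = - int m..int m. 2 powr (of_int n + \<rho>) * b s n)"
  have Jb: "\<bar>J s n\<bar> \<le> 2 * Q * 2 powr (- of_int \<bar>n\<bar>)" if s: "0 \<le> s" for s n
  proof -
    have bp: "0 < b s n" by (rule pos[OF s])
    have "zeta k \<gamma> \<rho> (n - 1) * (b s (n - 1))\<^sup>2 - b s n = - ((1 - zeta k \<gamma> \<rho> (n - 1) * (b s (n - 1))\<^sup>2 / b s n) * b s n)"
      using bp by (simp add: field_simps)
    then have "\<bar>zeta k \<gamma> \<rho> (n - 1) * (b s (n - 1))\<^sup>2 - b s n\<bar> = \<bar>1 - zeta k \<gamma> \<rho> (n - 1) * (b s (n - 1))\<^sup>2 / b s n\<bar> * b s n"
      using bp by (simp only: abs_minus_cancel abs_mult abs_of_pos)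
    also have "\<dots> \<le> 1 * b s n" using quo[OF s, of n] bp by (intro mult_right_mono) auto
    finally have q: "\<bar>zeta k \<gamma> \<rho> (n - 1) * (b s (n - 1))\<^sup>2 - b s n\<bar> \<le> b s n" by simp
    have "\<bar>J s n\<bar> = frag_rate \<rho> n * (2 powr (of_int n + \<rho>) * \<bar>zeta k \<gamma> \<rho> (n - 1) * (b s (n - 1))\<^sup>2 - b s n\<bar>)"
      using frag_rate_pos[of \<rho> n] by (simp add: J_def abs_mult)
    also have "\<dots> \<le> frag_rate \<rho> n * (2 powr (of_int n + \<rho>) * b s n)"
      using q frag_rate_pos[of \<rho> n] by (intro mult_left_mono) auto
    also have "\<dots> \<le> frag_rate \<rho> n * (2 * mass_term \<rho> A n)"
      using dom[OF s, of n] frag_rate_pos[of \<rho> n] by (intro mult_left_mono) auto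
    also have "\<dots> \<le> 2 * Q * 2 powr (- of_int \<bar>n\<bar>)" using Q(2)[of n] by simp
    finally show ?thesis .
  qed
  have dP: "(P m has_real_derivative (J s (- int m) - J s (int m + 1))) (at s within {0..})" if s: "0 \<le> s" for m s
  proof -
    have J1: "2 powr (of_int n + \<rho>) * net_flux (frag_rate \<rho>) (zeta k \<gamma> \<rho>) (b s) n = J s n - J s (n + 1)" for n
      by (simp add: J_def net_flux_def powr_add algebra_simps)
    have "(P m has_real_derivative (\<Sum>n = - int m..int m. 2 powr (of_int n + \<rho>) * net_flux (frag_rate \<rho>) (zeta k \<gamma> \<rho>) (b s) n)) (at s within {0..})"
      unfolding P_def by (intro DERIV_sum DERIV_cmult der s)
    then show ?thesis unfolding J1 sum_telescope_int .
  qed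
  have diff: "\<bar>P m t - P m 0\<bar> \<le> 4 * Q * (1/2) ^ m * t" for m
  proof -
    have "\<bar>J s (- int m) - J s (int m + 1)\<bar> \<le> 4 * Q * (1/2) ^ m" if s: "0 \<le> s" for s
    proof -
      have e: "(2::real) powr (- of_int \<bar>- int m\<bar>) = (1/2) ^ m"
        by (simp add: powr_minus powr_realpow power_divide inverse_eq_divide)
      have "(2::real) powr (- of_int \<bar>int m + 1\<bar>) \<le> 2 powr (- of_int \<bar>- int m\<bar>)" by (intro powr_mono) auto
      then have e2: "2 * Q * 2 powr (- of_int \<bar>int m + 1\<bar>) \<le> 2 * Q * (1/2) ^ m"
        using Q(1) unfolding e by (intro mult_left_mono) auto
      show ?thesis using Jb[OF s, of "- int m"] Jb[OF s, of "int m + 1"] e2 unfolding e by linarith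
    qed
    then have "norm (P m t - P m 0) \<le> 4 * Q * (1/2) ^ m * norm (t - 0)"
      using field_differentiable_bound[of "{0..}" "P m" "\<lambda>s. J s (- int m) - J s (int m + 1)" "4 * Q * (1/2) ^ m" t 0] dP t
      by auto
    then show ?thesis using t by simp
  qed
  have lim: "(\<lambda>m. P m s) \<longlonglongrightarrow> X" if "has_mass \<rho> (b s) X" for s X
    using that symmetric_intervals_exhaust unfolding has_mass_def has_sum_def P_def by (rule filterlim_compose)
  have "(\<lambda>n. 2 powr (of_int n + \<rho>) * b t n) summable_on UNIV"
  proof (rule summable_on_comparison_test[OF summable_on_cmult_right[OF mass_term_summable[OF \<rho> A]]])
    show "\<And>n. n \<in> UNIV \<Longrightarrow> 2 powr (of_int n + \<rho>) * b t n \<le> 2 * mass_term \<rho> A n" using dom[OF t] by simp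
    show "\<And>n. n \<in> UNIV \<Longrightarrow> 0 \<le> 2 powr (of_int n + \<rho>) * b t n" using pos[OF t] by (simp add: less_imp_le)
  qed
  then obtain X where X: "has_mass \<rho> (b t) X" by (auto simp: has_mass_def summable_on_def)
  have "(\<lambda>m. 4 * Q * (1/2) ^ m * t) \<longlonglongrightarrow> 4 * Q * 0 * t" by (intro tendsto_intros LIMSEQ_power_zero) auto
  then have "(\<lambda>m. P m t - P m 0) \<longlonglongrightarrow> 0"
    by (intro Lim_null_comparison[of "\<lambda>m. P m t - P m 0"]) (use diff in auto)
  moreover have "(\<lambda>m. P m t - P m 0) \<longlonglongrightarrow> X - M" by (intro tendsto_intros lim X init)
  ultimately have "X = M" using LIMSEQ_unique by fastforce
  then show ?thesis using X by simp
qed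

end

section \<open>Stability of stationary states\<close>

lemma eventually_small_multiple:
  fixes x y :: real assumes "0 < y" shows "\<forall>\<^sub>F \<mu> in at_right 0. \<mu> * x \<le> y"
proof -
  have "((\<lambda>\<mu>. \<mu> * x) \<longlongrightarrow> 0 * x) (at_right 0)" by (intro tendsto_intros)
  then have "\<forall>\<^sub>F \<mu> in at_right 0. \<mu> * x < y" using assms by (intro order_tendstoD(2)) auto
  then show ?thesis by eventually_elim simp
qed

lemma one_minus_exp_powr_le:
  fixes t \<theta> :: real assumes t: "0 < t" and \<theta>: "0 < \<theta>" "\<theta> < 1"
  shows "(1 - exp (- t)) powr (- \<theta>) \<le> 2 * (1 + t powr (- \<theta>))"
proof -
  have e: "1 / exp t \<le> 1 / (1 + t)" using exp_ge_add_one_self[of t] t by (intro divide_left_mono) auto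
  have h: "(1/2::real) powr (- \<theta>) \<le> 2"
  proof -
    have "(1/2::real) powr (- \<theta>) = 2 powr \<theta>" by (simp add: powr_minus powr_divide inverse_eq_divide)
    also have "\<dots> \<le> 2 powr 1" using \<theta> by (intro powr_mono) auto
    finally show ?thesis by simp
  qed
  show ?thesis
  proof (cases "t \<le> 1")
    case True
    have "1 / (1 + t) \<le> 1 - 1/2 * t"
    proof -
      have "t * t \<le> t * 1" using t True by (intro mult_left_mono) auto
      then show ?thesis using t by (simp add: field_simps)
    qed
    then have "1/2 * t \<le> 1 - exp (- t)" using e by (simp add: exp_minus inverse_eq_divide)
    then have "(1 - exp (- t)) powr (- \<theta>) \<le> (1/2 * t) powr (- \<theta>)" using t \<theta> by (intro powr_mono2') auto
    also have "\<dots> = (1/2) powr (- \<theta>) * t powr (- \<theta>)" using t by (intro powr_mult)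
    also have "\<dots> \<le> 2 * t powr (- \<theta>)" using h by (intro mult_right_mono) auto
    finally show ?thesis by simp
  next
    case False
    have "1 / (1 + t) \<le> 1/2" using False by (simp add: field_simps)
    then have "1/2 \<le> 1 - 1 / exp t" using e by linarith
    then have "1/2 \<le> 1 - exp (- t)" by (simp add: exp_minus inverse_eq_divide)
    then have "(1 - exp (- t)) powr (- \<theta>) \<le> (1/2) powr (- \<theta>)" using \<theta> by (intro powr_mono2') auto
    also have "\<dots> \<le> 2" by (rule h)
    also have "\<dots> \<le> 2 * (1 + t powr (- \<theta>))" by simp
    finally show ?thesis .
  qed
qed

context coag_frag_kernels
begin

lemma ratio_near_two:
  assumes x: "\<bar>A * 2 powr (of_int n)\<bar> \<le> 1/200" and d: "\<bar>drift \<rho> n\<bar> \<le> 1/200"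
  shows "\<bar>a_coeff k \<gamma> A \<rho> (n + 1) / a_coeff k \<gamma> A \<rho> n - 2\<bar> \<le> 1/25"
proof -
  have "\<bar>- (A * 2 powr (of_int n)) - drift \<rho> n\<bar> \<le> 1/100" using x d by linarith
  then have "\<bar>exp (- (A * 2 powr (of_int n)) - drift \<rho> n) - 1\<bar> \<le> 2 * (1/100)" by (rule exp_bounds_small) simp
  then show ?thesis unfolding a_coeff_ratio by linarith
qed

lemma uniform_coefficients:
  assumes M: "0 < M"
  obtains n0 N1 :: int and c1 C1 R \<kappa> :: real
  where "n0 < N1" "n0 \<le> 0" "0 \<le> N1" "0 < c1" "0 < C1" "0 < R" "0 < \<kappa>"
    and "\<And>\<rho>. 0 \<le> \<rho> \<Longrightarrow> \<rho> < 1 \<Longrightarrow> 4 * \<kappa> \<le> A_of_mass k \<gamma> \<rho> M \<and> total_mass \<rho> (A_of_mass k \<gamma> \<rho> M) = M"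
    and "\<And>\<rho>. 0 \<le> \<rho> \<Longrightarrow> \<rho> < 1 \<Longrightarrow> coeff_bounds \<beta> (\<gamma>0 / 4) c1 C1 R n0 (frag_rate \<rho>)
         (\<lambda>n. a_coeff k \<gamma> (A_of_mass k \<gamma> \<rho> M) \<rho> (n + 1) / a_coeff k \<gamma> (A_of_mass k \<gamma> \<rho> M) \<rho> n)"
    and "\<And>\<rho> n. 0 \<le> \<rho> \<Longrightarrow> \<rho> < 1 \<Longrightarrow> N1 \<le> n \<Longrightarrow>
         a_coeff k \<gamma> (A_of_mass k \<gamma> \<rho> M) \<rho> (n + 1) / a_coeff k \<gamma> (A_of_mass k \<gamma> \<rho> M) \<rho> n
            * exp (\<kappa> * 2 powr (of_int n)) \<le> (\<beta> - 1) / \<beta> / 2048 * 2 powr (- \<beta> * of_int n)"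
proof -
  obtain Al Ah where Al: "0 < Al" and AM: "\<And>\<rho>. 0 \<le> \<rho> \<Longrightarrow> \<rho> < 1 \<Longrightarrow> Al \<le> A_of_mass k \<gamma> \<rho> M \<and> A_of_mass k \<gamma> \<rho> M \<le> Ah
      \<and> total_mass \<rho> (A_of_mass k \<gamma> \<rho> M) = M"
    using A_of_mass_bounds[OF M] by blast
  have Ah: "0 < Ah" using AM[of 0] Al by auto
  obtain B where B: "0 < B" "\<And>\<xi>. 0 < \<xi> \<Longrightarrow> \<bar>ln_theta \<xi>\<bar> \<le> B" using ln_theta_bounded by blast
  obtain na where na: "\<And>n \<rho>. n \<le> na \<Longrightarrow> 0 \<le> \<rho> \<Longrightarrow> \<rho> < 1 \<Longrightarrow> \<bar>frag_rate \<rho> n - \<gamma>0 / 4\<bar> \<le> \<gamma>0 / 4 / 50"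
    using frag_rate_left by blast
  obtain nb where nb: "\<And>n \<rho>. n \<le> nb \<Longrightarrow> 0 \<le> \<rho> \<Longrightarrow> \<rho> < 1 \<Longrightarrow> \<bar>drift \<rho> n\<bar> \<le> 1/200"
    using drift_small_left[of "1/200"] by auto
  obtain Nc :: nat where Nc: "(1/2) ^ Nc < 1 / 200 / Ah" using real_arch_pow_inv[of "1 / 200 / Ah" "1/2"] Ah by auto
  define n0 where "n0 = min (min na nb) (- int Nc)"
  obtain c1 C1 where c1: "0 < c1" "0 < C1" and pw: "\<And>n \<rho>. n0 \<le> n \<Longrightarrow> 0 \<le> \<rho> \<Longrightarrow> \<rho> < 1 \<Longrightarrow>
     c1 * 2 powr (\<beta> * of_int n) \<le> frag_rate \<rho> n \<and> frag_rate \<rho> n \<le> C1 * 2 powr (\<beta> * of_int n)"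
    using frag_rate_power[of n0] by blast
  define \<theta> where "\<theta> = (\<beta> - 1) / \<beta>"
  have \<theta>: "0 < \<theta>" using beta by (simp add: \<theta>_def)
  \<comment> \<open>For $2^n \ge X$ the bound $e^{-x} \le 256/x^4$ beats the required $2^{-\beta n} \ge 4^{-n}$.\<close>
  define X where "X = 2 * exp B * 256 / (Al / 2) ^ 4 * 2048 / \<theta>"
  obtain N :: nat where N: "X < 2 ^ N" using real_arch_pow[of 2 X] by auto
  define N1 where "N1 = int N + 1"
  define R where "R = 2 * exp B"
  have bounds: "4 * (Al / 4) \<le> A \<and> total_mass \<rho> A = M \<and>
       coeff_bounds \<beta> (\<gamma>0 / 4) c1 C1 R n0 (frag_rate \<rho>) (\<lambda>n. a_coeff k \<gamma> A \<rho> (n + 1) / a_coeff k \<gamma> A \<rho> n) \<and>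
       (\<forall>n\<ge>N1. a_coeff k \<gamma> A \<rho> (n + 1) / a_coeff k \<gamma> A \<rho> n * exp (Al / 4 * 2 powr (of_int n)) \<le> \<theta> / 2048 * 2 powr (- \<beta> * of_int n))"
    if \<rho>: "0 \<le> \<rho>" "\<rho> < 1" and A: "A = A_of_mass k \<gamma> \<rho> M" for \<rho> A
  proof -
    have Ab: "Al \<le> A" "A \<le> Ah" "total_mass \<rho> A = M" using AM[OF \<rho>] by (auto simp: A)
    have dr: "\<bar>drift \<rho> n\<bar> \<le> B" for n by (rule drift_bound[OF B(2)])
    have rR: "a_coeff k \<gamma> A \<rho> (n + 1) / a_coeff k \<gamma> A \<rho> n \<le> R" for n
    proof -
      have "0 \<le> A * 2 powr (of_int n)" using Ab Al by simp
      then have "- (A * 2 powr (of_int n)) - drift \<rho> n \<le> B" using dr[of n] by linarith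
      then show ?thesis unfolding a_coeff_ratio R_def by simp
    qed
    have near: "\<bar>a_coeff k \<gamma> A \<rho> (n + 1) / a_coeff k \<gamma> A \<rho> n - 2\<bar> \<le> 1/25" if n: "n \<le> n0" for n
    proof (rule ratio_near_two)
      show "\<bar>drift \<rho> n\<bar> \<le> 1/200" using nb[of n \<rho>] n \<rho> by (simp add: n0_def)
      have "(2::real) powr (of_int n) \<le> 2 powr (- real Nc)" using n by (intro powr_mono) (auto simp: n0_def)
      also have "\<dots> = (1/2) ^ Nc" by (simp add: powr_minus powr_realpow power_divide inverse_eq_divide)
      finally have "A * 2 powr (of_int n) \<le> Ah * (1/2) ^ Nc" using Ab Al by (intro mult_mono) auto
      also have "\<dots> \<le> 1/200" using Nc Ah by (simp add: field_simps)
      finally show "\<bar>A * 2 powr (of_int n)\<bar> \<le> 1/200" using Ab Al by simp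
    qed
    have "coeff_bounds \<beta> (\<gamma>0 / 4) c1 C1 R n0 (frag_rate \<rho>) (\<lambda>n. a_coeff k \<gamma> A \<rho> (n + 1) / a_coeff k \<gamma> A \<rho> n)"
      unfolding coeff_bounds_def
      using frag_rate_pos a_coeff_pos rR na[OF _ \<rho>] near pw[OF _ \<rho>] by (auto simp: n0_def)
    moreover have "a_coeff k \<gamma> A \<rho> (n + 1) / a_coeff k \<gamma> A \<rho> n * exp (Al / 4 * 2 powr (of_int n)) \<le> \<theta> / 2048 * 2 powr (- \<beta> * of_int n)"
      if n: "N1 \<le> n" for n
    proof -
      define u where "u = (2::real) powr (of_int n)"
      have "(2::real) ^ N = 2 powr (real N)" by (simp add: powr_realpow)
      also have "\<dots> \<le> u" unfolding u_def using n by (intro powr_mono) (auto simp: N1_def)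
      finally have uX: "X \<le> u" using N by linarith
      have u1: "1 \<le> u" unfolding u_def using n by (intro ge_one_powr_ge_zero) (auto simp: N1_def)
      have "Al * u \<le> A * u" using Ab u1 by (intro mult_right_mono) auto
      then have "- (A * u) - drift \<rho> n + Al / 4 * u \<le> B + - (Al / 2 * u)"
        using dr[of n] mult_pos_pos[OF Al, of u] u1 by linarith
      then have "exp (- (A * u) - drift \<rho> n + Al / 4 * u) \<le> exp (B + - (Al / 2 * u))" by simp
      then have "a_coeff k \<gamma> A \<rho> (n + 1) / a_coeff k \<gamma> A \<rho> n * exp (Al / 4 * u) \<le> 2 * (exp B * exp (- (Al / 2 * u)))"
        unfolding a_coeff_ratio u_def[symmetric] by (simp add: exp_add[symmetric])
      also have "\<dots> \<le> 2 * (exp B * (256 / (Al / 2 * u) ^ 4))"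
        using exp_neg_bounds(2)[of "Al / 2 * u"] Al u1 by (intro mult_left_mono) auto
      also have "\<dots> = X * \<theta> / 2048 / u ^ 4" using \<theta> by (simp add: X_def power_mult_distrib power_divide)
      also have "\<dots> \<le> u * \<theta> / 2048 / u ^ 4" using uX \<theta> u1 by (intro divide_right_mono mult_right_mono) auto
      also have "\<dots> = \<theta> / 2048 * (1 / u ^ 3)" using u1 by (simp add: power3_eq_cube power4_eq_xxxx)
      also have "\<dots> \<le> \<theta> / 2048 * (1 / u ^ 2)"
        using u1 \<theta> by (intro mult_left_mono divide_left_mono power_increasing) auto
      also have "1 / u ^ 2 = u powr (- 2)" using u1 by (simp add: powr_minus powr_numeral inverse_eq_divide)
      also have "\<theta> / 2048 * u powr (- 2) \<le> \<theta> / 2048 * u powr (- \<beta>)"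
        using u1 \<theta> beta by (intro mult_left_mono powr_mono) auto
      also have "u powr (- \<beta>) = 2 powr (- \<beta> * of_int n)" by (simp add: u_def powr_powr mult.commute)
      finally show ?thesis by (simp add: u_def)
    qed
    ultimately show ?thesis using Ab by simp
  qed
  show thesis
  proof (rule that[of n0 N1 c1 C1 R "Al / 4"])
    show "n0 < N1" "n0 \<le> 0" "0 \<le> N1" "0 < R" "0 < Al / 4" using Al by (auto simp: n0_def N1_def R_def)
    show "0 < c1" "0 < C1" by (rule c1)+
    fix \<rho> :: real assume \<rho>: "0 \<le> \<rho>" "\<rho> < 1"
    note b = bounds[OF \<rho> refl]
    show "4 * (Al / 4) \<le> A_of_mass k \<gamma> \<rho> M \<and> total_mass \<rho> (A_of_mass k \<gamma> \<rho> M) = M" using b by blast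
    show "coeff_bounds \<beta> (\<gamma>0 / 4) c1 C1 R n0 (frag_rate \<rho>)
         (\<lambda>n. a_coeff k \<gamma> (A_of_mass k \<gamma> \<rho> M) \<rho> (n + 1) / a_coeff k \<gamma> (A_of_mass k \<gamma> \<rho> M) \<rho> n)" using b by blast
    show "a_coeff k \<gamma> (A_of_mass k \<gamma> \<rho> M) \<rho> (n + 1) / a_coeff k \<gamma> (A_of_mass k \<gamma> \<rho> M) \<rho> n
            * exp (Al / 4 * 2 powr (of_int n)) \<le> (\<beta> - 1) / \<beta> / 2048 * 2 powr (- \<beta> * of_int n)" if "N1 \<le> n" for n
      using b that unfolding \<theta>_def by blast
  qed
qed

text \<open>
  The amplitude \<open>\<mu>\<close> of the barrier is chosen first, small enough for all smallness conditions and for the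
  constants in the final estimates; then \<open>\<delta>\<close> places the initial defect below the barrier.
  Convergence of $A(t)$ is read off from the mass, as $|\varepsilon_n(t)|$ decays uniformly in $n$ and
  the mass is strictly monotone in $A$.
\<close>

lemma stability_for_fixed_offset:
  assumes \<rho>: "0 \<le> \<rho>" "\<rho> < 1" and AM: "4 * \<kappa> \<le> AM" "total_mass \<rho> AM = M"
    and net: "damped_network (frag_rate \<rho>) (zeta k \<gamma> \<rho>) (a_coeff k \<gamma> AM \<rho>) w w' \<beta> \<nu> \<eta> \<kappa> c C N1"
  shows "\<exists>\<delta>0>0.
    \<forall>(A0::real) (\<epsilon>0::int \<Rightarrow> real) (b0::int \<Rightarrow> real).
      0 < A0 \<longrightarrow>
      (\<forall>n. b0 n = a_coeff k \<gamma> A0 \<rho> n * (1 + \<epsilon>0 n)) \<longrightarrow>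
      has_mass \<rho> b0 M \<longrightarrow>
      \<bar>A0 - AM\<bar> \<le> \<delta>0 \<longrightarrow>
      (\<forall>n. \<bar>\<epsilon>0 n\<bar> \<le> \<delta>0) \<longrightarrow>
      (\<exists>(b::real \<Rightarrow> int \<Rightarrow> real) (A::real \<Rightarrow> real) (\<epsilon>::real \<Rightarrow> int \<Rightarrow> real).
        solves_coeff_system k \<gamma> \<rho> b0 b \<and>
        (\<forall>t>0. 0 < A t \<and> (\<forall>n. b t n = a_coeff k \<gamma> (A t) \<rho> n * (1 + \<epsilon> t n))) \<and>
        (\<forall>t>0. weighted_sup_norm \<beta> (\<epsilon> t)
                 \<le> ereal ((1 + t powr (- ((\<beta> - 1) / \<beta>))) * exp (- \<nu> * t))) \<and>
        (\<forall>t>0. A differentiable (at t) \<and>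
               \<bar>deriv A t\<bar> \<le> (1 + t powr (- ((\<beta> - 1) / \<beta>))) * exp (- \<nu> * t)) \<and>
        (A \<longlongrightarrow> AM) at_top)"
proof -
  interpret net: damped_network "frag_rate \<rho>" "zeta k \<gamma> \<rho>" "a_coeff k \<gamma> AM \<rho>" w w' \<beta> \<nu> \<eta> \<kappa> c C N1
    by (rule net)
  define \<theta> where "\<theta> = (\<beta> - 1) / \<beta>"
  have \<theta>: "0 < \<theta>" "\<theta> < 1" using beta by (auto simp: \<theta>_def)
  have "\<forall>\<^sub>F \<mu> in at_right 0. 0 < \<mu> \<and> \<mu> * (12 * C) \<le> 1 \<and> \<mu> * (10 * C) \<le> 1 \<and> \<mu> * net.K \<le> \<kappa> \<and>
      \<mu> * (net.K * 2 powr (of_int N1)) \<le> 1 \<and> \<mu> * (2 * net.K * 2 powr (of_int N1)) \<le> \<eta> \<and> \<mu> * (net.K + 2 * C) \<le> \<kappa>"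
    using net.kap net.eta
    by (intro eventually_conj eventually_small_multiple eventually_at_right_less) auto
  from eventually_happens'[OF trivial_limit_at_right_real this]
  obtain \<mu> where mu: "0 < \<mu>" "\<mu> * (12 * C) \<le> 1" "\<mu> * (10 * C) \<le> 1" "\<mu> * net.K \<le> \<kappa>"
      "\<mu> * (net.K * 2 powr (of_int N1)) \<le> 1" "\<mu> * (2 * net.K * 2 powr (of_int N1)) \<le> \<eta>" "\<mu> * (net.K + 2 * C) \<le> \<kappa>"
    by blast
  have sm: "net.small_amplitude \<mu>" using mu unfolding net.small_amplitude_def by (simp add: mult_ac)
  have "\<forall>\<^sub>F d in at_right 0. 0 < d \<and> d * 2 \<le> 1 \<and> d * 16 \<le> \<mu> * c \<and> d * 6 \<le> \<mu> * net.Z1"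
    using mu net.c_pos net.Z1_pos
    by (intro eventually_conj eventually_small_multiple eventually_at_right_less) auto
  from eventually_happens'[OF trivial_limit_at_right_real this]
  obtain \<delta> where \<delta>: "0 < \<delta>" "\<delta> * 2 \<le> 1" "\<delta> * 16 \<le> \<mu> * c" "\<delta> * 6 \<le> \<mu> * net.Z1" by blast
  obtain N where N: "\<And>n. N \<le> n \<Longrightarrow> frag_rate \<rho> (n - 1) \<le> 3/5 * frag_rate \<rho> n" using frag_rate_growth \<rho> by blast
  show ?thesis
  proof (intro exI[of _ \<delta>] conjI allI impI \<delta>(1))
    fix A0 \<epsilon>0 b0
    assume A0: "0 < A0" and b0: "\<forall>n. b0 n = a_coeff k \<gamma> A0 \<rho> n * (1 + \<epsilon>0 n)" and mass: "has_mass \<rho> b0 M"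
      and A0\<delta>: "\<bar>A0 - AM\<bar> \<le> \<delta>" and \<epsilon>0: "\<forall>n. \<bar>\<epsilon>0 n\<bar> \<le> \<delta>"
    have e1: "1/2 \<le> 1 + \<epsilon>0 n" "\<bar>\<epsilon>0 n\<bar> \<le> \<delta>" for n using \<epsilon>0[rule_format, of n] \<delta>(2) by auto
    have b0p: "0 < b0 n" for n using b0 a_coeff_pos[of A0 \<rho> n] e1(1)[of n] by simp
    have init1: "\<bar>1 - zeta k \<gamma> \<rho> (n - 1) * (b0 (n - 1))\<^sup>2 / b0 n\<bar> < \<mu> * c" for n
    proof -
      have "zeta k \<gamma> \<rho> (n - 1) * (b0 (n - 1))\<^sup>2 = a_coeff k \<gamma> A0 \<rho> n * (1 + \<epsilon>0 (n - 1))\<^sup>2"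
        using a_coeff_Suc[of A0 \<rho> "n - 1"] b0 by (simp add: power_mult_distrib)
      then have "1 - zeta k \<gamma> \<rho> (n - 1) * (b0 (n - 1))\<^sup>2 / b0 n = 1 - (1 + \<epsilon>0 (n - 1))\<^sup>2 / (1 + \<epsilon>0 n)"
        using b0 a_coeff_pos[of A0 \<rho> n] by simp
      also have "\<dots> = (\<epsilon>0 n - 2 * \<epsilon>0 (n - 1) - (\<epsilon>0 (n - 1))\<^sup>2) / (1 + \<epsilon>0 n)"
        using e1(1)[of n] by (simp add: field_simps power2_eq_square)
      finally have eq: "\<bar>1 - zeta k \<gamma> \<rho> (n - 1) * (b0 (n - 1))\<^sup>2 / b0 n\<bar> = \<bar>\<epsilon>0 n - 2 * \<epsilon>0 (n - 1) - (\<epsilon>0 (n - 1))\<^sup>2\<bar> / (1 + \<epsilon>0 n)"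
        using e1(1)[of n] by simp
      have "(\<epsilon>0 (n - 1))\<^sup>2 = \<bar>\<epsilon>0 (n - 1)\<bar> * \<bar>\<epsilon>0 (n - 1)\<bar>" by (simp add: power2_eq_square)
      also have "\<dots> \<le> \<delta> * 1" using e1(2)[of "n - 1"] \<delta> by (intro mult_mono) auto
      finally have sq: "(\<epsilon>0 (n - 1))\<^sup>2 \<le> \<delta>" "0 \<le> (\<epsilon>0 (n - 1))\<^sup>2" by simp_all
      have num: "\<bar>\<epsilon>0 n - 2 * \<epsilon>0 (n - 1) - (\<epsilon>0 (n - 1))\<^sup>2\<bar> \<le> 4 * \<delta>"
        using e1(2)[of n] e1(2)[of "n - 1"] sq by linarith
      have "\<bar>\<epsilon>0 n - 2 * \<epsilon>0 (n - 1) - (\<epsilon>0 (n - 1))\<^sup>2\<bar> / (1 + \<epsilon>0 n) \<le> 4 * \<delta> / (1/2)"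
        using num e1(1)[of n] \<delta>(1) by (intro frac_le) auto
      then show ?thesis unfolding eq using \<delta> by simp
    qed
    have init2: "\<bar>ln (b0 0 / a_coeff k \<gamma> AM \<rho> 0)\<bar> < \<mu> * net.Z1"
    proof -
      have "a_coeff k \<gamma> A0 \<rho> 0 = a_coeff k \<gamma> AM \<rho> 0 * exp (AM - A0)" using a_coeff_shift[of AM "AM - A0" \<rho> 0] by simp
      then have "b0 0 / a_coeff k \<gamma> AM \<rho> 0 = exp (AM - A0) * (1 + \<epsilon>0 0)" using b0 a_coeff_pos[of AM \<rho> 0] by simp
      then have "ln (b0 0 / a_coeff k \<gamma> AM \<rho> 0) = (AM - A0) + ln (1 + \<epsilon>0 0)" using e1(1)[of 0] by (simp add: ln_mult)
      moreover have "\<bar>ln (1 + \<epsilon>0 0)\<bar> \<le> 2 * \<delta>" using e1(2)[of 0] \<delta>(2) by (intro abs_ln_le) auto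
      ultimately show ?thesis using A0\<delta> \<delta> by linarith
    qed
    obtain b where binit: "\<And>n. b 0 n = b0 n"
      and bder: "\<And>n t. 0 \<le> t \<Longrightarrow> ((\<lambda>s. b s n) has_real_derivative net_flux (frag_rate \<rho>) (zeta k \<gamma> \<rho>) (b t) n) (at t within {0..})"
      and bpos: "\<And>n t. 0 \<le> t \<Longrightarrow> 0 < b t n"
      and bln: "\<And>n t. 0 \<le> t \<Longrightarrow> \<bar>ln (b t n / a_coeff k \<gamma> AM \<rho> n)\<bar> \<le> \<mu> * net.K * max 1 (2 powr (of_int n))"
      and bdef: "\<And>n t. 0 \<le> t \<Longrightarrow> \<bar>defect (zeta k \<gamma> \<rho>) (b t) n\<bar> \<le> net.barrier \<mu> n t"
      and bln0: "\<And>t. 0 \<le> t \<Longrightarrow> \<bar>ln (b t 0 / a_coeff k \<gamma> AM \<rho> 0)\<bar> \<le> 2 * \<mu> * net.Z1"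
      using net.global_solution[OF sm b0p init1 init2] by blast
    interpret sol: damped_solution "frag_rate \<rho>" "zeta k \<gamma> \<rho>" "a_coeff k \<gamma> AM \<rho>" w w' \<beta> \<nu> \<eta> \<kappa> c C N1 \<mu> b "max N (N1 + 2)"
      by unfold_locales (use sm bder bpos bln bln0 bdef N in auto)
    define A where "A = (\<lambda>t. AM - sol.z_lim t)"
    define \<epsilon> where "\<epsilon> = (\<lambda>t n. sol.excess n t)"
    have AK: "3 * \<kappa> \<le> A t" if "0 \<le> t" for t using sol.z_lim_bound[OF that] mu(7) AM(1) by (simp add: A_def abs_le_iff)
    have Ap: "0 < A t" if "0 \<le> t" for t using AK[OF that] net.kap by linarith
    have rep: "b t n = a_coeff k \<gamma> (A t) \<rho> n * (1 + \<epsilon> t n)" if "0 \<le> t" for t n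
      using sol.state_eq[OF that, of n] a_coeff_shift[of AM "sol.z_lim t" \<rho> n] by (simp add: A_def \<epsilon>_def)
    have sys: "solves_coeff_system k \<gamma> \<rho> b0 b"
      using binit bder by (simp add: solves_coeff_system_def coeff_rhs_eq)
    define s where "s = (\<lambda>t::real. (1 - exp (- t)) powr (- \<theta>))"
    have s2: "s t \<le> 2 * (1 + t powr (- \<theta>))" if "0 < t" for t unfolding s_def by (rule one_minus_exp_powr_le[OF that \<theta>])
    have norm_bound: "weighted_sup_norm \<beta> (\<epsilon> t) \<le> ereal ((1 + t powr (- \<theta>)) * exp (- \<nu> * t))" if t: "0 < t" for t
    proof -
      define E where "E = 4 * \<mu> * C * exp (- \<nu> * t)"
      have E0: "0 \<le> E" using mu net.C_pos by (simp add: E_def)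
      have "(SUP n\<in>{..0}. ereal \<bar>\<epsilon> t n\<bar>) \<le> ereal E"
        by (rule SUP_least) (use sol.excess_bound(1)[of t] t in \<open>simp add: \<epsilon>_def E_def\<close>)
      moreover have "(SUP n\<in>{0..}. ereal (2 powr ((\<beta> - 1) * of_int n) * \<bar>\<epsilon> t n\<bar>)) \<le> ereal (E * s t)"
        by (rule SUP_least) (use sol.excess_bound(2)[of t] t in \<open>simp add: \<epsilon>_def E_def s_def \<theta>_def\<close>)
      ultimately have "weighted_sup_norm \<beta> (\<epsilon> t) \<le> ereal E + ereal (E * s t)"
        unfolding weighted_sup_norm_def by (rule add_mono)
      also have "\<dots> = ereal (E * (1 + s t))" by (simp add: distrib_left)
      also have "\<dots> \<le> ereal ((1 + t powr (- \<theta>)) * exp (- \<nu> * t))"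
      proof -
        have "1 + s t \<le> (1 + t powr (- \<theta>)) + 2 * (1 + t powr (- \<theta>))"
          using s2[OF t] by (intro add_mono) auto
        then have "1 + s t \<le> 3 * (1 + t powr (- \<theta>))" by simp
        then have "E * (1 + s t) \<le> E * (3 * (1 + t powr (- \<theta>)))" using E0 by (intro mult_left_mono)
        also have "\<dots> = (\<mu> * (12 * C)) * ((1 + t powr (- \<theta>)) * exp (- \<nu> * t))" by (simp add: E_def)
        also have "\<dots> \<le> 1 * ((1 + t powr (- \<theta>)) * exp (- \<nu> * t))" using mu(2) by (intro mult_right_mono) auto
        finally show ?thesis by simp
      qed
      finally show ?thesis .
    qed
    have deriv_bound: "A differentiable (at t) \<and> \<bar>deriv A t\<bar> \<le> (1 + t powr (- \<theta>)) * exp (- \<nu> * t)" if t: "0 < t" for t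
    proof -
      obtain d where d: "(sol.z_lim has_real_derivative d) (at t)" and db: "\<bar>d\<bar> \<le> \<mu> * C * exp (- \<nu> * t) * s t"
        using sol.z_lim_derivative[OF t] by (auto simp: s_def \<theta>_def)
      have dA: "(A has_real_derivative - d) (at t)"
        unfolding A_def using DERIV_diff[OF DERIV_const d] by simp
      have "\<mu> * C * exp (- \<nu> * t) * s t \<le> \<mu> * C * exp (- \<nu> * t) * (2 * (1 + t powr (- \<theta>)))"
        using s2[OF t] mu(1) net.C_pos by (intro mult_left_mono) auto
      also have "\<dots> = (\<mu> * (2 * C)) * ((1 + t powr (- \<theta>)) * exp (- \<nu> * t))" by simp
      also have "\<dots> \<le> 1 * ((1 + t powr (- \<theta>)) * exp (- \<nu> * t))"
      proof (rule mult_right_mono)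
        have "0 < \<mu> * C" using mu(1) net.C_pos by simp
        then show "\<mu> * (2 * C) \<le> 1" using mu(2) by simp
      qed simp
      finally have "\<bar>- d\<bar> \<le> (1 + t powr (- \<theta>)) * exp (- \<nu> * t)"
        unfolding abs_minus_cancel mult_1_left by (rule order_trans[OF db])
      then show ?thesis using dA by (auto simp only: DERIV_imp_deriv real_differentiable_def)
    qed
    have ex: "\<bar>\<epsilon> t n\<bar> \<le> 4 * \<mu> * C * exp (- \<nu> * t)" if "0 \<le> t" for t n
      using sol.excess_bound(1)[OF that, of n] by (simp add: \<epsilon>_def)
    have ex1: "\<bar>\<epsilon> t n\<bar> \<le> 1" if t: "0 \<le> t" for t n
    proof -
      have "exp (- \<nu> * t) \<le> 1" using net.nu t by simp
      then have "4 * \<mu> * C * exp (- \<nu> * t) \<le> 4 * \<mu> * C * 1" using mu(1) net.C_pos by (intro mult_left_mono) auto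
      moreover have "0 < \<mu> * C" using mu(1) net.C_pos by simp
      ultimately show ?thesis using ex[OF t, of n] mu(2) by simp
    qed
    have mt: "2 powr (of_int n + \<rho>) * b t n = mass_term \<rho> (A t) n + \<epsilon> t n * mass_term \<rho> (A t) n" if "0 \<le> t" for t n
      using rep[OF that, of n] by (simp add: mass_term_def algebra_simps)
    have mono\<kappa>: "mass_term \<rho> (A t) n \<le> mass_term \<rho> \<kappa> n" if "0 \<le> t" for t n
      using mass_term_mono[of \<kappa> "A t" \<rho> n] AK[OF that] net.kap by simp
    have cons: "has_mass \<rho> (b t) M" if t: "0 \<le> t" for t
    proof (rule mass_conserved[where A = \<kappa> and b = b])
      show "2 powr (of_int n + \<rho>) * b t n \<le> 2 * mass_term \<rho> \<kappa> n" if t: "0 \<le> t" for t n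
      proof -
        have "\<epsilon> t n * mass_term \<rho> (A t) n \<le> 1 * mass_term \<rho> (A t) n"
          using ex1[OF t, of n] mass_term_pos[of \<rho> "A t" n] by (intro mult_right_mono) auto
        then show ?thesis using mt[OF t, of n] mono\<kappa>[OF t, of n] by linarith
      qed
      show "\<bar>1 - zeta k \<gamma> \<rho> (n - 1) * (b t (n - 1))\<^sup>2 / b t n\<bar> \<le> 1" if "0 \<le> t" for t n
        using sol.quotient_close[OF that, of n] sol.mu(2) by linarith
      have "b 0 = b0" using binit by auto
      then show "has_mass \<rho> (b 0) M" using mass by simp
    qed (use \<rho> net.kap bpos bder t in auto)
    have close: "\<bar>total_mass \<rho> (A t) - M\<bar> \<le> 4 * \<mu> * C * exp (- \<nu> * t) * total_mass \<rho> \<kappa>" if t: "0 \<le> t" for t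
    proof -
      have hs: "(mass_term \<rho> X has_sum total_mass \<rho> X) UNIV" if "0 < X" for X
        using has_sum_infsum[OF mass_term_summable[OF \<rho> that]] by (simp add: total_mass_def)
      have "norm (M + - total_mass \<rho> (A t)) \<le> 4 * \<mu> * C * exp (- \<nu> * t) * total_mass \<rho> \<kappa>"
      proof (rule norm_infsum_le)
        show "((\<lambda>n. 2 powr (of_int n + \<rho>) * b t n + - mass_term \<rho> (A t) n) has_sum (M + - total_mass \<rho> (A t))) UNIV"
          using cons[OF t] hs[OF Ap[OF t]] unfolding has_mass_def by (intro has_sum_add has_sum_uminusI)
        show "((\<lambda>n. 4 * \<mu> * C * exp (- \<nu> * t) * mass_term \<rho> \<kappa> n) has_sum 4 * \<mu> * C * exp (- \<nu> * t) * total_mass \<rho> \<kappa>) UNIV"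
          by (intro has_sum_cmult_right hs net.kap)
        fix n :: int
        have "norm (2 powr (of_int n + \<rho>) * b t n + - mass_term \<rho> (A t) n) = \<bar>\<epsilon> t n\<bar> * mass_term \<rho> (A t) n"
          using mass_term_pos[of \<rho> "A t" n] unfolding mt[OF t] by (simp add: abs_mult)
        also have "\<dots> \<le> 4 * \<mu> * C * exp (- \<nu> * t) * mass_term \<rho> \<kappa> n"
          using ex[OF t, of n] mono\<kappa>[OF t, of n] mass_term_pos[of \<rho> "A t" n] mu(1) net.C_pos by (intro mult_mono) auto
        finally show "norm (2 powr (of_int n + \<rho>) * b t n + - mass_term \<rho> (A t) n) \<le> 4 * \<mu> * C * exp (- \<nu> * t) * mass_term \<rho> \<kappa> n" .
      qed
      then show ?thesis by (simp add: abs_minus_commute)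
    qed
    have tm: "((\<lambda>t. total_mass \<rho> (A t)) \<longlongrightarrow> M) at_top"
    proof -
      have "filterlim (\<lambda>t. \<nu> * t) at_top at_top" by (rule scale_at_top[OF net.nu])
      then have "filterlim (\<lambda>t. - (\<nu> * t)) at_bot at_top" using filterlim_uminus_at_top[of "\<lambda>t. \<nu> * t" at_top] by blast
      then have "((\<lambda>t. exp (- (\<nu> * t))) \<longlongrightarrow> 0) at_top" by (rule filterlim_compose[OF exp_at_bot])
      then have "((\<lambda>t. 4 * \<mu> * C * exp (- (\<nu> * t)) * total_mass \<rho> \<kappa>) \<longlongrightarrow> 4 * \<mu> * C * 0 * total_mass \<rho> \<kappa>) at_top"
        by (intro tendsto_intros)
      then have "((\<lambda>t. 4 * \<mu> * C * exp (- \<nu> * t) * total_mass \<rho> \<kappa>) \<longlongrightarrow> 0) at_top" by simp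
      moreover have "\<forall>\<^sub>F t in at_top. norm (total_mass \<rho> (A t) - M) \<le> 4 * \<mu> * C * exp (- \<nu> * t) * total_mass \<rho> \<kappa>"
        using eventually_ge_at_top[of "0::real"] by eventually_elim (use close in auto)
      ultimately have "((\<lambda>t. total_mass \<rho> (A t) - M) \<longlongrightarrow> 0) at_top" by (rule Lim_null_comparison[rotated])
      then show ?thesis by (simp add: LIM_zero_iff)
    qed
    have conv: "(A \<longlongrightarrow> AM) at_top"
    proof (rule order_tendstoI)
      fix a assume a: "a < AM"
      \<comment> \<open>The mass is monotone on positive parameters only, so \<open>a\<close> is replaced by a positive number.\<close>
      define a' where "a' = max a \<kappa>"
      have a': "0 < a'" "a' < AM" "a \<le> a'" using a AM(1) net.kap by (auto simp: a'_def)
      have "M < total_mass \<rho> a'" using total_mass_strict_mono[OF \<rho> a'(1,2)] AM(2) by simp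
      from order_tendstoD(2)[OF tm this] eventually_ge_at_top[of "0::real"]
      show "\<forall>\<^sub>F t in at_top. a < A t"
      proof eventually_elim
        case (elim t)
        have "\<not> A t \<le> a'"
        proof
          assume "A t \<le> a'"
          then have "total_mass \<rho> a' \<le> total_mass \<rho> (A t)"
            using total_mass_strict_mono[OF \<rho> Ap[OF elim(2)], of a'] by (cases "A t = a'") auto
          then show False using elim by simp
        qed
        then show ?case using a' by simp
      qed
    next
      fix a assume a: "AM < a"
      have AMp: "0 < AM" using AM(1) net.kap by linarith
      have "total_mass \<rho> a < M" using total_mass_strict_mono[OF \<rho> AMp a] AM(2) by simp
      from order_tendstoD(1)[OF tm this] eventually_ge_at_top[of "0::real"]
      show "\<forall>\<^sub>F t in at_top. A t < a"
      proof eventually_elim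
        case (elim t)
        have "\<not> a \<le> A t"
        proof
          assume "a \<le> A t"
          then have "total_mass \<rho> (A t) \<le> total_mass \<rho> a"
            using total_mass_strict_mono[OF \<rho>, of a "A t"] AMp a by (cases "A t = a") auto
          then show False using elim by simp
        qed
        then show ?case by simp
      qed
    qed
    show "\<exists>b A \<epsilon>. solves_coeff_system k \<gamma> \<rho> b0 b \<and>
        (\<forall>t>0. 0 < A t \<and> (\<forall>n. b t n = a_coeff k \<gamma> (A t) \<rho> n * (1 + \<epsilon> t n))) \<and>
        (\<forall>t>0. weighted_sup_norm \<beta> (\<epsilon> t)
                 \<le> ereal ((1 + t powr (- ((\<beta> - 1) / \<beta>))) * exp (- \<nu> * t))) \<and>
        (\<forall>t>0. A differentiable (at t) \<and>
               \<bar>deriv A t\<bar> \<le> (1 + t powr (- ((\<beta> - 1) / \<beta>))) * exp (- \<nu> * t)) \<and>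
        (A \<longlongrightarrow> AM) at_top"
      using sys Ap rep norm_bound deriv_bound conv unfolding \<theta>_def
      by (intro exI[of _ b] exI[of _ A] exI[of _ \<epsilon>] conjI allI impI) (auto simp: less_imp_le)
  qed
qed

end

theorem theorem6p1:
  fixes \<alpha> \<beta> \<alpha>bar \<beta>bar k0 \<gamma>0 M :: real and k \<gamma> :: "real \<Rightarrow> real"
  assumes "coag_frag_kernels \<alpha> \<beta> \<alpha>bar \<beta>bar k0 \<gamma>0 k \<gamma>"
    and "0 < M"
  shows "\<exists>\<nu>>0. \<forall>\<rho>\<in>{0..<1::real}. \<exists>\<delta>0>0.
    \<forall>(A0::real) (\<epsilon>0::int \<Rightarrow> real) (b0::int \<Rightarrow> real).
      0 < A0 \<longrightarrow>
      (\<forall>n. b0 n = a_coeff k \<gamma> A0 \<rho> n * (1 + \<epsilon>0 n)) \<longrightarrow>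
      has_mass \<rho> b0 M \<longrightarrow>
      \<bar>A0 - A_of_mass k \<gamma> \<rho> M\<bar> \<le> \<delta>0 \<longrightarrow>
      (\<forall>n. \<bar>\<epsilon>0 n\<bar> \<le> \<delta>0) \<longrightarrow>
      (\<exists>(b::real \<Rightarrow> int \<Rightarrow> real) (A::real \<Rightarrow> real) (\<epsilon>::real \<Rightarrow> int \<Rightarrow> real).
        solves_coeff_system k \<gamma> \<rho> b0 b \<and>
        (\<forall>t>0. 0 < A t \<and> (\<forall>n. b t n = a_coeff k \<gamma> (A t) \<rho> n * (1 + \<epsilon> t n))) \<and>
        (\<forall>t>0. weighted_sup_norm \<beta> (\<epsilon> t)
                 \<le> ereal ((1 + t powr (- ((\<beta> - 1) / \<beta>))) * exp (- \<nu> * t))) \<and>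
        (\<forall>t>0. A differentiable (at t) \<and>
               \<bar>deriv A t\<bar> \<le> (1 + t powr (- ((\<beta> - 1) / \<beta>))) * exp (- \<nu> * t)) \<and>
        (A \<longlongrightarrow> A_of_mass k \<gamma> \<rho> M) at_top)"
proof -
  interpret coag_frag_kernels \<alpha> \<beta> \<alpha>bar \<beta>bar k0 \<gamma>0 k \<gamma> by (rule assms(1))
  define r where "r = (\<lambda>\<rho> n. a_coeff k \<gamma> (A_of_mass k \<gamma> \<rho> M) \<rho> (n + 1) / a_coeff k \<gamma> (A_of_mass k \<gamma> \<rho> M) \<rho> n)"
  obtain n0 N1 c1 C1 R \<kappa> where const: "n0 < N1" "n0 \<le> 0" "0 \<le> N1" "0 < c1" "0 < C1" "0 < R" "0 < \<kappa>"
    and AM: "\<And>\<rho>. 0 \<le> \<rho> \<Longrightarrow> \<rho> < 1 \<Longrightarrow> 4 * \<kappa> \<le> A_of_mass k \<gamma> \<rho> M \<and> total_mass \<rho> (A_of_mass k \<gamma> \<rho> M) = M"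
    and cb': "\<And>\<rho>. 0 \<le> \<rho> \<Longrightarrow> \<rho> < 1 \<Longrightarrow> coeff_bounds \<beta> (\<gamma>0 / 4) c1 C1 R n0 (frag_rate \<rho>)
         (\<lambda>n. a_coeff k \<gamma> (A_of_mass k \<gamma> \<rho> M) \<rho> (n + 1) / a_coeff k \<gamma> (A_of_mass k \<gamma> \<rho> M) \<rho> n)"
    and tail: "\<And>\<rho> n. 0 \<le> \<rho> \<Longrightarrow> \<rho> < 1 \<Longrightarrow> N1 \<le> n \<Longrightarrow>
         a_coeff k \<gamma> (A_of_mass k \<gamma> \<rho> M) \<rho> (n + 1) / a_coeff k \<gamma> (A_of_mass k \<gamma> \<rho> M) \<rho> n
            * exp (\<kappa> * 2 powr (of_int n)) \<le> (\<beta> - 1) / \<beta> / 2048 * 2 powr (- \<beta> * of_int n)"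
  proof (rule uniform_coefficients[OF assms(2)], goal_cases)
    case (1 n0 N1 c1 C1 R \<kappa>)
    show ?thesis by (rule that[of n0 N1 c1 C1 R \<kappa>]) (fact 1)+
  qed
  have cb: "coeff_bounds \<beta> (\<gamma>0 / 4) c1 C1 R n0 (frag_rate \<rho>) (r \<rho>)" if "0 \<le> \<rho>" "\<rho> < 1" for \<rho>
    unfolding r_def by (rule cb'[OF that])
  have g: "0 < \<gamma>0 / 4" using gamma0_pos by simp
  from supersolution_weights[OF beta g const(4,5,6) const(1,2,3)]
  obtain \<nu> \<eta> where nu: "0 < \<nu>" "0 < \<eta>" and weights: "\<forall>D r. coeff_bounds \<beta> (\<gamma>0 / 4) c1 C1 R n0 D r \<longrightarrow>
      (\<exists>w w' c C. decay_weights \<beta> \<nu> \<eta> N1 D r w w' c C)"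
    by blast
  show ?thesis
  proof (rule exI[of _ \<nu>], intro conjI nu(1) ballI)
    fix \<rho> :: real assume "\<rho> \<in> {0..<1}"
    then have \<rho>: "0 \<le> \<rho>" "\<rho> < 1" by auto
    obtain w w' c C where "decay_weights \<beta> \<nu> \<eta> N1 (frag_rate \<rho>) (r \<rho>) w w' c C"
      using weights cb[OF \<rho>] by blast
    note w = this[unfolded decay_weights_def]
    have net: "damped_network (frag_rate \<rho>) (zeta k \<gamma> \<rho>) (a_coeff k \<gamma> (A_of_mass k \<gamma> \<rho> M) \<rho>) w w' \<beta> \<nu> \<eta> \<kappa> c C N1"
    proof
      show "a_coeff k \<gamma> (A_of_mass k \<gamma> \<rho> M) \<rho> (n + 1) / a_coeff k \<gamma> (A_of_mass k \<gamma> \<rho> M) \<rho> n * exp (\<kappa> * 2 powr (of_int n))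
          \<le> (\<beta> - 1) / \<beta> / 2048 * 2 powr (- \<beta> * of_int n)" if "N1 \<le> n" for n
        by (rule tail[OF \<rho> that])
      show "chain_op (frag_rate \<rho>) q (\<lambda>m. w m s) n < - (2 * (\<nu> * w n s - w' n s))"
        if "0 \<le> s" "s \<le> 1" "admissible_ratios \<beta> \<eta> N1 (\<lambda>n. a_coeff k \<gamma> (A_of_mass k \<gamma> \<rho> M) \<rho> (n + 1) / a_coeff k \<gamma> (A_of_mass k \<gamma> \<rho> M) \<rho> n) q" for n s q
        using w that unfolding r_def by blast
    qed (use beta nu const w frag_rate_pos zeta_pos a_coeff_pos a_coeff_Suc in auto)
    show "\<exists>\<delta>0>0.
    \<forall>(A0::real) (\<epsilon>0::int \<Rightarrow> real) (b0::int \<Rightarrow> real).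
      0 < A0 \<longrightarrow>
      (\<forall>n. b0 n = a_coeff k \<gamma> A0 \<rho> n * (1 + \<epsilon>0 n)) \<longrightarrow>
      has_mass \<rho> b0 M \<longrightarrow>
      \<bar>A0 - A_of_mass k \<gamma> \<rho> M\<bar> \<le> \<delta>0 \<longrightarrow>
      (\<forall>n. \<bar>\<epsilon>0 n\<bar> \<le> \<delta>0) \<longrightarrow>
      (\<exists>(b::real \<Rightarrow> int \<Rightarrow> real) (A::real \<Rightarrow> real) (\<epsilon>::real \<Rightarrow> int \<Rightarrow> real).
        solves_coeff_system k \<gamma> \<rho> b0 b \<and>
        (\<forall>t>0. 0 < A t \<and> (\<forall>n. b t n = a_coeff k \<gamma> (A t) \<rho> n * (1 + \<epsilon> t n))) \<and>
        (\<forall>t>0. weighted_sup_norm \<beta> (\<epsilon> t)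
                 \<le> ereal ((1 + t powr (- ((\<beta> - 1) / \<beta>))) * exp (- \<nu> * t))) \<and>
        (\<forall>t>0. A differentiable (at t) \<and>
               \<bar>deriv A t\<bar> \<le> (1 + t powr (- ((\<beta> - 1) / \<beta>))) * exp (- \<nu> * t)) \<and>
        (A \<longlongrightarrow> A_of_mass k \<gamma> \<rho> M) at_top)"
      by (rule stability_for_fixed_offset[OF \<rho> _ _ net]) (use AM[OF \<rho>] in blast)+
  qed
qed

end
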